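(* Let $n\ge2$ and let $X^!$ be the cotangent bundle of the variety of full flags in $\mathbb C^n$. Let $s=(s_1,\dots,s_{n-1})\in\mathbb R^{n-1}$ be a big enough slope which is generic, i.e. $s_i+s_{i+1}+\dots+s_j\notin\mathbb Z$ for all $1\le i\le j\le n-1$. Then for every permutation $I^!$ of $\{1,\dots,n\}$ the index vertex $\mathsf{Ind}^{!s}_{I^!}$ is (the power series expansion in $z_1^!,\dots,z_{n-1}^!$ of) a rational function of $a_1^!,\dots,a_{n-1}^!$, $z_1^!,\dots,z_{n-1}^!$ and $\sqrt{\hbar^!}$, with coefficients in $\mathbb C(q^{1/2})$.
   Context: **Big enough.** $s$ is *big enough* if $s_i>0$ for all $i$ and $s_i+s_{i+1}+\dots+s_j>j-i-1$ for all $j\ge i$. **The variety $X^!$.** $X^!$ is the Nakajima quiver variety $\mu^{-1}(0)^{\theta\text{-ss}}/\prod_{i=1}^{n-1}GL(V_i)$ with $\dim V_i=i$ ($1\le i\le n-1$), framing $V_n=\mathbb{C}^n$, maps $A_i:V_i\to V_{i+1}$, $B_i:V_{i+1}\to V_i$, moment map $\mu$, semistability meaning that all $A_i$ are injective. $(\mathbb{C}^\times)^n$ with coordinates $u^!_1,\dots,u^!_n$ acts via $V_n$ (the basis vector $e_i$ has weight $u^!_i$); $\mathsf A^!$ is its quotient by the diagonal, with coordinates $a^!_i=u^!_i/u^!_{i+1}$. $\mathbb{C}^\times_{\hbar^!}$ scales the $B_i$ by $(\hbar^!)^{-1}$, and $\mathsf T^!=\mathsf A^!\times\mathbb C^\times_{\hbar^!}$.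 The $\mathsf T^!$-fixed points are indexed by permutations $I=(I_1,\dots,I_n)$: the flag with $V_i/V_{i-1}=\mathrm{Span}\{e_{I_i}\}$. The polarization at $I$ is $T^{1/2}_IX^!=\sum_{j<k}u^!_{I_k}/u^!_{I_j}$. The $z_i^!$ are formal (Kähler) variables. **Index vertex for generic $s$.** $\mathbb C^\times_q$ acts on $\mathbb P^1$ by $q\cdot[x_0:x_1]=[qx_0:x_1]$, $\infty=[1:0]$. For $p\in(X^!)^{\mathsf T^!}$, $\mathsf{QM}_p=\bigsqcup_{\mathbf d}\mathsf{QM}_p^{\mathbf d}$ is the moduli space of stable quasimaps $\mathbb P^1\to X^!$ with value $p$ at $\infty$: vector bundles $\mathscr V_i$ of rank $i$ on $\mathbb P^1$ ($i\le n-1$), a trivial bundle $\mathscr V_n$ of rank $n$, and a section $f$ of $\mathscr M\oplus(\hbar^!)^{-1}\mathscr M^\vee$, $\mathscr M=\bigoplus_{i=1}^{n-1}\mathrm{Hom}(\mathscr V_i,\mathscr V_{i+1})$, satisfying the moment map equations, generically landing in the stable locus, with $f(\infty)=p$; $\mathbf d=(\deg\mathscr V_1,\dots,\deg\mathscr V_{n-1})$. $\mathsf T^!_q=\mathsf T^!\times\mathbb C_q^\times$ acts on it with isolated fixed points. At a fixed point $f$ the $\mathscr V_i$ are equivariantly sums of line bundles $w\,q^d\mathcal O(d)$, $w$ a character of $\mathsf A^!$, linearized so that $H^*(\mathbb P^1,w\,q^d\mathcal O(d))=w\frac{1-q^{d+1}}{1-q}$ for all $d\in\mathbb Z$. Let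 $\mathcal T^{1/2}=\bigoplus_{i=1}^{n-1}\mathrm{Hom}(\mathscr V_i,\mathscr V_{i+1})-\bigoplus_{i=1}^{n-1}\mathrm{End}(\mathscr V_i)$ and $\mathscr T^{1/2}=H^*(\mathbb P^1,\mathcal T^{1/2})-T_p^{1/2}X^!$, a virtual $\mathsf A^!\times\mathbb C^\times_q$-character. For generic $s$, the $s$-index $\mathcal I_s(f)$ is the number, counted with sign, of monomials of $\mathscr T^{1/2}$ which after the substitution $a_i^!=q^{s_i}$ tend to $0$ as $q\to\infty$ (i.e. become negative powers of $q$). The index vertex is $$\mathsf{Ind}^{!s}_p=\sum_{\mathbf d:\ \mathsf{QM}_p^{\mathbf d}\ne\emptyset}\ \prod_{i=1}^{n-1}(z_i^!)^{-d_i}\sum_{f\in(\mathsf{QM}_p^{\mathbf d})^{\mathsf T^!_q}}\left(\frac{\hbar^!}{q}\right)^{\mathcal I_s(f)} ,$$ a power series in the $z_i^!$ (nonempty $\mathsf{QM}_p^{\mathbf d}$ has all $d_i\le0$). *)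

theory Defs
  imports
    Complex_Main
    "HOL-Library.Poly_Mapping"
    "HOL-Library.Product_Plus"
    "HOL-Computational_Algebra.Polynomial"
    "HOL-Computational_Algebra.Fraction_Field"
    "HOL-Combinatorics.Permutations"
    "Jordan_Normal_Form.Determinant"
begin

section \<open>Slopes\<close>

definition big_enough :: "nat \<Rightarrow> (nat \<Rightarrow> real) \<Rightarrow> bool" where
  "big_enough n s \<longleftrightarrow>
     (\<forall>i\<in>{1..n-1}. s i > 0) \<and>
     (\<forall>i\<in>{1..n-1}. \<forall>j\<in>{i..n-1}. (\<Sum>k=i..j. s k) > real j - real i - 1)"

definition generic_slope :: "nat \<Rightarrow> (nat \<Rightarrow> real) \<Rightarrow> bool" where
  "generic_slope n s \<longleftrightarrow> (\<forall>i\<in>{1..n-1}. \<forall>j\<in>{i..n-1}. (\<Sum>k=i..j. s k) \<notin> \<int>)"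

section \<open>The quiver variety\<close>

text \<open>
  Vertex \<open>i\<close> carries the space of dimension \<open>i\<close> for \<open>1 \<le> i \<le> n\<close>, vertex \<open>n\<close> being the framing.
  \<open>amap r i\<close> is the \<open>(i+1) \<times> i\<close> matrix of the map from vertex \<open>i\<close> to vertex \<open>i+1\<close>, and \<open>bmap r i\<close>
  the \<open>i \<times> (i+1)\<close> matrix of the map back, for \<open>1 \<le> i < n\<close>; the values at other \<open>i\<close> are irrelevant.
  Matrix rows and columns are numbered from \<open>0\<close>, so that the basis vector $e_k$ of the framing
  has index \<open>k - 1\<close>.
\<close>

record rep =
  amap :: "nat \<Rightarrow> complex mat"
  bmap :: "nat \<Rightarrow> complex mat"

definition rep_space :: "nat \<Rightarrow> rep set" where
  "rep_space n = {r. \<forall>i\<in>{1..<n}. amap r i \<in> carrier_mat (i+1) i \<and> bmap r i \<in> carrier_mat i (i+1)}"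

definition moment_map :: "rep \<Rightarrow> nat \<Rightarrow> complex mat" where
  "moment_map r i =
     (if i = 1 then 0\<^sub>m 1 1 else amap r (i-1) * bmap r (i-1)) - bmap r i * amap r i"

definition mu_zero :: "nat \<Rightarrow> rep set" where
  "mu_zero n = {r \<in> rep_space n. \<forall>i\<in>{1..<n}. moment_map r i = 0\<^sub>m i i}"

definition semistable :: "nat \<Rightarrow> rep \<Rightarrow> bool" where
  "semistable n r \<longleftrightarrow> (\<forall>i\<in>{1..<n}. inj_on (\<lambda>v. amap r i *\<^sub>v v) (carrier_vec i))"

text \<open>A base change fixes the framing, hence the identity matrix at vertex \<open>n\<close>.\<close>

definition frame_fixing :: "nat \<Rightarrow> (nat \<Rightarrow> complex mat) \<Rightarrow> nat \<Rightarrow> complex mat" where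
  "frame_fixing n h i = (if i = n then 1\<^sub>m n else h i)"

definition intertwines :: "nat \<Rightarrow> (nat \<Rightarrow> complex mat) \<Rightarrow> rep \<Rightarrow> rep \<Rightarrow> bool" where
  "intertwines n h r r' \<longleftrightarrow> (\<forall>i\<in>{1..<n}.
     amap r' i * frame_fixing n h i = frame_fixing n h (i+1) * amap r i \<and>
     bmap r' i * frame_fixing n h (i+1) = frame_fixing n h i * bmap r i)"

definition gauge_rel :: "nat \<Rightarrow> (rep \<times> rep) set" where
  "gauge_rel n = {(r, r'). r \<in> mu_zero n \<and> r' \<in> mu_zero n \<and>
     semistable n r \<and> semistable n r' \<and>
     (\<exists>h. (\<forall>i\<in>{1..<n}. h i \<in> carrier_mat i i \<and> det (h i) \<noteq> 0) \<and> intertwines n h r r')}"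

definition quiver_variety :: "nat \<Rightarrow> rep set set" where
  "quiver_variety n = {r \<in> mu_zero n. semistable n r} // gauge_rel n"

text \<open>
  The flag spanned successively by $e_{I_1}, e_{I_2}, \dots$, in the bases
  $(e_{I_1},\dots,e_{I_i})$ of its members.
\<close>

definition flag_rep :: "nat \<Rightarrow> (nat \<Rightarrow> nat) \<Rightarrow> rep" where
  "flag_rep n I = \<lparr>
     amap = (\<lambda>i. mat (i+1) i (\<lambda>(k, l).
       if i + 1 = n then (if k + 1 = I (l + 1) then 1 else 0)
       else (if k = l then 1 else 0))),
     bmap = (\<lambda>i. 0\<^sub>m i (i+1)) \<rparr>"

definition flag_point :: "nat \<Rightarrow> (nat \<Rightarrow> nat) \<Rightarrow> rep set" where
  "flag_point n I = gauge_rel n `` {flag_rep n I}"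

lemma flag_point_in_quiver_variety:
  assumes I: "I permutes {1..n}"
  shows "flag_point n I \<in> quiver_variety n"
proof -
  have "flag_rep n I \<in> mu_zero n"
    by (auto simp: mu_zero_def rep_space_def moment_map_def flag_rep_def)
  moreover have "semistable n (flag_rep n I)"
    unfolding semistable_def
  proof (intro ballI inj_onI)
    fix i v w
    let ?A = "amap (flag_rep n I) i"
    assume i: "i \<in> {1..<n}" and v: "v \<in> carrier_vec i" and w: "w \<in> carrier_vec i"
      and eq: "?A *\<^sub>v v = ?A *\<^sub>v w"
    show "v = w"
    proof (rule eq_vecI)
      fix l assume "l < dim_vec w"
      with w have l: "l < i" by auto
      define k where "k = (if i + 1 = n then I (l + 1) - 1 else l)"
      have Ib: "I (m + 1) \<ge> 1" "I (m + 1) \<le> n" if "m < i" for m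
        using permutes_in_image[OF I, of "m + 1"] that i by auto
      have inj: "I (m + 1) = I (l + 1) \<longleftrightarrow> m = l" for m
        using permutes_inj[OF I] by (auto simp: inj_eq)
      have k: "k < i + 1"
        using l i Ib[OF l] by (auto simp: k_def)
      have "row ?A k = unit_vec i l"
      proof (rule eq_vecI)
        fix m assume "m < dim_vec (unit_vec i l)"
        then have m: "m < i" by simp
        show "row ?A k $ m = unit_vec i l $ m"
          using k l m Ib[OF l] inj[of m] by (auto simp: flag_rep_def k_def)
      qed (simp add: flag_rep_def)
      then have "(?A *\<^sub>v x) $ k = x $ l" if "x \<in> carrier_vec i" for x
        using that k l by (simp add: flag_rep_def)
      from this[OF v] this[OF w] eq show "v $ l = w $ l" by simp
    qed (use v w in auto)
  qed
  ultimately show ?thesis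
    by (auto simp: flag_point_def quiver_variety_def intro: quotientI)
qed

text \<open>
  The torus acts through the weights \<open>u 1, \<dots>, u n\<close> on the framing and scales the \<open>bmap\<close>s by the
  inverse of \<open>h\<close>. The diagonal of the framing torus acts trivially on the quiver variety and on
  quasimaps up to isomorphism, so fixed points of the torus and of its quotient coincide.
\<close>

definition torus_rep :: "nat \<Rightarrow> (nat \<Rightarrow> complex) \<Rightarrow> complex \<Rightarrow> rep \<Rightarrow> rep" where
  "torus_rep n u h r = \<lparr>
     amap = (\<lambda>i. if i + 1 = n then mat_diag n (\<lambda>k. u (k+1)) * amap r i else amap r i),
     bmap = (\<lambda>i. inverse h \<cdot>\<^sub>m
       (if i + 1 = n then bmap r i * mat_diag n (\<lambda>k. inverse (u (k+1))) else bmap r i)) \<rparr>"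

section \<open>Quasimaps from the projective line\<close>

text \<open>
  Let $x = x_0/x_1$ and $y = 1/x$, so that \<open>\<infinity>\<close> is $y = 0$. As every vector bundle on the affine
  line is trivial, a vector bundle of rank \<open>r\<close> on the projective line is given by a transition
  matrix \<open>g\<close> of regular functions on $x \neq 0$ with values in $GL_r$: coordinates \<open>v\<close> in the
  frame over the chart of \<open>x\<close> become \<open>g x v\<close> in the frame over the chart of \<open>y\<close>.
  The bundle $\mathcal O(d)$ has transition function $x^{-d}$.
\<close>

definition regular_mat :: "nat \<Rightarrow> nat \<Rightarrow> (complex \<Rightarrow> complex mat) \<Rightarrow> bool" where
  "regular_mat r c M \<longleftrightarrow> (\<forall>x. M x \<in> carrier_mat r c) \<and>
     (\<forall>k<r. \<forall>l<c. \<exists>p. \<forall>x. M x $$ (k, l) = poly p x)"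

definition transition_mat :: "nat \<Rightarrow> (complex \<Rightarrow> complex mat) \<Rightarrow> bool" where
  "transition_mat r g \<longleftrightarrow> (\<forall>x. x \<noteq> 0 \<longrightarrow> g x \<in> carrier_mat r r \<and> det (g x) \<noteq> 0) \<and>
     (\<forall>k<r. \<forall>l<r. \<exists>p m. \<forall>x. x \<noteq> 0 \<longrightarrow> g x $$ (k, l) = poly p x / x ^ m)"

definition bundle_degree :: "(complex \<Rightarrow> complex mat) \<Rightarrow> int" where
  "bundle_degree g = (THE d. \<exists>c. c \<noteq> 0 \<and> (\<forall>x. x \<noteq> 0 \<longrightarrow> det (g x) = c * x powi (- d)))"

text \<open>
  A quasimap consists of the transition matrices of its bundles (\<open>transition f n\<close> belonging to the
  trivial bundle at the framing) and of the section, written in the frames of the two charts.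
\<close>

record quasimap =
  transition :: "nat \<Rightarrow> complex \<Rightarrow> complex mat"
  sect0 :: "complex \<Rightarrow> rep"
  sectinf :: "complex \<Rightarrow> rep"

definition regular_section :: "nat \<Rightarrow> (complex \<Rightarrow> rep) \<Rightarrow> bool" where
  "regular_section n \<phi> \<longleftrightarrow> (\<forall>i\<in>{1..<n}.
     regular_mat (i+1) i (\<lambda>x. amap (\<phi> x) i) \<and> regular_mat i (i+1) (\<lambda>x. bmap (\<phi> x) i))"

text \<open>
  In the last condition the point \<open>\<infinity>\<close> may be left aside, as all but finitely many points of the
  projective line are required to be mapped to the stable locus.
\<close>

definition is_quasimap :: "nat \<Rightarrow> quasimap \<Rightarrow> bool" where
  "is_quasimap n f \<longleftrightarrow>
     (\<forall>i\<in>{1..<n}. transition_mat i (transition f i)) \<and>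
     (\<forall>x. x \<noteq> 0 \<longrightarrow> transition f n x = 1\<^sub>m n) \<and>
     regular_section n (sect0 f) \<and> regular_section n (sectinf f) \<and>
     (\<forall>x. x \<noteq> 0 \<longrightarrow> intertwines n (\<lambda>i. transition f i x) (sect0 f x) (sectinf f (1 / x))) \<and>
     (\<forall>x. sect0 f x \<in> mu_zero n) \<and> (\<forall>y. sectinf f y \<in> mu_zero n) \<and>
     finite {x. \<not> semistable n (sect0 f x)}"

definition quasimaps_at :: "nat \<Rightarrow> rep set \<Rightarrow> quasimap set" where
  "quasimaps_at n p = {f. is_quasimap n f \<and> sectinf f 0 \<in> p}"

text \<open>Isomorphisms of quasimaps are given by base changes of the bundles over the two charts.\<close>

definition qm_iso_via ::
    "nat \<Rightarrow> (nat \<Rightarrow> complex \<Rightarrow> complex mat) \<Rightarrow> (nat \<Rightarrow> complex \<Rightarrow> complex mat) \<Rightarrow>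
     quasimap \<Rightarrow> quasimap \<Rightarrow> bool" where
  "qm_iso_via n h0 hinf f f' \<longleftrightarrow>
     (\<forall>i\<in>{1..<n}. regular_mat i i (h0 i) \<and> regular_mat i i (hinf i) \<and>
        (\<forall>x. det (h0 i x) \<noteq> 0 \<and> det (hinf i x) \<noteq> 0) \<and>
        (\<forall>x. x \<noteq> 0 \<longrightarrow> hinf i (1 / x) * transition f i x = transition f' i x * h0 i x)) \<and>
     (\<forall>x. intertwines n (\<lambda>i. h0 i x) (sect0 f x) (sect0 f' x)) \<and>
     (\<forall>y. intertwines n (\<lambda>i. hinf i y) (sectinf f y) (sectinf f' y))"

definition QM :: "nat \<Rightarrow> rep set \<Rightarrow> quasimap set set" where
  "QM n p = quasimaps_at n p //
     {(f, f'). f \<in> quasimaps_at n p \<and> f' \<in> quasimaps_at n p \<and>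
        (\<exists>h0 hinf. qm_iso_via n h0 hinf f f')}"

definition QM_degree :: "nat \<Rightarrow> rep set \<Rightarrow> (nat \<Rightarrow> int) \<Rightarrow> quasimap set set" where
  "QM_degree n p d = {F \<in> QM n p. \<forall>f\<in>F. \<forall>i\<in>{1..<n}. bundle_degree (transition f i) = d i}"

text \<open>
  As \<open>q\<close> maps the point \<open>x\<close> to \<open>q x\<close>, the translate of a quasimap \<open>f\<close> has at \<open>x\<close> the value of
  \<open>f\<close> at \<open>x / q\<close>; in the other chart, \<open>y\<close> is mapped to \<open>y / q\<close>.
\<close>

definition torus_qm ::
    "nat \<Rightarrow> (nat \<Rightarrow> complex) \<Rightarrow> complex \<Rightarrow> complex \<Rightarrow> quasimap \<Rightarrow> quasimap" where
  "torus_qm n u h q f = \<lparr>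
     transition = (\<lambda>i x. transition f i (x / q)),
     sect0 = (\<lambda>x. torus_rep n u h (sect0 f (x / q))),
     sectinf = (\<lambda>y. torus_rep n u h (sectinf f (q * y))) \<rparr>"

definition torus_point :: "nat \<Rightarrow> (nat \<Rightarrow> complex) \<Rightarrow> complex \<Rightarrow> complex \<Rightarrow> bool" where
  "torus_point n u h q \<longleftrightarrow> (\<forall>k\<in>{1..n}. u k \<noteq> 0) \<and> h \<noteq> 0 \<and> q \<noteq> 0"

definition torus_fixed :: "nat \<Rightarrow> quasimap set \<Rightarrow> bool" where
  "torus_fixed n F \<longleftrightarrow> (\<forall>u h q. torus_point n u h q \<longrightarrow> (\<forall>f\<in>F. torus_qm n u h q f \<in> F))"

section \<open>Characters\<close>

text \<open>
  A character of the framing torus is given by the exponents of \<open>u 1, \<dots>, u n\<close>. A virtual character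
  of this torus times the torus of \<open>q\<close> is a Laurent polynomial with integer coefficients, i.e. an
  element of the group ring of pairs (exponents of the \<open>u k\<close>, exponent of \<open>q\<close>).
\<close>

type_synonym weight = "nat \<Rightarrow>\<^sub>0 int"
type_synonym virtual_char = "(weight \<times> int) \<Rightarrow>\<^sub>0 int"

definition u_weight :: "nat \<Rightarrow> weight" where
  "u_weight k = Poly_Mapping.single k 1"

definition eval_weight :: "nat \<Rightarrow> weight \<Rightarrow> (nat \<Rightarrow> complex) \<Rightarrow> complex" where
  "eval_weight n w u = (\<Prod>k=1..n. u k powi Poly_Mapping.lookup w k)"

definition monomial :: "weight \<Rightarrow> int \<Rightarrow> virtual_char" where
  "monomial w m = Poly_Mapping.single (w, m) 1"

text \<open>
  The cohomology of $w\,q^d \mathcal O(d)$, that is, the Laurent polynomial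
  $w\,(1 - q^{d+1})/(1 - q)$; see the lemma that follows.
\<close>

definition line_cohomology :: "weight \<Rightarrow> int \<Rightarrow> virtual_char" where
  "line_cohomology w d = (\<Sum>m\<in>{0..d}. monomial w m) - (\<Sum>m\<in>{d+1..-1}. monomial w m)"

lemma monomial_mult: "monomial w m * monomial w' m' = monomial (w + w') (m + m')"
  by (simp add: monomial_def mult_single)

lemma line_cohomology_step: "line_cohomology w (d + 1) = line_cohomology w d + monomial w (d + 1)"
proof (cases "d + 1 \<ge> 0")
  case True
  then have "{0..d+1} = insert (d+1) {0..d}" "{d+1..-1} = {}" "{d+1+1..-1} = {}"
    by auto
  then show ?thesis
    by (simp add: line_cohomology_def)
next
  case False
  then have "{0..d+1} = {}" "{0..d} = {}" "{d+1..-1} = insert (d+1) {d+1+1..-1}"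
    by auto
  then show ?thesis
    by (simp add: line_cohomology_def)
qed

lemma line_cohomology_eq:
  "line_cohomology w d * (1 - monomial 0 1) = monomial w 0 * (1 - monomial 0 (d + 1))"
proof (induction d rule: int_induct[where k = "-1"])
  case base
  have "monomial 0 0 = 1"
    by (simp add: monomial_def zero_prod_def[symmetric])
  then show ?case
    by (simp add: line_cohomology_def)
next
  case (step1 i)
  then show ?case
    unfolding line_cohomology_step distrib_right by (simp add: right_diff_distrib monomial_mult)
next
  case (step2 i)
  have "line_cohomology w (i - 1) = line_cohomology w i - monomial w i"
    using line_cohomology_step[of w "i - 1"] by simp
  then have "line_cohomology w (i - 1) * (1 - monomial 0 1) =
      line_cohomology w i * (1 - monomial 0 1) - monomial w i * (1 - monomial 0 1)"
    by (simp only: left_diff_distrib)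
  also have "\<dots> = monomial w 0 * (1 - monomial 0 (i - 1 + 1))"
    unfolding step2.IH by (simp add: right_diff_distrib monomial_mult add.commute)
  finally show ?case .
qed

text \<open>
  An equivariant splitting of a quasimap \<open>f\<close> fixed by the torus: in the frames of \<open>f\<close>, the bundle
  at vertex \<open>i\<close> is the direct sum over \<open>j < i\<close> of the line bundles
  $w_{ij}\,q^{d_{ij}} \mathcal O(d_{ij})$. These are linearized by $w_{ij}\,q^{d_{ij}}$ on the frame
  near $x = 0$ and by $w_{ij}$ on the frame near $\infty$ (by localization, this is the linearization
  whose cohomology is as above), and the section has to be equivariant, the framing having the
  weights \<open>u 1, \<dots>, u n\<close>.
\<close>

definition equivariant_splitting ::
    "nat \<Rightarrow> quasimap \<Rightarrow> (nat \<Rightarrow> nat \<Rightarrow> weight) \<Rightarrow> (nat \<Rightarrow> nat \<Rightarrow> int) \<Rightarrow> bool" where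
  "equivariant_splitting n f w d \<longleftrightarrow>
     (\<forall>j<n. w n j = u_weight (j+1) \<and> d n j = 0) \<and>
     (\<forall>i\<in>{1..<n}. \<forall>j<i. Poly_Mapping.keys (w i j) \<subseteq> {1..n}) \<and>
     (\<forall>i\<in>{1..<n}. \<forall>x. x \<noteq> 0 \<longrightarrow> transition f i x = mat_diag i (\<lambda>j. x powi (- d i j))) \<and>
     (\<forall>u h q. torus_point n u h q \<longrightarrow>
        qm_iso_via n
          (\<lambda>i _. mat_diag i (\<lambda>j. eval_weight n (w i j) u * q powi d i j))
          (\<lambda>i _. mat_diag i (\<lambda>j. eval_weight n (w i j) u))
          (torus_qm n u h q f) f)"

text \<open>
  The cohomology of $\bigoplus_i \mathrm{Hom}(\mathscr V_i, \mathscr V_{i+1}) -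
  \bigoplus_i \mathrm{End}(\mathscr V_i)$ for bundles split as above.
\<close>

definition polarization_cohomology ::
    "nat \<Rightarrow> (nat \<Rightarrow> nat \<Rightarrow> weight) \<Rightarrow> (nat \<Rightarrow> nat \<Rightarrow> int) \<Rightarrow> virtual_char" where
  "polarization_cohomology n w d =
     (\<Sum>i=1..n-1. \<Sum>j<i. \<Sum>k<i+1. line_cohomology (w (i+1) k - w i j) (d (i+1) k - d i j)) -
     (\<Sum>i=1..n-1. \<Sum>j<i. \<Sum>k<i. line_cohomology (w i k - w i j) (d i k - d i j))"

definition polarization_at :: "nat \<Rightarrow> (nat \<Rightarrow> nat) \<Rightarrow> virtual_char" where
  "polarization_at n I =
     (\<Sum>k=1..n. \<Sum>j\<in>{1..<k}. monomial (u_weight (I k) - u_weight (I j)) 0)"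

definition virtual_half_tangent :: "nat \<Rightarrow> (nat \<Rightarrow> nat) \<Rightarrow> quasimap set \<Rightarrow> virtual_char" where
  "virtual_half_tangent n I F =
     (THE \<chi>. \<exists>f\<in>F. \<exists>w d. equivariant_splitting n f w d \<and>
        \<chi> = polarization_cohomology n w d - polarization_at n I)"

section \<open>The index vertex\<close>

text \<open>
  Only weights \<open>w\<close> with exponents of sum zero occur below. With $a_i = u_i/u_{i+1}$ one has
  $\prod_k u_k^{w_k} = \prod_{i<n} a_i^{w_1 + \dots + w_i}$ for these.
\<close>

definition decays :: "nat \<Rightarrow> (nat \<Rightarrow> real) \<Rightarrow> weight \<times> int \<Rightarrow> bool" where
  "decays n s = (\<lambda>(w, m).
     ((\<lambda>q::real. (\<Prod>i=1..n-1. (q powr s i) powi (\<Sum>k=1..i. Poly_Mapping.lookup w k)) * q powi m) \<longlongrightarrow> 0) at_top)"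

definition s_index :: "nat \<Rightarrow> (nat \<Rightarrow> real) \<Rightarrow> (nat \<Rightarrow> nat) \<Rightarrow> quasimap set \<Rightarrow> int" where
  "s_index n s I F =
     (\<Sum>\<kappa>\<in>{\<kappa> \<in> Poly_Mapping.keys (virtual_half_tangent n I F). decays n s \<kappa>}.
        Poly_Mapping.lookup (virtual_half_tangent n I F) \<kappa>)"

text \<open>
  \<open>q_field\<close> is the field of rational functions of $q^{1/2}$. In \<open>param_poly\<close>, polynomials over this
  field, the variable with number \<open>0\<close> is $\sqrt\hbar$, and the one with number \<open>i \<ge> 1\<close> is $a_i$.
\<close>

type_synonym q_field = "complex poly fract"
type_synonym param_poly = "(nat \<Rightarrow>\<^sub>0 nat) \<Rightarrow>\<^sub>0 q_field"
type_synonym param_field = "param_poly fract"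

definition sqrt_q :: q_field where
  "sqrt_q = Fract [:0, 1:] 1"

definition of_param_poly :: "param_poly \<Rightarrow> param_field" where
  "of_param_poly p = Fract p 1"

definition q_param :: param_field where
  "q_param = of_param_poly (Poly_Mapping.single 0 (sqrt_q ^ 2))"

definition sqrt_hbar :: param_field where
  "sqrt_hbar = of_param_poly (Poly_Mapping.single (Poly_Mapping.single 0 1) 1)"

definition hbar :: param_field where
  "hbar = sqrt_hbar ^ 2"

text \<open>
  Power series in \<open>z 1, \<dots>, z (n-1)\<close> are given by their coefficients; the coefficient at the
  exponents \<open>\<gamma>\<close> comes from the degrees $d_i = -\gamma_i$.
\<close>

type_synonym z_series = "(nat \<Rightarrow>\<^sub>0 nat) \<Rightarrow> param_field"

definition index_vertex :: "nat \<Rightarrow> (nat \<Rightarrow> real) \<Rightarrow> (nat \<Rightarrow> nat) \<Rightarrow> z_series" where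
  "index_vertex n s I \<gamma> =
     (if Poly_Mapping.keys \<gamma> \<subseteq> {1..n-1}
      then \<Sum>F\<in>{F \<in> QM_degree n (flag_point n I) (\<lambda>i. - int (Poly_Mapping.lookup \<gamma> i)). torus_fixed n F}.
             (hbar / q_param) powi s_index n s I F
      else 0)"

section \<open>Expansions of rational functions\<close>

text \<open>
  \<open>P\<close> and \<open>Q\<close> are polynomials in the \<open>z i\<close> whose coefficients are polynomials in the $a_i$ and
  $\sqrt\hbar$. The rational function \<open>P/Q\<close> has a power series expansion if the constant term of \<open>Q\<close>,
  a polynomial in the $a_i$ and $\sqrt\hbar$, is not zero; the last condition is \<open>Q * S = P\<close>.
\<close>

type_synonym z_poly = "(nat \<Rightarrow>\<^sub>0 nat) \<Rightarrow>\<^sub>0 param_poly"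

definition admissible_vars :: "nat \<Rightarrow> z_poly \<Rightarrow> bool" where
  "admissible_vars n P \<longleftrightarrow> (\<forall>\<gamma>\<in>Poly_Mapping.keys P. Poly_Mapping.keys \<gamma> \<subseteq> {1..n-1} \<and>
     (\<forall>\<alpha>\<in>Poly_Mapping.keys (Poly_Mapping.lookup P \<gamma>). Poly_Mapping.keys \<alpha> \<subseteq> {0..n-1}))"

definition is_rational_expansion :: "nat \<Rightarrow> z_series \<Rightarrow> bool" where
  "is_rational_expansion n S \<longleftrightarrow> (\<exists>P Q :: z_poly.
     admissible_vars n P \<and> admissible_vars n Q \<and> Poly_Mapping.lookup Q 0 \<noteq> 0 \<and>
     (\<forall>\<gamma>. (\<Sum>(\<alpha>, \<beta>)\<in>{(\<alpha>, \<beta>). \<alpha> + \<beta> = \<gamma>}. of_param_poly (Poly_Mapping.lookup Q \<alpha>) * S \<beta>) =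
            of_param_poly (Poly_Mapping.lookup P \<gamma>)))"

end

theory Submission
  imports
    Defs
    "HOL-Computational_Algebra.Fundamental_Theorem_Algebra"
begin

text \<open>
  Up to isomorphism, a quasimap fixed by the torus is the one for which the columns of the map from
  vertex $i$ to the framing are $x^{m(i,j)} e_{I_j}$ near $x = 0$, where $m(i+1,j) \le m(i,j)$. Indeed,
  invariance under scaling forces the $B_i$ to vanish, and invariance under one sufficiently generic
  torus element makes the column modules of these maps monomial over both charts.

  A line bundle $w\,q^d \mathcal O(d)$ contributes $\min(d+1, c) - \min(0, c)$ to the index, with $c$
  depending only on $w$ and $s$. So the index vertex is the sum of $(\hbar/q)^{\varphi(m)} z^m$ over the
  arrays $m$, with $\varphi$ a sum of terms $\pm\min(m_\alpha - m_\beta + 1, c)$. If the entries of $m$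
  in a set $U$ exceed all others by a large gap, then increasing them by one multiplies the
  coefficient by a factor $\lambda_U$ that depends only on $U$. Hence the product of the
  $1 - \lambda_U z^U$ over all $U$ is a denominator.
\<close>

section \<open>Rational power series\<close>

text \<open>Increasing the entries in U by one leaves a difference m_\<alpha> - m_\<beta> unchanged
  unless exactly one of \<alpha>, \<beta> lies in U. In that case the gap puts the minimum on one of
  its two branches: it either stays at c or moves with the difference. This is why \<lambda>_U does
  not depend on the array. The factor 1 - \<lambda>_U z^U cancels the weights of all arrays with a
  gap at U, and an array without a gap at any nonempty U has bounded entries, so only finitely many
  terms survive the full product. On the geometric side, a fixed isomorphism class provides, for
  each torus element separately, some isomorphism from the translate; nothing links the isomorphisms
  for different elements. The classification therefore uses single elements: one built from the
  coprime numbers 3 and 2, and one that scales only the B_i. Since the index is read off from an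
  arbitrary equivariant splitting, its independence of the splitting has to be proved too. All
  comparisons go through the composite maps to the framing, where base changes are trivial.\<close>

lemma of_param_poly_0 [simp]: "of_param_poly 0 = 0"
  and of_param_poly_1 [simp]: "of_param_poly 1 = 1"
  and of_param_poly_add: "of_param_poly (p + p') = of_param_poly p + of_param_poly p'"
  and of_param_poly_mult: "of_param_poly (p * p') = of_param_poly p * of_param_poly p'"
  and of_param_poly_uminus: "of_param_poly (- p) = - of_param_poly p"
  by (simp_all add: of_param_poly_def Zero_fract_def One_fract_def)

lemma of_param_poly_eq_iff: "of_param_poly p = of_param_poly p' \<longleftrightarrow> p = p'"
  by (simp add: of_param_poly_def eq_fract)

section \<open>Laurent polynomials in the square root of hbar\<close>

text \<open>The weights of the fixed points are powers of hbar/q, so the a_i never enter. Variable 0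
  being sqrt hbar, the coefficients of numerator and denominator can be kept in this subring, which
  is inside what \<open>admissible_vars\<close> permits.\<close>

definition hbar_polys :: "param_poly set" where
  "hbar_polys = {p. \<forall>\<alpha>\<in>Poly_Mapping.keys p. Poly_Mapping.keys \<alpha> \<subseteq> {0}}"

lemma hbar_polys_0 [simp]: "0 \<in> hbar_polys"
  and hbar_polys_1 [simp]: "1 \<in> hbar_polys"
  by (simp_all add: hbar_polys_def)

lemma hbar_polys_add: "p \<in> hbar_polys \<Longrightarrow> p' \<in> hbar_polys \<Longrightarrow> p + p' \<in> hbar_polys"
  using keys_add[of p p'] by (auto simp: hbar_polys_def)

lemma hbar_polys_uminus: "p \<in> hbar_polys \<Longrightarrow> - p \<in> hbar_polys"
  by (auto simp: hbar_polys_def in_keys_iff)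

lemma hbar_polys_mult:
  assumes "p \<in> hbar_polys" "p' \<in> hbar_polys"
  shows "p * p' \<in> hbar_polys"
  unfolding hbar_polys_def
proof (rule CollectI, intro ballI)
  fix \<alpha> assume "\<alpha> \<in> Poly_Mapping.keys (p * p')"
  then obtain a b where "a \<in> Poly_Mapping.keys p" "b \<in> Poly_Mapping.keys p'" "\<alpha> = a + b"
    using keys_mult[of p p'] by blast
  then show "Poly_Mapping.keys \<alpha> \<subseteq> {0}"
    using assms keys_add[of a b] unfolding hbar_polys_def by fast
qed

lemma hbar_polys_single: "Poly_Mapping.single (Poly_Mapping.single 0 k) c \<in> hbar_polys"
  by (auto simp: hbar_polys_def split: if_splits)

lemma hbar_pow: "hbar ^ k = of_param_poly (Poly_Mapping.single (Poly_Mapping.single 0 (2 * k)) 1)"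
proof (induction k)
  case 0
  then show ?case by simp
next
  case (Suc k)
  have "hbar ^ Suc k = of_param_poly (Poly_Mapping.single
      (Poly_Mapping.single 0 1 + Poly_Mapping.single 0 1 + Poly_Mapping.single 0 (2 * k)) (1 * 1 * 1))"
    unfolding power_Suc Suc by (simp only: hbar_def sqrt_hbar_def power2_eq_square
        of_param_poly_mult[symmetric] mult_single)
  also have "Poly_Mapping.single 0 1 + Poly_Mapping.single 0 1 + Poly_Mapping.single 0 (2 * k) =
      Poly_Mapping.single (0 :: nat) (2 * Suc k)"
    unfolding single_add[symmetric] by simp
  finally show ?case by simp
qed

lemma hbar_nonzero: "hbar \<noteq> 0"
proof
  assume "hbar = 0"
  then have "of_param_poly (Poly_Mapping.single (Poly_Mapping.single 0 2) 1) = of_param_poly 0"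
    using hbar_pow[of 1] by simp
  then have "Poly_Mapping.single (Poly_Mapping.single 0 2) (1 :: q_field) = (0 :: param_poly)"
    by (simp only: of_param_poly_eq_iff)
  then have "Poly_Mapping.lookup (Poly_Mapping.single (Poly_Mapping.single 0 2) (1 :: q_field) :: param_poly)
      (Poly_Mapping.single 0 2) = 0"
    by (simp only: lookup_zero)
  then show False by simp
qed

text \<open>The index may be negative, hence Laurent polynomials. Powers of hbar are the only
  denominators that occur, as q lies in the coefficient field.\<close>

definition hbar_laurent :: "param_field set" where
  "hbar_laurent = {f. \<exists>k. \<exists>p\<in>hbar_polys. hbar ^ k * f = of_param_poly p}"

lemma hbar_power_polys: "\<exists>p\<in>hbar_polys. hbar ^ k = of_param_poly p"
  using hbar_pow hbar_polys_single by blast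

lemma hbar_laurent_mono:
  assumes "\<exists>p\<in>hbar_polys. hbar ^ k * f = of_param_poly p" "k \<le> k'"
  shows "\<exists>p\<in>hbar_polys. hbar ^ k' * f = of_param_poly p"
proof -
  obtain p where p: "p \<in> hbar_polys" "hbar ^ k * f = of_param_poly p" using assms by blast
  obtain p' where p': "p' \<in> hbar_polys" "hbar ^ (k' - k) = of_param_poly p'"
    using hbar_power_polys by blast
  have "hbar ^ k' * f = hbar ^ (k' - k) * (hbar ^ k * f)"
    using assms(2) by (simp add: mult.assoc[symmetric] power_add[symmetric])
  also have "\<dots> = of_param_poly (p' * p)" using p p' by (simp add: of_param_poly_mult)
  finally show ?thesis using p p' hbar_polys_mult by blast
qed

text \<open>The larger of two exponents serves both elements, by \<open>hbar_laurent_mono\<close>.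
  This clears the coefficients of a series with finite support all at once.\<close>

lemma hbar_laurent_common:
  assumes "finite A" "A \<subseteq> hbar_laurent"
  shows "\<exists>k. \<forall>f\<in>A. \<exists>p\<in>hbar_polys. hbar ^ k * f = of_param_poly p"
  using assms
proof (induction A)
  case (insert f A)
  then obtain k l where k: "\<forall>f\<in>A. \<exists>p\<in>hbar_polys. hbar ^ k * f = of_param_poly p"
    and l: "\<exists>p\<in>hbar_polys. hbar ^ l * f = of_param_poly p"
    by (auto simp: hbar_laurent_def)
  show ?case
  proof (intro exI[of _ "max k l"] ballI)
    fix g assume "g \<in> insert f A"
    then show "\<exists>p\<in>hbar_polys. hbar ^ max k l * g = of_param_poly p"
      using k hbar_laurent_mono[of k g "max k l"] hbar_laurent_mono[OF l, of "max k l"] by auto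
  qed
qed simp

lemma hbar_laurent_0 [simp]: "0 \<in> hbar_laurent" and hbar_laurent_1 [simp]: "1 \<in> hbar_laurent"
proof -
  have "hbar ^ 0 * 0 = of_param_poly 0" "hbar ^ 0 * 1 = of_param_poly 1" by simp_all
  then show "0 \<in> hbar_laurent" "1 \<in> hbar_laurent"
    unfolding hbar_laurent_def using hbar_polys_0 hbar_polys_1 by blast+
qed

lemma hbar_laurent_add:
  assumes "f \<in> hbar_laurent" "g \<in> hbar_laurent"
  shows "f + g \<in> hbar_laurent"
proof -
  obtain k where k: "\<forall>f\<in>{f, g}. \<exists>p\<in>hbar_polys. hbar ^ k * f = of_param_poly p"
    using hbar_laurent_common[of "{f, g}"] assms by auto
  then obtain p p' where "p \<in> hbar_polys" "hbar ^ k * f = of_param_poly p"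
    "p' \<in> hbar_polys" "hbar ^ k * g = of_param_poly p'" by auto
  then have "hbar ^ k * (f + g) = of_param_poly (p + p')" "p + p' \<in> hbar_polys"
    by (simp_all add: distrib_left of_param_poly_add hbar_polys_add)
  then show ?thesis unfolding hbar_laurent_def by blast
qed

lemma hbar_laurent_mult:
  assumes "f \<in> hbar_laurent" "g \<in> hbar_laurent"
  shows "f * g \<in> hbar_laurent"
proof -
  obtain k k' p p' where "p \<in> hbar_polys" "hbar ^ k * f = of_param_poly p"
    "p' \<in> hbar_polys" "hbar ^ k' * g = of_param_poly p'"
    using assms by (auto simp: hbar_laurent_def)
  then have "(hbar ^ k * f) * (hbar ^ k' * g) = of_param_poly (p * p')" "p * p' \<in> hbar_polys"
    by (simp_all add: of_param_poly_mult hbar_polys_mult)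
  moreover have "(hbar ^ k * f) * (hbar ^ k' * g) = hbar ^ (k + k') * (f * g)"
    by (simp add: power_add mult_ac)
  ultimately show ?thesis unfolding hbar_laurent_def by (metis (mono_tags, lifting) mem_Collect_eq)
qed

lemma hbar_laurent_sum:
  "(\<And>a. a \<in> A \<Longrightarrow> f a \<in> hbar_laurent) \<Longrightarrow> sum f A \<in> hbar_laurent"
  by (induction A rule: infinite_finite_induct) (auto intro: hbar_laurent_add)

lemma sqrt_q_nonzero: "sqrt_q \<noteq> 0"
  by (simp add: sqrt_q_def Zero_fract_def eq_fract)

text \<open>q is the square of the constant sqrt q of \<open>q_field\<close>, so its inverse is a
  constant polynomial as well; q/hbar needs one factor hbar to become polynomial.\<close>

lemma hbar_over_q_laurent: "(hbar / q_param) powi k \<in> hbar_laurent"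
proof -
  let ?c = "\<lambda>c. of_param_poly (Poly_Mapping.single 0 c)"
  have c: "?c c * ?c c' = ?c (c * c')" for c c'
    by (simp add: of_param_poly_mult[symmetric] mult_single)
  have cin: "?c c \<in> hbar_laurent" for c
    unfolding hbar_laurent_def using hbar_polys_single[of 0 c] by (auto intro!: exI[of _ 0])
  have q: "q_param * ?c (1 / sqrt_q ^ 2) = 1"
    unfolding q_param_def c by (simp add: sqrt_q_nonzero)
  then have q0: "q_param \<noteq> 0" by auto
  have "hbar \<in> hbar_laurent"
    using hbar_power_polys[of 1] unfolding hbar_laurent_def by (auto intro!: exI[of _ 0])
  moreover have "inverse q_param = ?c (1 / sqrt_q ^ 2)"
    using q q0 by (simp add: field_simps)
  ultimately have y: "hbar / q_param \<in> hbar_laurent"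
    using cin by (simp add: divide_inverse hbar_laurent_mult)
  have "hbar * (q_param / hbar) = of_param_poly (Poly_Mapping.single 0 (sqrt_q ^ 2))"
    using hbar_nonzero by (simp add: q_param_def)
  moreover have "Poly_Mapping.single 0 (sqrt_q ^ 2) \<in> hbar_polys"
    using hbar_polys_single[of 0] by simp
  ultimately have y': "q_param / hbar \<in> hbar_laurent"
    unfolding hbar_laurent_def by (intro CollectI exI[of _ 1]) auto
  have pow: "f \<in> hbar_laurent \<Longrightarrow> f ^ j \<in> hbar_laurent" for f j
    by (induction j) (auto intro: hbar_laurent_mult)
  show ?thesis
    using pow[OF y] pow[OF y'] by (auto simp: power_int_def)
qed

lemma hbar_over_q_nonzero: "hbar / q_param \<noteq> 0"
proof -
  have "q_param * of_param_poly (Poly_Mapping.single 0 (1 / sqrt_q ^ 2)) = 1"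
    unfolding q_param_def by (simp add: of_param_poly_mult[symmetric] mult_single sqrt_q_nonzero)
  then show ?thesis using hbar_nonzero by auto
qed

section \<open>Products of polynomials and power series in the z_i\<close>

text \<open>\<open>z_series\<close> is a bare function type, so the product of a polynomial with a
  series is written out; this is the left-hand side in \<open>is_rational_expansion\<close>.\<close>

definition conv :: "z_poly \<Rightarrow> z_series \<Rightarrow> z_series" where
  "conv Q S \<gamma> = (\<Sum>(\<alpha>, \<beta>)\<in>{(\<alpha>, \<beta>). \<alpha> + \<beta> = \<gamma>}. of_param_poly (Poly_Mapping.lookup Q \<alpha>) * S \<beta>)"

lemma is_rational_expansion_conv:
  "is_rational_expansion n S \<longleftrightarrow> (\<exists>P Q. admissible_vars n P \<and> admissible_vars n Q \<and>
     Poly_Mapping.lookup Q 0 \<noteq> 0 \<and> (\<forall>\<gamma>. conv Q S \<gamma> = of_param_poly (Poly_Mapping.lookup P \<gamma>)))"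
  by (simp add: is_rational_expansion_def conv_def)

text \<open>Each component of \<alpha> is at most that of \<gamma>, and \<alpha> determines \<beta>.
  Without finiteness the sums defining \<open>conv\<close> would be zero by convention.\<close>

lemma finite_splits: "finite {(\<alpha>, \<beta>). \<alpha> + \<beta> = (\<gamma> :: nat \<Rightarrow>\<^sub>0 nat)}"
proof (rule finite_imageD)
  let ?F = "{f. \<forall>i. (i \<in> Poly_Mapping.keys \<gamma> \<longrightarrow> f i \<in> {..Max (Poly_Mapping.lookup \<gamma> ` Poly_Mapping.keys \<gamma>)})
     \<and> (i \<notin> Poly_Mapping.keys \<gamma> \<longrightarrow> f i = (0 :: nat))}"
  have "finite ?F" by (intro finite_set_of_finite_funs) auto
  moreover have "(\<lambda>(\<alpha>, \<beta>). Poly_Mapping.lookup \<alpha>) ` {(\<alpha>, \<beta>). \<alpha> + \<beta> = \<gamma>} \<subseteq> ?F"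
  proof (safe)
    fix \<alpha> \<beta> :: "nat \<Rightarrow>\<^sub>0 nat" and i
    assume \<gamma>: "\<gamma> = \<alpha> + \<beta>" and i: "i \<in> Poly_Mapping.keys (\<alpha> + \<beta>)"
    have "Poly_Mapping.lookup \<alpha> i \<le> Poly_Mapping.lookup (\<alpha> + \<beta>) i" by (simp add: lookup_add)
    also have "\<dots> \<le> Max (Poly_Mapping.lookup (\<alpha> + \<beta>) ` Poly_Mapping.keys (\<alpha> + \<beta>))"
      using i by (intro Max_ge) auto
    finally show "Poly_Mapping.lookup \<alpha> i \<le> Max (Poly_Mapping.lookup (\<alpha> + \<beta>) ` Poly_Mapping.keys (\<alpha> + \<beta>))" .
  next
    fix \<alpha> \<beta> :: "nat \<Rightarrow>\<^sub>0 nat" and i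
    assume "i \<notin> Poly_Mapping.keys (\<alpha> + \<beta>)"
    then show "Poly_Mapping.lookup \<alpha> i = 0" by (simp add: in_keys_iff lookup_add)
  qed
  ultimately show "finite ((\<lambda>(\<alpha>, \<beta>). Poly_Mapping.lookup \<alpha>) ` {(\<alpha>, \<beta>). \<alpha> + \<beta> = \<gamma>})"
    using finite_subset by blast
  show "inj_on (\<lambda>(\<alpha>, \<beta>). Poly_Mapping.lookup \<alpha>) {(\<alpha>, \<beta>). \<alpha> + \<beta> = \<gamma>}"
    by (auto simp: inj_on_def poly_mapping_eq_iff[symmetric] dest: add_left_imp_eq)
qed

lemma lookup_mult_single:
  fixes Q :: z_poly
  shows "Poly_Mapping.lookup (Q * Poly_Mapping.single \<delta> c) (\<epsilon> + \<delta>) = Poly_Mapping.lookup Q \<epsilon> * c"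
    and "\<nexists>\<epsilon>. \<alpha> = \<epsilon> + \<delta> \<Longrightarrow> Poly_Mapping.lookup (Q * Poly_Mapping.single \<delta> c) \<alpha> = 0"
proof -
  have *: "Poly_Mapping.lookup (Q * Poly_Mapping.single \<delta> c) \<alpha> =
      Sum_any (\<lambda>l. Poly_Mapping.lookup Q l * (c when \<alpha> = l + \<delta>))" for \<alpha>
  proof -
    have "Sum_any (\<lambda>q. (Poly_Mapping.lookup (Poly_Mapping.single \<delta> c) q when \<alpha> = l + q)) = (c when \<alpha> = l + \<delta>)" for l
    proof -
      have "Sum_any (\<lambda>q. (Poly_Mapping.lookup (Poly_Mapping.single \<delta> c) q when \<alpha> = l + q)) =
          Sum_any (\<lambda>q. ((c when \<alpha> = l + \<delta>) when q = \<delta>))"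
        by (rule Sum_any.cong) (auto simp: lookup_single when_def)
      then show ?thesis by simp
    qed
    then show ?thesis by (simp add: lookup_mult)
  qed
  show "\<nexists>\<epsilon>. \<alpha> = \<epsilon> + \<delta> \<Longrightarrow> Poly_Mapping.lookup (Q * Poly_Mapping.single \<delta> c) \<alpha> = 0"
    unfolding * by (auto simp: when_def)
  have "Sum_any (\<lambda>l. Poly_Mapping.lookup Q l * (c when \<epsilon> + \<delta> = l + \<delta>)) =
      Sum_any (\<lambda>l. (Poly_Mapping.lookup Q l * c when l = \<epsilon>))"
    by (rule Sum_any.cong) (auto simp: when_def)
  then show "Poly_Mapping.lookup (Q * Poly_Mapping.single \<delta> c) (\<epsilon> + \<delta>) = Poly_Mapping.lookup Q \<epsilon> * c"
    unfolding * by simp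
qed

text \<open>A monomial factor may be moved from the polynomial to the series. The shifted
  coefficient is a sum over a set with at most one element, empty if z^\<delta> does not divide
  z^\<beta>; this avoids subtraction of exponents.\<close>

lemma conv_mult_single:
  "conv (Q * Poly_Mapping.single \<delta> c) S \<gamma> =
     conv Q (\<lambda>\<beta>. of_param_poly c * (\<Sum>\<beta>'\<in>{\<beta>'. \<delta> + \<beta>' = \<beta>}. S \<beta>')) \<gamma>"
proof -
  let ?T = "\<lambda>\<beta>. of_param_poly c * (\<Sum>\<beta>'\<in>{\<beta>'. \<delta> + \<beta>' = \<beta>}. S \<beta>')"
  have T: "?T (\<delta> + \<beta>) = of_param_poly c * S \<beta>" for \<beta>
    by simp
  have T0: "?T \<beta> = 0" if "\<nexists>\<beta>'. \<beta> = \<delta> + \<beta>'" for \<beta>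
  proof -
    have "{\<beta>'. \<delta> + \<beta>' = \<beta>} = {}" using that by auto
    then show ?thesis by simp
  qed
  let ?A = "{(\<epsilon>, \<beta>). \<epsilon> + \<delta> + \<beta> = \<gamma>}"
  have "conv (Q * Poly_Mapping.single \<delta> c) S \<gamma> =
     (\<Sum>(\<alpha>, \<beta>)\<in>(\<lambda>(\<epsilon>, \<beta>). (\<epsilon> + \<delta>, \<beta>)) ` ?A.
        of_param_poly (Poly_Mapping.lookup (Q * Poly_Mapping.single \<delta> c) \<alpha>) * S \<beta>)"
    unfolding conv_def
  proof (rule sum.mono_neutral_right[OF finite_splits], goal_cases)
    case 1
    then show ?case by auto
  next
    case 2
    show ?case
    proof (clarify, goal_cases)
      case (1 \<alpha> \<beta>)
      then have "\<nexists>\<epsilon>. \<alpha> = \<epsilon> + \<delta>" by force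
      then show ?case by (simp add: lookup_mult_single(2))
    qed
  qed
  also have "\<dots> = (\<Sum>(\<epsilon>, \<beta>)\<in>?A. of_param_poly (Poly_Mapping.lookup Q \<epsilon>) * ?T (\<delta> + \<beta>))"
    by (subst sum.reindex) (auto simp: inj_on_def lookup_mult_single(1) of_param_poly_mult T mult_ac intro!: sum.cong)
  also have "\<dots> = (\<Sum>(\<epsilon>, \<beta>)\<in>(\<lambda>(\<epsilon>, \<beta>). (\<epsilon>, \<delta> + \<beta>)) ` ?A. of_param_poly (Poly_Mapping.lookup Q \<epsilon>) * ?T \<beta>)"
    by (subst sum.reindex) (auto simp: inj_on_def intro!: sum.cong)
  also have "\<dots> = conv Q ?T \<gamma>"
    unfolding conv_def
  proof (rule sum.mono_neutral_left[OF finite_splits], goal_cases)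
    case 1
    then show ?case by (auto simp: add.assoc)
  next
    case 2
    show ?case
    proof (clarify, goal_cases)
      case (1 \<alpha> \<beta>)
      then have "\<nexists>\<beta>'. \<beta> = \<delta> + \<beta>'" by (force simp: add.assoc)
      then have "?T \<beta> = 0" by (rule T0)
      then show ?case by (simp only: mult_zero_right)
    qed
  qed
  finally show ?thesis .
qed

lemma conv_add_left: "conv (Q + Q') S \<gamma> = conv Q S \<gamma> + conv Q' S \<gamma>"
  unfolding conv_def
  by (simp add: lookup_add of_param_poly_add distrib_right sum.distrib split_def)

lemma conv_add_right: "conv Q (\<lambda>\<beta>. S \<beta> + S' \<beta>) \<gamma> = conv Q S \<gamma> + conv Q S' \<gamma>"
  unfolding conv_def by (simp add: distrib_left sum.distrib split_def)

lemma conv_1: "conv 1 S \<gamma> = S \<gamma>"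
proof -
  have "conv 1 S \<gamma> = (\<Sum>(\<alpha>, \<beta>)\<in>{(0, \<gamma>)}. of_param_poly (Poly_Mapping.lookup (1 :: z_poly) \<alpha>) * S \<beta>)"
    unfolding conv_def
    by (rule sum.mono_neutral_right[OF finite_splits]) (auto simp: lookup_one when_def split: if_splits)
  then show ?thesis by simp
qed

text \<open>Stronger than \<open>admissible_vars\<close>, and closed under the two operations that
  build denominators: sums, and multiplication by a monomial with coefficient in
  \<open>hbar_polys\<close>.\<close>

definition z_admissible :: "nat \<Rightarrow> z_poly \<Rightarrow> bool" where
  "z_admissible n P \<longleftrightarrow> (\<forall>\<gamma>\<in>Poly_Mapping.keys P. Poly_Mapping.keys \<gamma> \<subseteq> {1..n-1}) \<and>
     (\<forall>\<gamma>. Poly_Mapping.lookup P \<gamma> \<in> hbar_polys)"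

lemma z_admissible_admissible_vars: "z_admissible n P \<Longrightarrow> admissible_vars n P"
  unfolding z_admissible_def admissible_vars_def hbar_polys_def by fastforce

lemma z_admissible_single:
  "c \<in> hbar_polys \<Longrightarrow> Poly_Mapping.keys \<delta> \<subseteq> {1..n-1} \<Longrightarrow> z_admissible n (Poly_Mapping.single \<delta> c)"
  by (auto simp: z_admissible_def lookup_single when_def split: if_splits)

lemma z_admissible_add: "z_admissible n P \<Longrightarrow> z_admissible n Q \<Longrightarrow> z_admissible n (P + Q)"
  using keys_add[of P Q] unfolding z_admissible_def lookup_add
  by (blast intro: hbar_polys_add)

lemma z_admissible_mult_single:
  assumes Q: "z_admissible n Q" and c: "c \<in> hbar_polys" and \<delta>: "Poly_Mapping.keys \<delta> \<subseteq> {1..n-1}"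
  shows "z_admissible n (Q * Poly_Mapping.single \<delta> c)"
  unfolding z_admissible_def
proof (intro conjI allI ballI)
  fix \<gamma> assume "\<gamma> \<in> Poly_Mapping.keys (Q * Poly_Mapping.single \<delta> c)"
  then obtain a b where "a \<in> Poly_Mapping.keys Q" "b \<in> Poly_Mapping.keys (Poly_Mapping.single \<delta> c)" "\<gamma> = a + b"
    using keys_mult by blast
  then have "a \<in> Poly_Mapping.keys Q" "\<gamma> = a + \<delta>" by (auto split: if_splits)
  then show "Poly_Mapping.keys \<gamma> \<subseteq> {1..n-1}"
    using Q \<delta> keys_add[of a \<delta>] unfolding z_admissible_def by fast
next
  fix \<gamma>
  show "Poly_Mapping.lookup (Q * Poly_Mapping.single \<delta> c) \<gamma> \<in> hbar_polys"
    using Q c lookup_mult_single[where Q = Q and c = c and \<delta> = \<delta>]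
    by (cases "\<exists>\<epsilon>. \<gamma> = \<epsilon> + \<delta>") (auto simp: z_admissible_def intro!: hbar_polys_mult)
qed

section \<open>Rational series and division by a binomial\<close>

definition hbar_rational :: "nat \<Rightarrow> z_series \<Rightarrow> bool" where
  "hbar_rational n S \<longleftrightarrow> (\<exists>P Q. z_admissible n P \<and> z_admissible n Q \<and>
     Poly_Mapping.lookup Q 0 \<noteq> 0 \<and> (\<forall>\<gamma>. conv Q S \<gamma> = of_param_poly (Poly_Mapping.lookup P \<gamma>)))"

lemma hbar_rational_is_rational: "hbar_rational n S \<Longrightarrow> is_rational_expansion n S"
  unfolding hbar_rational_def is_rational_expansion_conv using z_admissible_admissible_vars by blast

text \<open>Division by c0 + c1 z^\<delta>. As \<delta> \<noteq> 0, the new denominator has the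
  constant term Q(0) c0, which is nonzero because polynomials form an integral domain.\<close>

lemma hbar_rational_divide:
  assumes rat: "hbar_rational n (\<lambda>\<gamma>. of_param_poly c0 * S \<gamma> + of_param_poly c1 * (\<Sum>\<beta>\<in>{\<beta>. \<delta> + \<beta> = \<gamma>}. S \<beta>))"
    and c: "c0 \<in> hbar_polys" "c1 \<in> hbar_polys" "c0 \<noteq> 0"
    and \<delta>: "Poly_Mapping.keys \<delta> \<subseteq> {1..n-1}" "\<delta> \<noteq> 0"
  shows "hbar_rational n S"
proof -
  let ?S' = "\<lambda>\<gamma>. of_param_poly c0 * S \<gamma> + of_param_poly c1 * (\<Sum>\<beta>\<in>{\<beta>. \<delta> + \<beta> = \<gamma>}. S \<beta>)"
  obtain P Q where PQ: "z_admissible n P" "z_admissible n Q" "Poly_Mapping.lookup Q 0 \<noteq> 0"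
    "\<And>\<gamma>. conv Q ?S' \<gamma> = of_param_poly (Poly_Mapping.lookup P \<gamma>)"
    using rat by (auto simp: hbar_rational_def)
  let ?Q = "Q * Poly_Mapping.single 0 c0 + Q * Poly_Mapping.single \<delta> c1"
  have "conv ?Q S \<gamma> = of_param_poly (Poly_Mapping.lookup P \<gamma>)" for \<gamma>
  proof -
    have "conv ?Q S \<gamma> = conv Q ?S' \<gamma>"
      unfolding conv_add_left conv_mult_single by (simp add: conv_add_right)
    then show ?thesis using PQ by simp
  qed
  moreover have "Poly_Mapping.lookup ?Q 0 \<noteq> 0"
  proof -
    have "\<nexists>\<epsilon>. 0 = \<epsilon> + \<delta>"
      using \<delta>(2) by (auto simp: poly_mapping_eq_iff fun_eq_iff lookup_add)
    then have "Poly_Mapping.lookup (Q * Poly_Mapping.single \<delta> c1) 0 = 0"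
      by (rule lookup_mult_single(2))
    moreover have "Poly_Mapping.lookup (Q * Poly_Mapping.single 0 c0) 0 = Poly_Mapping.lookup Q 0 * c0"
      using lookup_mult_single(1)[of Q 0 c0 0] by simp
    ultimately show ?thesis using PQ c by (simp add: lookup_add)
  qed
  moreover have "z_admissible n ?Q"
    by (intro z_admissible_add z_admissible_mult_single) (use PQ c \<delta> in auto)
  ultimately show ?thesis
    unfolding hbar_rational_def using PQ by blast
qed

text \<open>A power of hbar that clears the finitely many coefficients is the whole
  denominator.\<close>

lemma hbar_rational_finite:
  assumes fin: "finite {\<gamma>. S \<gamma> \<noteq> 0}"
    and keys: "\<And>\<gamma>. S \<gamma> \<noteq> 0 \<Longrightarrow> Poly_Mapping.keys \<gamma> \<subseteq> {1..n-1}"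
    and S: "\<And>\<gamma>. S \<gamma> \<in> hbar_laurent"
  shows "hbar_rational n S"
proof -
  have "finite (S ` {\<gamma>. S \<gamma> \<noteq> 0})" "S ` {\<gamma>. S \<gamma> \<noteq> 0} \<subseteq> hbar_laurent" using fin S by auto
  then obtain k where k: "\<And>\<gamma>. S \<gamma> \<noteq> 0 \<Longrightarrow> \<exists>p\<in>hbar_polys. hbar ^ k * S \<gamma> = of_param_poly p"
    using hbar_laurent_common by force
  have "\<exists>p\<in>hbar_polys. hbar ^ k * S \<gamma> = of_param_poly p" for \<gamma>
    using k[of \<gamma>] by (cases "S \<gamma> = 0") (auto intro!: bexI[of _ 0])
  then obtain g where g: "\<And>\<gamma>. g \<gamma> \<in> hbar_polys" "\<And>\<gamma>. hbar ^ k * S \<gamma> = of_param_poly (g \<gamma>)"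
    by metis
  have g0: "g \<gamma> \<noteq> 0 \<longleftrightarrow> S \<gamma> \<noteq> 0" for \<gamma>
    using g(2)[of \<gamma>] hbar_nonzero of_param_poly_eq_iff[of "g \<gamma>" 0] by auto
  have P: "Poly_Mapping.lookup (Abs_poly_mapping g) = g"
    using fin by (simp add: g0)
  obtain p where p: "p \<in> hbar_polys" "hbar ^ k = of_param_poly p" using hbar_power_polys by blast
  then have p0: "p \<noteq> 0" using hbar_nonzero by auto
  have "conv (1 * Poly_Mapping.single 0 p) S \<gamma> = of_param_poly (Poly_Mapping.lookup (Abs_poly_mapping g) \<gamma>)" for \<gamma>
    unfolding conv_mult_single conv_1 P using p g(2)[of \<gamma>] by simp
  moreover have "z_admissible n (Abs_poly_mapping g)"
    unfolding z_admissible_def using keys by (auto simp: P g g0 in_keys_iff)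
  moreover have "z_admissible n (1 * Poly_Mapping.single 0 p)"
    using p by (simp add: z_admissible_single)
  moreover have "Poly_Mapping.lookup (1 * Poly_Mapping.single 0 p :: z_poly) 0 \<noteq> 0" using p0 by simp
  ultimately show ?thesis unfolding hbar_rational_def by blast
qed

section \<open>Generating functions of arrays\<close>

definition indic :: "'a set \<Rightarrow> 'a \<Rightarrow> int" where
  "indic U \<alpha> = (if \<alpha> \<in> U then 1 else 0)"

text \<open>The bound \<open>m \<alpha> \<ge> C\<close> is the gap to the entries outside
  \<open>X\<close>, which are zero for supported arrays. The framing entries are of this
  kind.\<close>

definition gap :: "'a set \<Rightarrow> 'a set \<Rightarrow> int \<Rightarrow> ('a \<Rightarrow> int) \<Rightarrow> bool" where
  "gap X U C m \<longleftrightarrow> (\<forall>\<alpha>\<in>U. m \<alpha> \<ge> C \<and> (\<forall>\<beta>\<in>X - U. m \<alpha> - m \<beta> \<ge> C))"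

definition supported :: "'a set \<Rightarrow> ('a \<Rightarrow> int) \<Rightarrow> bool" where
  "supported X m \<longleftrightarrow> (\<forall>\<alpha>. \<alpha> \<notin> X \<longrightarrow> m \<alpha> = 0)"

text \<open>\<open>r \<alpha>\<close> is the index of the variable z_i that counts the entry
  \<alpha>. Exponents of variables outside the image of \<open>r\<close> are forced to be zero by
  the empty sum.\<close>

definition arrays :: "'a set \<Rightarrow> ('a \<Rightarrow> nat) \<Rightarrow> (nat \<Rightarrow>\<^sub>0 nat) \<Rightarrow> ('a \<Rightarrow> int) set" where
  "arrays X r \<gamma> = {m. supported X m \<and> (\<forall>\<alpha>. m \<alpha> \<ge> 0) \<and>
     (\<forall>i. int (Poly_Mapping.lookup \<gamma> i) = (\<Sum>\<alpha>\<in>{\<alpha>\<in>X. r \<alpha> = i}. m \<alpha>))}"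

definition gen_series :: "'a set \<Rightarrow> ('a \<Rightarrow> nat) \<Rightarrow> (('a \<Rightarrow> int) \<Rightarrow> param_field) \<Rightarrow> z_series" where
  "gen_series X r W \<gamma> = (\<Sum>m\<in>arrays X r \<gamma>. W m)"

text \<open>The exponent of the monomial z^U.\<close>

definition set_degree :: "('a \<Rightarrow> nat) \<Rightarrow> 'a set \<Rightarrow> nat \<Rightarrow>\<^sub>0 nat" where
  "set_degree r U = (\<Sum>\<alpha>\<in>U. Poly_Mapping.single (r \<alpha>) 1)"

lemma gap_mono: "gap X U C m \<Longrightarrow> C' \<le> C \<Longrightarrow> gap X U C' m"
  unfolding gap_def by (meson order_trans)

text \<open>A difference of two entries changes by at most one under a shift, so every factor of the
  denominator costs one unit of the gap.\<close>

lemma gap_diff_indic: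
  assumes "gap X U (C + 1) m"
  shows "gap X U C (\<lambda>\<alpha>. m \<alpha> - indic V \<alpha>)"
  unfolding gap_def
proof (intro ballI conjI)
  have indic: "0 \<le> indic V \<alpha>" "indic V \<alpha> \<le> 1" for \<alpha> by (simp_all add: indic_def)
  fix \<alpha> assume \<alpha>: "\<alpha> \<in> U"
  then have "C + 1 \<le> m \<alpha>" using assms by (simp add: gap_def)
  then show "C \<le> m \<alpha> - indic V \<alpha>" using indic(2)[of \<alpha>] by linarith
  fix \<beta> assume "\<beta> \<in> X - U"
  then have "C + 1 \<le> m \<alpha> - m \<beta>" using assms \<alpha> by (simp add: gap_def)
  then show "C \<le> m \<alpha> - indic V \<alpha> - (m \<beta> - indic V \<beta>)"
    using indic(2)[of \<alpha>] indic(1)[of \<beta>] by linarith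
qed

lemma supported_indic: "V \<subseteq> X \<Longrightarrow> supported X m \<Longrightarrow> supported X (\<lambda>\<alpha>. m \<alpha> - indic V \<alpha>)"
  by (auto simp: supported_def indic_def)

lemma finite_bounded_arrays:
  assumes "finite X"
  shows "finite {m. supported X m \<and> (\<forall>\<alpha>\<in>X. 0 \<le> m \<alpha> \<and> m \<alpha> \<le> (B :: int))}"
proof -
  have "finite {m. \<forall>\<alpha>. (\<alpha> \<in> X \<longrightarrow> m \<alpha> \<in> {0..B}) \<and> (\<alpha> \<notin> X \<longrightarrow> m \<alpha> = 0)}"
    using assms by (intro finite_set_of_finite_funs) auto
  then show ?thesis
    by (rule finite_subset[rotated]) (auto simp: supported_def)
qed

lemma finite_arrays:
  assumes "finite X"
  shows "finite (arrays X r \<gamma>)"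
proof (rule finite_subset[OF _ finite_bounded_arrays[OF assms, of "\<Sum>\<beta>\<in>X. int (Poly_Mapping.lookup \<gamma> (r \<beta>))"]], safe)
  fix m \<alpha> assume m: "m \<in> arrays X r \<gamma>"
  then show "supported X m" "0 \<le> m \<alpha>" by (auto simp: arrays_def)
  assume \<alpha>: "\<alpha> \<in> X"
  have "m \<alpha> \<le> (\<Sum>\<beta>\<in>{\<beta>\<in>X. r \<beta> = r \<alpha>}. m \<beta>)"
    using m assms \<alpha> by (intro member_le_sum) (auto simp: arrays_def)
  also have "\<dots> = int (Poly_Mapping.lookup \<gamma> (r \<alpha>))" using m by (simp add: arrays_def)
  also have "\<dots> \<le> (\<Sum>\<beta>\<in>X. int (Poly_Mapping.lookup \<gamma> (r \<beta>)))"
    using assms \<alpha> by (intro member_le_sum[where f = "\<lambda>\<beta>. int (Poly_Mapping.lookup \<gamma> (r \<beta>))"]) auto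
  finally show "m \<alpha> \<le> (\<Sum>\<beta>\<in>X. int (Poly_Mapping.lookup \<gamma> (r \<beta>)))" .
qed

lemma lookup_set_degree:
  assumes "finite X" "U \<subseteq> X"
  shows "int (Poly_Mapping.lookup (set_degree r U) i) = (\<Sum>\<alpha>\<in>{\<alpha>\<in>X. r \<alpha> = i}. indic U \<alpha>)"
proof -
  have "int (Poly_Mapping.lookup (set_degree r U) i) = (\<Sum>\<alpha>\<in>U. if r \<alpha> = i then 1 else 0)"
    unfolding set_degree_def lookup_sum lookup_single when_def of_nat_sum by (intro sum.cong) auto
  also have "\<dots> = (\<Sum>\<alpha>\<in>X. if r \<alpha> = i then indic U \<alpha> else 0)"
    using assms by (intro sum.mono_neutral_cong_left) (auto simp: indic_def)
  also have "\<dots> = (\<Sum>\<alpha>\<in>{\<alpha>\<in>X. r \<alpha> = i}. indic U \<alpha>)"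
    using assms by (simp add: sum.inter_filter)
  finally show ?thesis .
qed

text \<open>Multiplication by z^U translates arrays by \<open>indic U\<close>. Arrays that are not
  such translates of nonnegative ones contribute nothing, as \<open>W\<close> vanishes once an entry
  is negative.\<close>

lemma gen_series_shift:
  assumes X: "finite X" "U \<subseteq> X"
    and W: "\<And>m \<alpha>. m \<alpha> < 0 \<Longrightarrow> W m = 0"
  shows "gen_series X r (\<lambda>m. W (\<lambda>\<alpha>. m \<alpha> - indic U \<alpha>)) \<gamma> =
    (\<Sum>\<beta>\<in>{\<beta>. set_degree r U + \<beta> = \<gamma>}. gen_series X r W \<beta>)"
proof -
  let ?\<delta> = "set_degree r U" and ?t = "\<lambda>m \<alpha>. m \<alpha> - indic U \<alpha>"
  have sum_t: "(\<Sum>\<alpha>\<in>{\<alpha>\<in>X. r \<alpha> = i}. ?t m \<alpha>) =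
      (\<Sum>\<alpha>\<in>{\<alpha>\<in>X. r \<alpha> = i}. m \<alpha>) - int (Poly_Mapping.lookup ?\<delta> i)" for m i
    by (simp add: sum_subtractf lookup_set_degree[OF X])
  show ?thesis
  proof (cases "\<exists>\<beta>. ?\<delta> + \<beta> = \<gamma>")
    case True
    then obtain \<beta> where \<beta>: "\<gamma> = ?\<delta> + \<beta>" by auto
    have "gen_series X r (\<lambda>m. W (?t m)) \<gamma> = (\<Sum>m\<in>{m\<in>arrays X r \<gamma>. \<forall>\<alpha>. ?t m \<alpha> \<ge> 0}. W (?t m))"
      unfolding gen_series_def
    proof (rule sum.mono_neutral_right[OF finite_arrays[OF X(1)]])
      show "\<forall>m\<in>arrays X r \<gamma> - {m\<in>arrays X r \<gamma>. \<forall>\<alpha>. ?t m \<alpha> \<ge> 0}. W (?t m) = 0"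
      proof
        fix m assume "m \<in> arrays X r \<gamma> - {m\<in>arrays X r \<gamma>. \<forall>\<alpha>. ?t m \<alpha> \<ge> 0}"
        then obtain \<alpha> where "?t m \<alpha> < 0" by (auto simp: not_le)
        then show "W (?t m) = 0" using W[of "?t m" \<alpha>] by simp
      qed
    qed auto
    also have "\<dots> = (\<Sum>m\<in>arrays X r \<beta>. W m)"
    proof (rule sum.reindex_bij_betw[of ?t], rule bij_betwI[where g = "\<lambda>m \<alpha>. m \<alpha> + indic U \<alpha>"])
      show "?t \<in> {m\<in>arrays X r \<gamma>. \<forall>\<alpha>. ?t m \<alpha> \<ge> 0} \<rightarrow> arrays X r \<beta>"
      proof (safe)
        fix m assume m: "m \<in> arrays X r \<gamma>" "\<forall>\<alpha>. ?t m \<alpha> \<ge> 0"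
        have "int (Poly_Mapping.lookup \<beta> i) = (\<Sum>\<alpha>\<in>{\<alpha>\<in>X. r \<alpha> = i}. ?t m \<alpha>)" for i
        proof -
          have "(\<Sum>\<alpha>\<in>{\<alpha>\<in>X. r \<alpha> = i}. m \<alpha>) = int (Poly_Mapping.lookup \<gamma> i)"
            using m(1) by (simp add: arrays_def)
          then show ?thesis unfolding sum_t by (simp add: \<beta> lookup_add)
        qed
        then show "?t m \<in> arrays X r \<beta>"
          using m supported_indic[OF X(2), of m] by (simp add: arrays_def)
      qed
    next
      show "(\<lambda>m \<alpha>. m \<alpha> + indic U \<alpha>) \<in> arrays X r \<beta> \<rightarrow> {m\<in>arrays X r \<gamma>. \<forall>\<alpha>. ?t m \<alpha> \<ge> 0}"
      proof (safe)
        fix m assume m: "m \<in> arrays X r \<beta>"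
        have "supported X (\<lambda>\<alpha>. m \<alpha> + indic U \<alpha>)"
          using m X(2) by (auto simp: arrays_def supported_def indic_def)
        moreover have "int (Poly_Mapping.lookup \<gamma> i) = (\<Sum>\<alpha>\<in>{\<alpha>\<in>X. r \<alpha> = i}. m \<alpha> + indic U \<alpha>)" for i
          using m by (simp add: arrays_def \<beta> lookup_add sum.distrib lookup_set_degree[OF X])
        moreover have "m \<alpha> + indic U \<alpha> \<ge> 0" for \<alpha>
          using m by (simp add: arrays_def indic_def)
        ultimately show "(\<lambda>\<alpha>. m \<alpha> + indic U \<alpha>) \<in> arrays X r \<gamma>"
          by (simp add: arrays_def)
        fix \<alpha> show "0 \<le> m \<alpha> + indic U \<alpha> - indic U \<alpha>"
          using m by (simp add: arrays_def)
      qed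
    qed auto
    also have "\<dots> = (\<Sum>\<beta>\<in>{\<beta>. ?\<delta> + \<beta> = \<gamma>}. gen_series X r W \<beta>)"
      by (simp add: \<beta> gen_series_def)
    finally show ?thesis .
  next
    case False
    \<comment> \<open>Were \<open>?t m\<close> nonnegative, its row sums would exhibit z^\<gamma> as
      a multiple of z^U.\<close>
    have "W (?t m) = 0" if m: "m \<in> arrays X r \<gamma>" for m
    proof (rule ccontr)
      assume "W (?t m) \<noteq> 0"
      then have "?t m \<alpha> \<ge> 0" for \<alpha> using W[of "?t m"] by (meson not_le)
      then have "(\<Sum>\<alpha>\<in>{\<alpha>\<in>X. r \<alpha> = i}. ?t m \<alpha>) \<ge> 0" for i by (intro sum_nonneg) auto
      moreover have "(\<Sum>\<alpha>\<in>{\<alpha>\<in>X. r \<alpha> = i}. m \<alpha>) = int (Poly_Mapping.lookup \<gamma> i)" for i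
        using m by (simp add: arrays_def)
      ultimately have le: "Poly_Mapping.lookup ?\<delta> i \<le> Poly_Mapping.lookup \<gamma> i" for i
        unfolding sum_t by (metis diff_ge_0_iff_ge of_nat_le_iff)
      then have "?\<delta> + (\<gamma> - ?\<delta>) = \<gamma>"
        by (intro poly_mapping_eqI) (simp add: lookup_add lookup_minus)
      with False show False by blast
    qed
    then have "gen_series X r (\<lambda>m. W (?t m)) \<gamma> = 0"
      by (simp add: gen_series_def)
    moreover have "{\<beta>. ?\<delta> + \<beta> = \<gamma>} = {}" using False by auto
    ultimately show ?thesis by simp
  qed
qed

text \<open>
  Pigeonhole: if \<open>m \<alpha>\<close> is larger, one of the intervals \<open>{t * C..<(t + 1) * C}\<close> below it contains
  no value of \<open>m\<close>.
\<close>

lemma bounded_of_no_gap: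
  assumes X: "finite X" and C: "C \<ge> 1" and nn: "\<forall>\<alpha>\<in>X. m \<alpha> \<ge> 0"
    and no_gap: "\<And>U. U \<subseteq> X \<Longrightarrow> U \<noteq> {} \<Longrightarrow> \<not> gap X U C m"
    and \<alpha>: "\<alpha> \<in> X"
  shows "m \<alpha> \<le> int (card X) * C"
proof (rule ccontr)
  assume big: "\<not> m \<alpha> \<le> int (card X) * C"
  let ?B = "(\<lambda>\<beta>. m \<beta> div C) ` (X - {\<alpha>})"
  have "card ?B \<le> card (X - {\<alpha>})" using X by (intro card_image_le) auto
  also have "\<dots> < card X" using X \<alpha> by (rule card_Diff1_less)
  also have "\<dots> = card {0..<int (card X)}" by simp
  finally have "\<not> {0..<int (card X)} \<subseteq> ?B"
    using X by (meson card_mono finite_Diff finite_imageI not_le)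
  then obtain t where t: "0 \<le> t" "t < int (card X)" "t \<notin> ?B"
    by (meson atLeastLessThan_iff subsetI)
  let ?U = "{\<beta>\<in>X. m \<beta> \<ge> (t + 1) * C}"
  have div_less: "x div C < a \<longleftrightarrow> x < a * C" for x a
  proof -
    have x: "x = x div C * C + x mod C" "0 \<le> x mod C" "x mod C < C"
      using C by simp_all
    have "(x div C + 1) * C \<le> a * C" if "x div C < a" using that C by (intro mult_right_mono) auto
    moreover have "a * C \<le> x div C * C" if "\<not> x div C < a" using that C by (intro mult_right_mono) auto
    moreover have "(x div C + 1) * C = x div C * C + C" by (simp add: distrib_right)
    ultimately show ?thesis using x by linarith
  qed
  have "(t + 1) * C \<le> int (card X) * C" using t C by (intro mult_right_mono) auto
  then have \<alpha>U: "\<alpha> \<in> ?U" using big \<alpha> by auto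
  have "gap X ?U C m"
    unfolding gap_def
  proof (intro ballI conjI)
    fix \<beta> assume \<beta>: "\<beta> \<in> ?U"
    have "(t + 1) * C = t * C + C" "t * C \<ge> 0" using t C by (simp_all add: distrib_right)
    then show "C \<le> m \<beta>" using \<beta> by auto
    fix \<beta>' assume \<beta>': "\<beta>' \<in> X - ?U"
    then have "\<beta>' \<in> X - {\<alpha>}" using \<alpha>U by auto
    then have ne: "m \<beta>' div C \<noteq> t" using t(3) by blast
    have "m \<beta>' < (t + 1) * C" using \<beta>' by auto
    then have "m \<beta>' div C < t + 1" by (simp only: div_less)
    then have "m \<beta>' div C < t" using ne by simp
    then have "m \<beta>' < t * C" by (simp only: div_less)
    moreover have "m \<beta> \<ge> t * C + C" using \<beta> by (simp add: distrib_right)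
    ultimately show "C \<le> m \<beta> - m \<beta>'" by linarith
  qed
  then show False using no_gap[of ?U] \<alpha>U by blast
qed

text \<open>Only arrays without a gap contribute, and \<open>bounded_of_no_gap\<close> bounds their
  entries. Each of these finitely many arrays belongs to a single exponent \<gamma>, so the support
  is finite.\<close>

lemma gen_series_finite:
  assumes X: "finite X" and r: "r ` X \<subseteq> {1..n-1}" and C: "C \<ge> 1"
    and W: "\<And>m. W m \<in> hbar_laurent"
    and vanish: "\<And>U m. U \<subseteq> X \<Longrightarrow> U \<noteq> {} \<Longrightarrow> supported X m \<Longrightarrow> gap X U C m \<Longrightarrow> W m = 0"
  shows "hbar_rational n (gen_series X r W)"
proof (rule hbar_rational_finite)
  let ?M = "{m. supported X m \<and> (\<forall>\<alpha>\<in>X. 0 \<le> m \<alpha> \<and> m \<alpha> \<le> int (card X) * C)}"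
  have ex: "\<exists>m\<in>?M. m \<in> arrays X r \<gamma> \<and> W m \<noteq> 0" if ne: "gen_series X r W \<gamma> \<noteq> 0" for \<gamma>
  proof -
    obtain m where m: "m \<in> arrays X r \<gamma>" "W m \<noteq> 0"
      using sum.not_neutral_contains_not_neutral[OF ne[unfolded gen_series_def]] by blast
    then have sm: "supported X m" and nn: "\<forall>\<alpha>\<in>X. m \<alpha> \<ge> 0" by (auto simp: arrays_def)
    have "m \<alpha> \<le> int (card X) * C" if "\<alpha> \<in> X" for \<alpha>
      by (rule bounded_of_no_gap[OF X C nn _ that]) (use vanish m(2) sm in blast)
    then show ?thesis using m sm nn by blast
  qed
  have "{\<gamma>. gen_series X r W \<gamma> \<noteq> 0} \<subseteq> (\<Union>m\<in>?M. {\<gamma>. m \<in> arrays X r \<gamma>})"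
    using ex by blast
  moreover have "finite (\<Union>m\<in>?M. {\<gamma>. m \<in> arrays X r \<gamma>})"
  proof (rule finite_UN_I[OF finite_bounded_arrays[OF X]])
    fix m
    have "\<gamma> = \<gamma>'" if "m \<in> arrays X r \<gamma>" "m \<in> arrays X r \<gamma>'" for \<gamma> \<gamma>'
    proof (rule poly_mapping_eqI)
      fix i
      have "int (Poly_Mapping.lookup \<gamma> i) = int (Poly_Mapping.lookup \<gamma>' i)"
        using that unfolding arrays_def by simp
      then show "Poly_Mapping.lookup \<gamma> i = Poly_Mapping.lookup \<gamma>' i" by simp
    qed
    then have "{\<gamma>. m \<in> arrays X r \<gamma>} = {} \<or> (\<exists>\<gamma>. {\<gamma>. m \<in> arrays X r \<gamma>} = {\<gamma>})" by blast
    then show "finite {\<gamma>. m \<in> arrays X r \<gamma>}" by (metis finite.emptyI finite.insertI)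
  qed
  ultimately show "finite {\<gamma>. gen_series X r W \<gamma> \<noteq> 0}" by (rule finite_subset)
  fix \<gamma>
  show "gen_series X r W \<gamma> \<in> hbar_laurent"
    unfolding gen_series_def using W by (intro hbar_laurent_sum)
  assume "gen_series X r W \<gamma> \<noteq> 0"
  then obtain m where m: "m \<in> arrays X r \<gamma>" using ex by blast
  show "Poly_Mapping.keys \<gamma> \<subseteq> {1..n-1}"
  proof
    fix i assume i: "i \<in> Poly_Mapping.keys \<gamma>"
    have "int (Poly_Mapping.lookup \<gamma> i) = (\<Sum>\<alpha>\<in>{\<alpha>\<in>X. r \<alpha> = i}. m \<alpha>)"
      using m by (simp add: arrays_def)
    then have "{\<alpha>\<in>X. r \<alpha> = i} \<noteq> {}" using i by (auto simp: in_keys_iff simp del: Collect_empty_eq)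
    then show "i \<in> {1..n-1}" using r by auto
  qed
qed

text \<open>
  Each set \<open>U\<close> contributes the factor \<open>1 - lam U * z\<^bsup>deg U\<^esup>\<close> of the denominator: multiplying by it
  replaces \<open>W m\<close> by \<open>W m - lam U * W (m - indic U)\<close>, which vanishes if \<open>m\<close> has a gap at \<open>U\<close>.
\<close>

lemma gen_series_rational:
  assumes X: "finite X" and r: "r ` X \<subseteq> {1..n-1}"
    and \<U>: "finite \<U>" "\<And>U. U \<in> \<U> \<Longrightarrow> U \<subseteq> X \<and> U \<noteq> {} \<and> lam U \<in> hbar_laurent"
    and C: "C \<ge> 1"
    and W: "\<And>m. W m \<in> hbar_laurent" "\<And>m \<alpha>. m \<alpha> < 0 \<Longrightarrow> W m = 0"
    and periodic: "\<And>U m. U \<in> \<U> \<Longrightarrow> supported X m \<Longrightarrow> gap X U C m \<Longrightarrow> W (\<lambda>\<alpha>. m \<alpha> + indic U \<alpha>) = lam U * W m"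
    and vanish: "\<And>U m. U \<subseteq> X \<Longrightarrow> U \<noteq> {} \<Longrightarrow> U \<notin> \<U> \<Longrightarrow> supported X m \<Longrightarrow> gap X U C m \<Longrightarrow> W m = 0"
  shows "hbar_rational n (gen_series X r W)"
  using \<U> C W periodic vanish
proof (induction \<U> arbitrary: C W rule: finite_induct)
  case empty
  show ?case
    by (rule gen_series_finite[OF X r empty.prems(2,3)]) (use empty.prems(6) in simp)
next
  case (insert U \<U>)
  have U: "U \<subseteq> X" "U \<noteq> {}" "lam U \<in> hbar_laurent" using insert.prems by auto
  \<comment> \<open>\<open>lam U\<close> may contain negative powers of hbar. The factor is
    therefore taken as hbar^k - (hbar^k lam U) z^U, whose coefficients are polynomials.\<close>
  obtain k p where p: "p \<in> hbar_polys" "hbar ^ k * lam U = of_param_poly p"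
    using U(3) unfolding hbar_laurent_def by blast
  obtain p0 where p0: "p0 \<in> hbar_polys" "hbar ^ k = of_param_poly p0" using hbar_power_polys by blast
  have p0': "p0 \<noteq> 0" using p0 hbar_nonzero by auto
  have laurent: "of_param_poly p \<in> hbar_laurent" if "p \<in> hbar_polys" for p
    unfolding hbar_laurent_def using that by (auto intro!: exI[of _ 0])
  let ?c1 = "- p" and ?t = "\<lambda>m \<alpha>. m \<alpha> - indic U \<alpha>"
  define W' where "W' m = of_param_poly p0 * W m + of_param_poly ?c1 * W (?t m)" for m
  have W'_eq: "W' m = hbar ^ k * (W m - lam U * W (?t m))" for m
    unfolding W'_def p0(2)[symmetric] of_param_poly_uminus p(2)[symmetric] by (simp add: algebra_simps)
  have "gen_series X r W' = (\<lambda>\<gamma>. of_param_poly p0 * gen_series X r W \<gamma> +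
      of_param_poly ?c1 * (\<Sum>\<beta>\<in>{\<beta>. set_degree r U + \<beta> = \<gamma>}. gen_series X r W \<beta>))"
  proof
    fix \<gamma>
    have "gen_series X r W' \<gamma> = of_param_poly p0 * gen_series X r W \<gamma> +
        of_param_poly ?c1 * gen_series X r (\<lambda>m. W (?t m)) \<gamma>"
      by (simp add: gen_series_def W'_def sum.distrib sum_distrib_left)
    also have "gen_series X r (\<lambda>m. W (?t m)) \<gamma> =
        (\<Sum>\<beta>\<in>{\<beta>. set_degree r U + \<beta> = \<gamma>}. gen_series X r W \<beta>)"
      by (rule gen_series_shift[OF X U(1)]) (rule insert.prems(4))
    finally show "gen_series X r W' \<gamma> = of_param_poly p0 * gen_series X r W \<gamma> +
        of_param_poly ?c1 * (\<Sum>\<beta>\<in>{\<beta>. set_degree r U + \<beta> = \<gamma>}. gen_series X r W \<beta>)" .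
  qed
  moreover have "hbar_rational n (gen_series X r W')"
  \<comment> \<open>The new weight also involves the array shifted down by U, which may have lost
    one unit of the gap.\<close>
  proof (rule insert.IH[of "C + 1"])
    show "V \<subseteq> X \<and> V \<noteq> {} \<and> lam V \<in> hbar_laurent" if "V \<in> \<U>" for V
      using insert.prems that by auto
    show "C + 1 \<ge> 1" using insert.prems by simp
    show "W' m \<in> hbar_laurent" for m
      unfolding W'_def using insert.prems p p0
      by (intro hbar_laurent_add hbar_laurent_mult laurent hbar_polys_uminus)
    show "W' m = 0" if "m \<alpha> < 0" for m \<alpha>
    proof -
      have "?t m \<alpha> < 0" using that by (simp add: indic_def)
      then have "W (?t m) = 0" using insert.prems(4)[of "?t m" \<alpha>] by simp
      then show ?thesis using insert.prems(4)[of m \<alpha>] that by (simp add: W'_def)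
    qed
    show "W' (\<lambda>\<alpha>. m \<alpha> + indic V \<alpha>) = lam V * W' m"
      if V: "V \<in> \<U>" and m: "supported X m" and g: "gap X V (C + 1) m" for V m
    proof -
      have 1: "W (\<lambda>\<alpha>. m \<alpha> + indic V \<alpha>) = lam V * W m"
        using insert.prems(5)[of V m] V m gap_mono[OF g] by simp
      have "W (\<lambda>\<alpha>. ?t m \<alpha> + indic V \<alpha>) = lam V * W (?t m)"
        using insert.prems(5)[of V "?t m"] V supported_indic[OF U(1) m] gap_diff_indic[OF g] by simp
      moreover have "(\<lambda>\<alpha>. ?t m \<alpha> + indic V \<alpha>) = ?t (\<lambda>\<alpha>. m \<alpha> + indic V \<alpha>)"
        by (simp add: fun_eq_iff)
      ultimately have "W (?t (\<lambda>\<alpha>. m \<alpha> + indic V \<alpha>)) = lam V * W (?t m)" by simp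
      with 1 show ?thesis by (simp add: W'_eq algebra_simps)
    qed
    show "W' m = 0" if V: "V \<subseteq> X" "V \<noteq> {}" "V \<notin> \<U>" and m: "supported X m" and g: "gap X V (C + 1) m" for V m
    proof (cases "V = U")
      \<comment> \<open>Periodicity at \<open>?t m\<close> gives
        \<open>W m = lam U * W (?t m)\<close>, so the two terms of \<open>W' m\<close>
        cancel.\<close>
      case True
      then have "W (\<lambda>\<alpha>. ?t m \<alpha> + indic U \<alpha>) = lam U * W (?t m)"
        using insert.prems(5)[of U "?t m"] supported_indic[OF U(1) m] gap_diff_indic[OF g] by simp
      then show ?thesis by (simp add: W'_eq)
    next
      case False
      then have "W m = 0" "W (?t m) = 0"
        using V m insert.prems(6)[of V] gap_mono[OF g] supported_indic[OF U(1) m] gap_diff_indic[OF g] by auto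
      then show ?thesis by (simp add: W'_def)
    qed
  qed
  moreover have "Poly_Mapping.keys (set_degree r U) \<subseteq> {1..n-1}"
  proof
    fix i assume "i \<in> Poly_Mapping.keys (set_degree r U)"
    then have "(\<Sum>\<alpha>\<in>{\<alpha>\<in>X. r \<alpha> = i}. indic U \<alpha>) \<noteq> 0"
      unfolding lookup_set_degree[OF X U(1), symmetric] by (simp add: in_keys_iff)
    then obtain \<alpha> where "\<alpha> \<in> X" "r \<alpha> = i"
      using sum.not_neutral_contains_not_neutral by blast
    then show "i \<in> {1..n-1}" using r by auto
  qed
  moreover have "set_degree r U \<noteq> 0"
  proof
    assume 0: "set_degree r U = 0"
    obtain \<alpha> where \<alpha>: "\<alpha> \<in> U" using U by auto
    have "indic U \<alpha> \<le> (\<Sum>\<beta>\<in>{\<beta>\<in>X. r \<beta> = r \<alpha>}. indic U \<beta>)"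
      using \<alpha> U X by (intro member_le_sum) (auto simp: indic_def)
    then show False
      using lookup_set_degree[OF X U(1), of r "r \<alpha>"] 0 \<alpha> by (simp add: indic_def)
  qed
  ultimately show ?case
    using hbar_rational_divide[of n p0 "gen_series X r W" ?c1 "set_degree r U"] p(1) p0(1) p0'
      hbar_polys_uminus by simp
qed

section \<open>Piecewise linear exponents\<close>

text \<open>The increment \<open>l\<close> depends on U alone and becomes the exponent of hbar/q in
  \<lambda>_U. One C is demanded for all U because \<open>gen_series_rational\<close> works with a
  single gap size.\<close>

definition eventually_linear :: "'a set \<Rightarrow> (('a \<Rightarrow> int) \<Rightarrow> int) \<Rightarrow> bool" where
  "eventually_linear X \<phi> \<longleftrightarrow> (\<exists>C. \<forall>U\<subseteq>X. \<exists>l. \<forall>m. supported X m \<longrightarrow> gap X U C m \<longrightarrow>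
     \<phi> (\<lambda>\<alpha>. m \<alpha> + indic U \<alpha>) = \<phi> m + l)"

lemma eventually_linear_const: "eventually_linear X (\<lambda>_. c)"
  unfolding eventually_linear_def by auto

lemma eventually_linear_add:
  assumes "eventually_linear X \<phi>" "eventually_linear X \<psi>"
  shows "eventually_linear X (\<lambda>m. \<phi> m + \<psi> m)"
proof -
  obtain C D where C: "\<And>U. U \<subseteq> X \<Longrightarrow> \<exists>l. \<forall>m. supported X m \<longrightarrow> gap X U C m \<longrightarrow> \<phi> (\<lambda>\<alpha>. m \<alpha> + indic U \<alpha>) = \<phi> m + l"
    and D: "\<And>U. U \<subseteq> X \<Longrightarrow> \<exists>l. \<forall>m. supported X m \<longrightarrow> gap X U D m \<longrightarrow> \<psi> (\<lambda>\<alpha>. m \<alpha> + indic U \<alpha>) = \<psi> m + l"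
    using assms unfolding eventually_linear_def by blast
  show ?thesis
    unfolding eventually_linear_def
  proof (rule exI[of _ "max C D"], intro allI impI)
    fix U assume U: "U \<subseteq> X"
    obtain l l' where l: "\<forall>m. supported X m \<longrightarrow> gap X U C m \<longrightarrow> \<phi> (\<lambda>\<alpha>. m \<alpha> + indic U \<alpha>) = \<phi> m + l"
      and l': "\<forall>m. supported X m \<longrightarrow> gap X U D m \<longrightarrow> \<psi> (\<lambda>\<alpha>. m \<alpha> + indic U \<alpha>) = \<psi> m + l'"
      using C[OF U] D[OF U] by blast
    have "supported X m \<longrightarrow> gap X U (max C D) m \<longrightarrow>
        \<phi> (\<lambda>\<alpha>. m \<alpha> + indic U \<alpha>) + \<psi> (\<lambda>\<alpha>. m \<alpha> + indic U \<alpha>) = \<phi> m + \<psi> m + (l + l')" for m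
      using l l' gap_mono[of X U "max C D" m C] gap_mono[of X U "max C D" m D] by auto
    then show "\<exists>l. \<forall>m. supported X m \<longrightarrow> gap X U (max C D) m \<longrightarrow>
        \<phi> (\<lambda>\<alpha>. m \<alpha> + indic U \<alpha>) + \<psi> (\<lambda>\<alpha>. m \<alpha> + indic U \<alpha>) = \<phi> m + \<psi> m + l" by blast
  qed
qed

lemma eventually_linear_uminus:
  assumes "eventually_linear X \<phi>"
  shows "eventually_linear X (\<lambda>m. - \<phi> m)"
proof -
  obtain C where C: "\<And>U. U \<subseteq> X \<Longrightarrow> \<exists>l. \<forall>m. supported X m \<longrightarrow> gap X U C m \<longrightarrow> \<phi> (\<lambda>\<alpha>. m \<alpha> + indic U \<alpha>) = \<phi> m + l"
    using assms unfolding eventually_linear_def by blast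
  show ?thesis
    unfolding eventually_linear_def
  proof (rule exI[of _ C], intro allI impI)
    fix U assume "U \<subseteq> X"
    then obtain l where l: "\<forall>m. supported X m \<longrightarrow> gap X U C m \<longrightarrow> \<phi> (\<lambda>\<alpha>. m \<alpha> + indic U \<alpha>) = \<phi> m + l"
      using C by blast
    then show "\<exists>l. \<forall>m. supported X m \<longrightarrow> gap X U C m \<longrightarrow> - \<phi> (\<lambda>\<alpha>. m \<alpha> + indic U \<alpha>) = - \<phi> m + l"
      by (intro exI[of _ "- l"]) auto
  qed
qed

lemma eventually_linear_diff:
  "eventually_linear X \<phi> \<Longrightarrow> eventually_linear X \<psi> \<Longrightarrow> eventually_linear X (\<lambda>m. \<phi> m - \<psi> m)"
  using eventually_linear_add[OF _ eventually_linear_uminus] by simp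

lemma eventually_linear_sum:
  "(\<And>a. a \<in> A \<Longrightarrow> eventually_linear X (\<phi> a)) \<Longrightarrow> eventually_linear X (\<lambda>m. \<Sum>a\<in>A. \<phi> a m)"
  by (induction A rule: infinite_finite_induct)
    (auto intro: eventually_linear_add simp: eventually_linear_const)

text \<open>If exactly one of \<alpha>, \<beta> lies in U, the gap decides the minimum. For \<alpha>
  in U it equals c before and after the shift; for \<beta> in U it equals the difference plus one,
  which drops by one. The bound |c| + 2 ensures this whatever the sign of c. The indices may lie
  outside X, where supported arrays are zero.\<close>

lemma eventually_linear_min: "eventually_linear X (\<lambda>m. min (m \<alpha> - m \<beta> + 1) c)"
  unfolding eventually_linear_def
proof (rule exI[of _ "\<bar>c\<bar> + 2"], intro allI impI)
  fix U assume U: "U \<subseteq> X"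
  let ?l = "if \<beta> \<in> U \<and> \<alpha> \<notin> U then -1 else 0 :: int"
  have "min (m \<alpha> + indic U \<alpha> - (m \<beta> + indic U \<beta>) + 1) c = min (m \<alpha> - m \<beta> + 1) c + ?l"
    if m: "supported X m" and g: "gap X U (\<bar>c\<bar> + 2) m" for m
  proof -
    have *: "m a - m b \<ge> \<bar>c\<bar> + 2" if "a \<in> U" "b \<notin> U" for a b
      using that m g unfolding gap_def supported_def by (cases "b \<in> X") auto
    show ?thesis
      using *[of \<alpha> \<beta>] *[of \<beta> \<alpha>] by (auto simp: indic_def min_def)
  qed
  then show "\<exists>l. \<forall>m. supported X m \<longrightarrow> gap X U (\<bar>c\<bar> + 2) m \<longrightarrow>
      min (m \<alpha> + indic U \<alpha> - (m \<beta> + indic U \<beta>) + 1) c = min (m \<alpha> - m \<beta> + 1) c + l" by blast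
qed

text \<open>A gap of size at least one at U makes the signs and the inequalities along
  \<open>E\<close> insensitive to the shift by U: two entries of which only one moves are already
  strictly ordered by the gap. Every nonempty U receives a factor, so no sets are left over for the
  vanishing condition of \<open>gen_series_rational\<close>.\<close>

lemma monotone_arrays_rational:
  assumes X: "finite X" and r: "r ` X \<subseteq> {1..n-1}" and E: "E \<subseteq> X \<times> X"
    and \<phi>: "eventually_linear X \<phi>"
  shows "hbar_rational n (gen_series X r (\<lambda>m.
    if (\<forall>\<alpha>. m \<alpha> \<ge> 0) \<and> (\<forall>(\<alpha>, \<beta>)\<in>E. m \<beta> \<le> m \<alpha>) then (hbar / q_param) powi \<phi> m else 0))"
proof -
  let ?y = "hbar / q_param" and ?ok = "\<lambda>m. (\<forall>\<alpha>. m \<alpha> \<ge> (0::int)) \<and> (\<forall>(\<alpha>, \<beta>)\<in>E. m \<beta> \<le> m \<alpha>)"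
  obtain C0 where "\<forall>U\<subseteq>X. \<exists>l. \<forall>m. supported X m \<longrightarrow> gap X U C0 m \<longrightarrow> \<phi> (\<lambda>\<alpha>. m \<alpha> + indic U \<alpha>) = \<phi> m + l"
    using \<phi> unfolding eventually_linear_def by blast
  then obtain l where l: "\<And>U m. U \<subseteq> X \<Longrightarrow> supported X m \<Longrightarrow> gap X U C0 m \<Longrightarrow> \<phi> (\<lambda>\<alpha>. m \<alpha> + indic U \<alpha>) = \<phi> m + l U"
    by metis
  let ?C = "max C0 1"
  show ?thesis
  proof (rule gen_series_rational[OF X r, of "{U. U \<subseteq> X \<and> U \<noteq> {}}" "\<lambda>U. ?y powi l U" ?C])
    show "finite {U. U \<subseteq> X \<and> U \<noteq> {}}" using X by simp
    show "U \<subseteq> X \<and> U \<noteq> {} \<and> ?y powi l U \<in> hbar_laurent" if "U \<in> {U. U \<subseteq> X \<and> U \<noteq> {}}" for U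
      using that hbar_over_q_laurent by auto
    show "(if ?ok m then ?y powi \<phi> m else 0) \<in> hbar_laurent" for m
      using hbar_over_q_laurent by simp
    show "(if ?ok m then ?y powi \<phi> m else 0) = 0" if "m \<alpha> < 0" for m \<alpha>
      using that by (meson not_le)
    fix U m assume U: "U \<in> {U. U \<subseteq> X \<and> U \<noteq> {}}" and m: "supported X m" and g: "gap X U ?C m"
    let ?s = "\<lambda>\<alpha>. m \<alpha> + indic U \<alpha>"
    have "\<phi> ?s = \<phi> m + l U" using l[of U m] U m gap_mono[OF g] by simp
    then have y: "?y powi \<phi> ?s = ?y powi l U * ?y powi \<phi> m"
      using hbar_over_q_nonzero by (simp add: power_int_add mult.commute)
    have "?s \<alpha> \<ge> 0 \<longleftrightarrow> m \<alpha> \<ge> 0" for \<alpha>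
      using g unfolding gap_def indic_def by force
    moreover have "?s \<beta> \<le> ?s \<alpha> \<longleftrightarrow> m \<beta> \<le> m \<alpha>" if "(\<alpha>, \<beta>) \<in> E" for \<alpha> \<beta>
    proof -
      have "\<alpha> \<in> X" "\<beta> \<in> X" using that E by auto
      then show ?thesis using g unfolding gap_def indic_def
        by (cases "\<alpha> \<in> U"; cases "\<beta> \<in> U") force+
    qed
    ultimately have "?ok ?s \<longleftrightarrow> ?ok m" by fast
    then show "(if ?ok ?s then ?y powi \<phi> ?s else 0) = ?y powi l U * (if ?ok m then ?y powi \<phi> m else 0)"
      using y by simp
  next
    show "1 \<le> ?C" by simp
  qed auto
qed

section \<open>Matrices of polynomials\<close>

interpretation poly_at: comm_ring_hom "\<lambda>p. poly p x" for x :: complex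
  by unfold_locales auto

text \<open>The matrix functions in \<open>regular_mat\<close> are the evaluations of matrices over
  the polynomial ring, where determinants, adjugates and coefficients are available.\<close>

definition eval_mat :: "complex poly mat \<Rightarrow> complex \<Rightarrow> complex mat" where
  "eval_mat P x = map_mat (\<lambda>p. poly p x) P"

lemma eval_mat_carrier [simp]: "eval_mat P x \<in> carrier_mat r c \<longleftrightarrow> P \<in> carrier_mat r c"
  by (simp add: eval_mat_def)

lemma eval_mat_dim [simp]: "dim_row (eval_mat P x) = dim_row P" "dim_col (eval_mat P x) = dim_col P"
  by (simp_all add: eval_mat_def)

lemma eval_mat_index [simp]:
  "k < dim_row P \<Longrightarrow> l < dim_col P \<Longrightarrow> eval_mat P x $$ (k, l) = poly (P $$ (k, l)) x"
  by (simp add: eval_mat_def)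

lemma eval_mat_mult:
  "P \<in> carrier_mat r k \<Longrightarrow> Q \<in> carrier_mat k c \<Longrightarrow> eval_mat (P * Q) x = eval_mat P x * eval_mat Q x"
  unfolding eval_mat_def by (rule poly_at.mat_hom_mult)

lemma det_eval_mat: "det (eval_mat P x) = poly (det P) x"
  unfolding eval_mat_def by (rule poly_at.hom_det)

lemma poly_eq_of_infinite:
  fixes p q :: "complex poly"
  assumes "infinite {x. poly p x = poly q x}"
  shows "p = q"
proof (rule ccontr)
  assume "p \<noteq> q"
  then have "finite {x. poly (p - q) x = 0}" by (intro poly_roots_finite) simp
  then show False using assms by simp
qed

lemma eval_mat_eqI:
  assumes "P \<in> carrier_mat r c" "Q \<in> carrier_mat r c" "infinite {x. eval_mat P x = eval_mat Q x}"
  shows "P = Q"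
proof (rule eq_matI)
  fix k l assume "k < dim_row Q" "l < dim_col Q"
  with assms have kl: "k < dim_row P" "l < dim_col P" "k < dim_row Q" "l < dim_col Q" by auto
  have "{x. eval_mat P x = eval_mat Q x} \<subseteq> {x. poly (P $$ (k, l)) x = poly (Q $$ (k, l)) x}"
    using kl by (auto simp flip: eval_mat_index)
  then show "P $$ (k, l) = Q $$ (k, l)"
    by (rule poly_eq_of_infinite[OF infinite_super[OF _ assms(3)]])
qed (use assms in auto)

lemma infinite_nonzero_complex: "infinite {x :: complex. x \<noteq> 0}"
proof -
  have "{x :: complex. x \<noteq> 0} = UNIV - {0}" by auto
  then show ?thesis by (simp add: infinite_UNIV_char_0)
qed

lemma regular_mat_eval: "P \<in> carrier_mat r c \<Longrightarrow> regular_mat r c (eval_mat P)"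
  by (auto simp: regular_mat_def)

lemma regular_matE:
  assumes "regular_mat r c M"
  obtains P where "P \<in> carrier_mat r c" "M = eval_mat P"
proof -
  have "\<exists>p. k < r \<and> l < c \<longrightarrow> (\<forall>x. M x $$ (k, l) = poly p x)" for k l
    using assms unfolding regular_mat_def by blast
  then obtain p where p: "\<And>k l x. k < r \<Longrightarrow> l < c \<Longrightarrow> M x $$ (k, l) = poly (p k l) x"
    by metis
  have M: "M x \<in> carrier_mat r c" for x using assms by (simp add: regular_mat_def)
  let ?P = "mat r c (\<lambda>(k, l). p k l)"
  have "M x = eval_mat ?P x" for x
    using M[of x] by (intro eq_matI) (auto simp: p)
  then show thesis by (intro that[of ?P]) auto
qed

lemma regular_mat_carrier: "regular_mat r c M \<Longrightarrow> M x \<in> carrier_mat r c"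
  by (simp add: regular_mat_def)

lemma regular_mat_mult:
  assumes "regular_mat r k M" "regular_mat k c N"
  shows "regular_mat r c (\<lambda>x. M x * N x)"
proof -
  obtain P Q where "P \<in> carrier_mat r k" "M = eval_mat P" "Q \<in> carrier_mat k c" "N = eval_mat Q"
    using assms by (metis regular_matE)
  then show ?thesis
    using regular_mat_eval[of "P * Q" r c] by (simp add: eval_mat_mult[symmetric] mult_carrier_mat[of _ r k])
qed

lemma regular_mat_const: "A \<in> carrier_mat r c \<Longrightarrow> regular_mat r c (\<lambda>_. A)"
  unfolding regular_mat_def by (auto intro!: exI[of _ "[:_:]"])

lemma regular_mat_smult:
  assumes "regular_mat r c M"
  shows "regular_mat r c (\<lambda>x. a \<cdot>\<^sub>m M x)"
proof -
  obtain P where "P \<in> carrier_mat r c" "M = eval_mat P" using assms by (rule regular_matE)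
  then show ?thesis
    unfolding regular_mat_def by (auto intro!: exI[of _ "smult a (P $$ (_, _))"])
qed

lemma regular_mat_compose:
  assumes "regular_mat r c M"
  shows "regular_mat r c (\<lambda>x. M (a * x))"
proof -
  obtain P where "P \<in> carrier_mat r c" "M = eval_mat P" using assms by (rule regular_matE)
  then show ?thesis
    unfolding regular_mat_def
    by (auto simp: poly_pcompose mult.commute intro!: exI[of _ "pcompose (P $$ (_, _)) [:0, a:]"])
qed

lemma regular_mat_diag:
  assumes "\<And>l. l < r \<Longrightarrow> \<exists>p. \<forall>x. f x l = poly p x"
  shows "regular_mat r r (\<lambda>x. mat_diag r (f x))"
  unfolding regular_mat_def
proof (intro conjI allI impI)
  fix k l assume "k < r" "l < r"
  then show "\<exists>p. \<forall>x. mat_diag r (f x) $$ (k, l) = poly p x"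
    using assms[of l] by (cases "k = l") (auto simp: mat_diag_def intro!: exI[of _ 0])
qed simp

lemma regular_mat_eqI:
  assumes "regular_mat r c M" "regular_mat r c N" "infinite {x. M x = N x}"
  shows "M = N"
proof -
  obtain P Q where "P \<in> carrier_mat r c" "M = eval_mat P" "Q \<in> carrier_mat r c" "N = eval_mat Q"
    using assms by (metis regular_matE)
  then show ?thesis using assms(3) eval_mat_eqI by metis
qed

lemma unit_poly_const:
  fixes p :: "complex poly"
  assumes "\<And>x. poly p x \<noteq> 0"
  obtains c where "c \<noteq> 0" "p = [:c:]"
proof -
  have "constant (poly p)" using assms fundamental_theorem_of_algebra by blast
  then have "poly p x = poly [:poly p 0:] x" for x
    unfolding constant_def by (metis mult_zero_right poly_0 poly_pCons add.right_neutral)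
  then have "p = [:poly p 0:]" by (metis poly_eq_poly_eq_iff ext)
  then show thesis using assms that by blast
qed

lemma regular_det_const:
  assumes M: "regular_mat r r M" and "\<And>x. det (M x) \<noteq> 0"
  obtains c where "c \<noteq> 0" "\<And>x. det (M x) = c"
proof -
  obtain P where P: "P \<in> carrier_mat r r" "M = eval_mat P" using M by (rule regular_matE)
  then obtain c where "c \<noteq> 0" "det P = [:c:]"
    using assms(2) unit_poly_const[of "det P"] by (auto simp: det_eval_mat)
  then show thesis using P that by (simp add: det_eval_mat)
qed

text \<open>The determinant is a nowhere vanishing polynomial, hence constant, so the adjugate
  divided by it is again polynomial.\<close>

lemma regular_inverse:
  assumes M: "regular_mat r r M" and det: "\<And>x. det (M x) \<noteq> 0"
  shows "\<exists>N. regular_mat r r N \<and> (\<forall>x. M x * N x = 1\<^sub>m r \<and> N x * M x = 1\<^sub>m r \<and> det (N x) \<noteq> 0)"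
proof -
  obtain P where P: "P \<in> carrier_mat r r" "M = eval_mat P" using M by (rule regular_matE)
  obtain c where c: "c \<noteq> 0" "\<And>x. det (M x) = c" using regular_det_const[OF M det] by blast
  let ?N = "\<lambda>x. (1 / c) \<cdot>\<^sub>m eval_mat (adj_mat P) x"
  note adj = adj_mat[OF P(1)]
  have N: "?N x \<in> carrier_mat r r" for x using adj(1) by simp
  have reg: "regular_mat r r ?N" by (intro regular_mat_smult regular_mat_eval adj)
  have MN: "M x * ?N x = 1\<^sub>m r" for x
  proof -
    have "M x * ?N x = (1 / c) \<cdot>\<^sub>m eval_mat (P * adj_mat P) x"
      using P adj(1) by (simp add: mult_smult_distrib[of _ r r _ r] eval_mat_mult[of _ r r _ r])
    also have "eval_mat (P * adj_mat P) x = c \<cdot>\<^sub>m 1\<^sub>m r"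
      unfolding adj(2) using c(2)[of x] P by (intro eq_matI) (auto simp: det_eval_mat)
    also have "(1 / c) \<cdot>\<^sub>m (c \<cdot>\<^sub>m 1\<^sub>m r) = 1\<^sub>m r" using c(1) by (intro eq_matI) auto
    finally show ?thesis .
  qed
  have NM: "?N x * M x = 1\<^sub>m r" for x
    by (rule mat_mult_left_right_inverse[OF _ _ MN]) (use M N in \<open>auto intro: regular_mat_carrier\<close>)
  have "det (?N x) \<noteq> 0" for x
  proof
    assume "det (?N x) = 0"
    then have "det (M x * ?N x) = 0"
      using det_mult[of "M x" r "?N x"] M N regular_mat_carrier by simp
    then show False unfolding MN by simp
  qed
  then show ?thesis using reg MN NM by blast
qed

section \<open>Twists and column modules\<close>

text \<open>The effect of a torus element on a map to the framing: \<open>u\<close> acts on the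
  rows, and \<open>t\<close> rescales the chart coordinate.\<close>

definition twist :: "(nat \<Rightarrow> complex) \<Rightarrow> complex \<Rightarrow> complex poly mat \<Rightarrow> complex poly mat" where
  "twist u t P = mat (dim_row P) (dim_col P) (\<lambda>(k, l). smult (u k) (pcompose (P $$ (k, l)) [:0, t:]))"

lemma twist_carrier: "P \<in> carrier_mat r c \<Longrightarrow> twist u t P \<in> carrier_mat r c"
  by (simp add: twist_def)

lemma eval_twist:
  "P \<in> carrier_mat r c \<Longrightarrow> eval_mat (twist u t P) x = mat_diag r u * eval_mat P (t * x)"
  by (subst mat_diag_mult_left[of _ r c]) (auto simp: twist_def poly_pcompose mult.commute intro!: eq_matI)

definition twist_vec :: "(nat \<Rightarrow> complex) \<Rightarrow> complex \<Rightarrow> complex poly vec \<Rightarrow> complex poly vec" where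
  "twist_vec u t g = vec (dim_vec g) (\<lambda>k. smult (u k) (pcompose (g $ k) [:0, t:]))"

text \<open>Unlike the matrix itself, this module does not change under an invertible base change of
  the source bundle, which makes it the invariant for classifying fixed points.\<close>

definition poly_span :: "complex poly mat \<Rightarrow> complex poly vec set" where
  "poly_span P = {P *\<^sub>v v | v. v \<in> carrier_vec (dim_col P)}"

text \<open>The twist is semilinear: it sends P v to (twist P) v(t x) = P (H v(t x)).\<close>

lemma poly_span_twist:
  assumes P: "P \<in> carrier_mat r c" and H: "H \<in> carrier_mat c c" and eq: "twist u t P = P * H"
    and g: "g \<in> poly_span P"
  shows "twist_vec u t g \<in> poly_span P"
proof -
  obtain v where v: "v \<in> carrier_vec c" "g = P *\<^sub>v v" using g P by (auto simp: poly_span_def)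
  let ?v = "vec c (\<lambda>k. pcompose (v $ k) [:0, t:])"
  have "twist_vec u t g = twist u t P *\<^sub>v ?v"
  proof (rule eq_vecI)
    fix k assume "k < dim_vec (twist u t P *\<^sub>v ?v)"
    then have k: "k < r" using P by (simp add: twist_def)
    have "twist_vec u t g $ k = smult (u k) (pcompose (\<Sum>l = 0..<c. P $$ (k, l) * v $ l) [:0, t:])"
      using k P v by (simp add: twist_vec_def scalar_prod_def)
    also have "\<dots> = (\<Sum>l = 0..<c. smult (u k) (pcompose (P $$ (k, l)) [:0, t:]) * pcompose (v $ l) [:0, t:])"
      by (induction c) (simp_all add: pcompose_add pcompose_mult smult_add_right)
    also have "\<dots> = (twist u t P *\<^sub>v ?v) $ k"
      using k P by (simp add: twist_def scalar_prod_def)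
    finally show "twist_vec u t g $ k = (twist u t P *\<^sub>v ?v) $ k" .
  qed (use P v in \<open>simp_all add: twist_vec_def twist_def\<close>)
  also have "\<dots> = P *\<^sub>v (H *\<^sub>v ?v)"
    unfolding eq using P H by (simp add: assoc_mult_mat_vec[of _ r c _ c])
  finally show ?thesis using P H by (auto simp: poly_span_def)
qed

text \<open>
  A subspace that is stable under a diagonal operator with distinct eigenvalues contains the
  eigencomponents of its elements.
\<close>

lemma monomials_mem:
  assumes carrier: "L \<subseteq> carrier_vec n"
    and add: "\<And>g h. g \<in> L \<Longrightarrow> h \<in> L \<Longrightarrow> g + h \<in> L"
    and smult: "\<And>g c. g \<in> L \<Longrightarrow> [:c:] \<cdot>\<^sub>v g \<in> L"
    and twist: "\<And>g. g \<in> L \<Longrightarrow> twist_vec u t g \<in> L"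
    and distinct: "\<And>k m k' m'. k < n \<Longrightarrow> k' < n \<Longrightarrow> u k * t ^ m = u k' * t ^ m' \<Longrightarrow> k = k' \<and> m = m'"
    and g: "g \<in> L" and k: "k < n" "coeff (g $ k) m \<noteq> 0"
  shows "monom 1 m \<cdot>\<^sub>v unit_vec n k \<in> L"
proof -
  define supp where "supp g = {(k, m). k < n \<and> coeff (g $ k) m \<noteq> 0}" for g :: "complex poly vec"
  have fin: "finite (supp g)" for g
  proof (rule finite_subset)
    show "supp g \<subseteq> (SIGMA k:{..<n}. {..degree (g $ k)})" by (auto simp: supp_def le_degree)
  qed auto
  have "(k, m) \<in> supp g" using k by (simp add: supp_def)
  then show ?thesis using g
  proof (induction "card (supp g)" arbitrary: g rule: less_induct)
    case less
    have gn: "dim_vec g = n" using less.prems carrier by auto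
    show ?case
    proof (cases "supp g = {(k, m)}")
      case True
      have coeff0: "coeff (g $ j) i = 0" if "j < n" "(j, i) \<noteq> (k, m)" for i j
        using that True by (auto simp: supp_def)
      have c: "coeff (g $ k) m \<noteq> 0" using less.prems by (simp add: supp_def)
      have "[:1 / coeff (g $ k) m:] \<cdot>\<^sub>v g = monom 1 m \<cdot>\<^sub>v unit_vec n k"
      proof (rule eq_vecI)
        fix j assume "j < dim_vec (monom 1 m \<cdot>\<^sub>v unit_vec n k :: complex poly vec)"
        then have j: "j < n" by simp
        show "([:1 / coeff (g $ k) m:] \<cdot>\<^sub>v g) $ j = (monom 1 m \<cdot>\<^sub>v unit_vec n k) $ j"
        proof (rule poly_eqI)
          fix i
          show "coeff (([:1 / coeff (g $ k) m:] \<cdot>\<^sub>v g) $ j) i = coeff ((monom 1 m \<cdot>\<^sub>v unit_vec n k) $ j) i"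
            using j gn c coeff0[of j i] k(1) by (cases "j = k"; cases "i = m") auto
        qed
      qed (simp add: gn)
      then show ?thesis using smult less.prems(2) by metis
    next
      case False
      then obtain k' m' where km': "(k', m') \<in> supp g" "(k', m') \<noteq> (k, m)"
        using less.prems(1) by (metis is_singletonI' singletonD empty_iff insertI1 subsetI subset_singletonD surj_pair)
      let ?l = "u k' * t ^ m'"
      \<comment> \<open>Twist minus eigenvalue kills exactly the monomial at (k', m') and multiplies
        every other coefficient by a nonzero number, the eigenvalues being distinct.\<close>
      let ?g = "twist_vec u t g + [:- ?l:] \<cdot>\<^sub>v g"
      have coeff: "coeff (?g $ j) i = (u j * t ^ i - ?l) * coeff (g $ j) i" if "j < n" for i j
        using that gn by (simp add: twist_vec_def coeff_pcompose_linear algebra_simps)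
      have k': "k' < n" using km' by (simp add: supp_def)
      have "u j * t ^ i - ?l = 0 \<longleftrightarrow> (j, i) = (k', m')" if "j < n" for i j
        using distinct[OF that k', of i m'] by auto
      then have "supp ?g = supp g - {(k', m')}"
        unfolding supp_def by (auto simp: coeff)
      then have "card (supp ?g) < card (supp g)" "(k, m) \<in> supp ?g"
        using km' less.prems(1) fin[of g] by (auto simp: card_Diff1_less simp del: card_Diff_insert)
      moreover have "?g \<in> L" using less.prems(2) by (intro add twist smult)
      ultimately show ?thesis by (rule less.hyps)
    qed
  qed
qed

lemma poly_span_monomials:
  assumes P: "P \<in> carrier_mat n c" and H: "H \<in> carrier_mat c c" and eq: "twist u t P = P * H"
    and distinct: "\<And>k m k' m'. k < n \<Longrightarrow> k' < n \<Longrightarrow> u k * t ^ m = u k' * t ^ m' \<Longrightarrow> k = k' \<and> m = m'"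
    and g: "g \<in> poly_span P" and k: "k < n" "coeff (g $ k) m \<noteq> 0"
  shows "monom 1 m \<cdot>\<^sub>v unit_vec n k \<in> poly_span P"
proof (rule monomials_mem[OF _ _ _ _ _ g k])
  show "poly_span P \<subseteq> carrier_vec n" using P by (auto simp: poly_span_def)
  show "g + h \<in> poly_span P" if gh: "g \<in> poly_span P" "h \<in> poly_span P" for g h
  proof -
    obtain v w where "v \<in> carrier_vec c" "g = P *\<^sub>v v" "w \<in> carrier_vec c" "h = P *\<^sub>v w"
      using gh P by (auto simp: poly_span_def)
    then have "g + h = P *\<^sub>v (v + w)" "v + w \<in> carrier_vec c"
      using P by (simp_all add: mult_add_distrib_mat_vec[of _ n c])
    then show ?thesis using P by (auto simp: poly_span_def)
  qed
  show "[:a:] \<cdot>\<^sub>v g \<in> poly_span P" if g: "g \<in> poly_span P" for g a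
  proof -
    obtain v where "v \<in> carrier_vec c" "g = P *\<^sub>v v" using g P by (auto simp: poly_span_def)
    then have "[:a:] \<cdot>\<^sub>v g = P *\<^sub>v ([:a:] \<cdot>\<^sub>v v)" "[:a:] \<cdot>\<^sub>v v \<in> carrier_vec c"
      using P by (auto intro!: eq_vecI simp: scalar_prod_smult_distrib[of _ c])
    then show ?thesis using P by (auto simp: poly_span_def)
  qed
  show "twist_vec u t g \<in> poly_span P" if "g \<in> poly_span P" for g
    using poly_span_twist[OF P H eq that] .
  show "k = k' \<and> m = m'" if "k < n" "k' < n" "u k * t ^ m = u k' * t ^ m'" for k m k' m'
    using distinct[OF that] .
qed

lemma poly_span_mat:
  assumes P: "P \<in> carrier_mat n c" and G: "G \<in> carrier_mat n d"
    and cols: "\<And>j. j < d \<Longrightarrow> col G j \<in> poly_span P"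
  obtains V where "V \<in> carrier_mat c d" "P * V = G"
proof -
  have "\<forall>j. \<exists>v. j < d \<longrightarrow> v \<in> carrier_vec c \<and> col G j = P *\<^sub>v v"
    using cols P unfolding poly_span_def by fastforce
  then obtain v where v: "\<And>j. j < d \<Longrightarrow> v j \<in> carrier_vec c \<and> col G j = P *\<^sub>v v j" by metis
  let ?V = "mat c d (\<lambda>(k, j). v j $ k)"
  have col: "col ?V j = v j" if "j < d" for j
    using that v[OF that] by (intro eq_vecI) auto
  have "P * ?V = G"
  proof (rule mat_col_eqI)
    fix j assume "j < dim_col G"
    then have j: "j < d" using G by simp
    have "col (P * ?V) j = P *\<^sub>v col ?V j"
      using P j by (intro col_mult2[of _ n c _ d]) auto
    then show "col (P * ?V) j = col G j" using col v j by simp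
  qed (use P G in auto)
  then show thesis by (intro that[of ?V]) auto
qed

text \<open>
  The column module of \<open>R\<close> is generated by monomials, whence the Smith-like form \<open>E * Q\<close> with
  \<open>E\<close> a diagonal matrix of monomials.
\<close>

lemma twist_stable_diagonal:
  assumes R: "R \<in> carrier_mat r r" "det R \<noteq> 0" and H: "H \<in> carrier_mat r r" and eq: "twist u t R = R * H"
    and distinct: "\<And>k m k' m'. k < r \<Longrightarrow> k' < r \<Longrightarrow> u k * t ^ m = u k' * t ^ m' \<Longrightarrow> k = k' \<and> m = m'"
  shows "\<exists>m Q. Q \<in> carrier_mat r r \<and> R = mat_diag r (\<lambda>j. monom 1 (m j)) * Q \<and> (\<forall>x. det (eval_mat Q x) \<noteq> 0)"
proof -
  have mons: "monom 1 d \<cdot>\<^sub>v unit_vec r k \<in> poly_span R"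
    if "g \<in> poly_span R" "k < r" "coeff (g $ k) d \<noteq> 0" for g k d
    by (rule poly_span_monomials[OF R(1) H eq _ that]) (use distinct in blast)
  have ex: "\<exists>d. monom 1 d \<cdot>\<^sub>v unit_vec r j \<in> poly_span R" if j: "j < r" for j
  proof -
    \<comment> \<open>Cramer's rule: R times its adjugate is det R, so the module contains det R e_j
      and hence x^d e_j for every monomial x^d occurring in det R.\<close>
    note adj = adj_mat[OF R(1)]
    have "R *\<^sub>v col (adj_mat R) j = col (R * adj_mat R) j"
      using j adj(1) R(1) by (intro col_mult2[symmetric, of _ r r _ r]) auto
    also have "\<dots> = det R \<cdot>\<^sub>v unit_vec r j"
      unfolding adj(2) using j by (intro eq_vecI) auto
    finally have mem: "det R \<cdot>\<^sub>v unit_vec r j \<in> poly_span R"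
      using R(1) adj(1) unfolding poly_span_def by (metis (mono_tags, lifting) CollectI carrier_matD(1) carrier_matD(2) col_carrier_vec j)
    obtain d where "coeff (det R) d \<noteq> 0" using R(2) by (meson leading_coeff_neq_0)
    then have "coeff ((det R \<cdot>\<^sub>v unit_vec r j) $ j) d \<noteq> 0" using j by simp
    then show ?thesis using mons[OF mem j] by blast
  qed
  \<comment> \<open>The minimal exponents work in both directions: E = R V since these monomials lie
    in the module, and E divides R since no lower ones do.\<close>
  define m where "m j = (LEAST d. monom 1 d \<cdot>\<^sub>v unit_vec r j \<in> poly_span R)" for j
  have m: "monom 1 (m j) \<cdot>\<^sub>v unit_vec r j \<in> poly_span R" if "j < r" for j
    unfolding m_def by (rule LeastI_ex[OF ex[OF that]])
  let ?E = "mat_diag r (\<lambda>j. monom 1 (m j)) :: complex poly mat"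
  have E: "?E \<in> carrier_mat r r" by simp
  have "col ?E j = monom 1 (m j) \<cdot>\<^sub>v unit_vec r j" if "j < r" for j
    using that by (intro eq_vecI) (auto simp: mat_diag_def)
  then obtain V where V: "V \<in> carrier_mat r r" "R * V = ?E"
    using poly_span_mat[OF R(1) E] m by metis
  have dvd: "monom 1 (m a) dvd R $$ (a, j)" if a: "a < r" and j: "j < r" for a j
    unfolding monom_1_dvd_iff'
  proof (intro allI impI, rule ccontr)
    fix d assume d: "d < m a" "coeff (R $$ (a, j)) d \<noteq> 0"
    have "R *\<^sub>v unit_vec r j = col R j"
      using R(1) j by (intro eq_vecI) auto
    then have mem: "col R j \<in> poly_span R"
      using R(1) unfolding poly_span_def by (metis (mono_tags, lifting) CollectI carrier_matD(2) unit_vec_carrier)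
    have "coeff (col R j $ a) d \<noteq> 0" using d a j R(1) by simp
    then have "monom 1 d \<cdot>\<^sub>v unit_vec r a \<in> poly_span R" using mons[OF mem a] by blast
    then have "m a \<le> d" unfolding m_def by (rule Least_le)
    then show False using d by simp
  qed
  let ?Q = "mat r r (\<lambda>(a, j). R $$ (a, j) div monom 1 (m a))"
  have Q: "?Q \<in> carrier_mat r r" by simp
  have R_eq: "R = ?E * ?Q"
    by (subst mat_diag_mult_left[of _ r r]) (use R(1) dvd in \<open>auto intro!: eq_matI\<close>)
  \<comment> \<open>From R = E Q and E = R V follows det R det Q det V = det R, so det Q is a
    unit.\<close>
  have "det R * (det ?Q * det V) = (det R * det V) * det ?Q" by (simp only: mult_ac)
  also have "det R * det V = det ?E" unfolding V(2)[symmetric] by (rule det_mult[OF R(1) V(1), symmetric])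
  also have "det ?E * det ?Q = det (?E * ?Q)" by (rule det_mult[OF E Q, symmetric])
  also have "\<dots> = det R * 1" using R_eq by simp
  finally have "det R * (det ?Q * det V) = det R * 1" .
  then have QV: "det ?Q * det V = 1" using R(2) mult_left_cancel by blast
  have "det (eval_mat ?Q x) \<noteq> 0" for x
  proof
    assume "det (eval_mat ?Q x) = 0"
    then have "poly (det ?Q * det V) x = 0" by (simp only: det_eval_mat poly_mult mult_zero_left)
    then show False unfolding QV by simp
  qed
  then show ?thesis using Q R_eq by blast
qed

section \<open>Representations of the quiver\<close>

lemma left_cancel_mat:
  fixes Z :: "'a :: semiring_1 mat"
  assumes "Z * Y = 1\<^sub>m i" "Z \<in> carrier_mat i n" "Y \<in> carrier_mat n i"
    and "A \<in> carrier_mat i c" "B \<in> carrier_mat i c" "Y * A = Y * B"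
  shows "A = B"
proof -
  have "A = Z * (Y * A)"
    using assms(1-5) left_mult_one_mat[of A i c] by (simp add: assoc_mult_mat[symmetric, of Z i n Y i A c])
  also have "\<dots> = Z * (Y * B)" by (simp only: assms(6))
  also have "\<dots> = B"
    using assms(1-5) left_mult_one_mat[of B i c] by (simp add: assoc_mult_mat[symmetric, of Z i n Y i B c])
  finally show ?thesis .
qed

lemma rep_spaceD:
  "r \<in> rep_space n \<Longrightarrow> 1 \<le> i \<Longrightarrow> i < n \<Longrightarrow> amap r i \<in> carrier_mat (i + 1) i"
  "r \<in> rep_space n \<Longrightarrow> 1 \<le> i \<Longrightarrow> i < n \<Longrightarrow> bmap r i \<in> carrier_mat i (i + 1)"
  by (auto simp: rep_space_def)

lemma mu_zero_rep_space: "r \<in> mu_zero n \<Longrightarrow> r \<in> rep_space n"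
  by (simp add: mu_zero_def)

lemma frame_fixing_carrier:
  "(\<And>i. 1 \<le> i \<Longrightarrow> i < n \<Longrightarrow> h i \<in> carrier_mat i i) \<Longrightarrow> 1 \<le> i \<Longrightarrow> i \<le> n \<Longrightarrow> frame_fixing n h i \<in> carrier_mat i i"
  by (auto simp: frame_fixing_def)

lemma frame_fixing_mult: "frame_fixing n (\<lambda>i. k i * h i) i = frame_fixing n k i * frame_fixing n h i"
  by (simp add: frame_fixing_def)

lemma intertwinesD:
  assumes "intertwines n h r r'" "1 \<le> i" "i < n"
  shows "amap r' i * frame_fixing n h i = frame_fixing n h (i + 1) * amap r i"
    "bmap r' i * frame_fixing n h (i + 1) = frame_fixing n h i * bmap r i"
  using assms by (simp_all add: intertwines_def)

lemma intertwines_refl: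
  assumes "r \<in> rep_space n"
  shows "intertwines n (\<lambda>i. 1\<^sub>m i) r r"
  unfolding intertwines_def
proof (intro ballI)
  fix i assume "i \<in> {1..<n}"
  then have i: "1 \<le> i" "i < n" by auto
  have f: "frame_fixing n (\<lambda>i. 1\<^sub>m i) j = 1\<^sub>m j" for j by (simp add: frame_fixing_def)
  show "amap r i * frame_fixing n (\<lambda>i. 1\<^sub>m i) i = frame_fixing n (\<lambda>i. 1\<^sub>m i) (i + 1) * amap r i \<and>
      bmap r i * frame_fixing n (\<lambda>i. 1\<^sub>m i) (i + 1) = frame_fixing n (\<lambda>i. 1\<^sub>m i) i * bmap r i"
    unfolding f
    using left_mult_one_mat[OF rep_spaceD(1)[OF assms i]] right_mult_one_mat[OF rep_spaceD(1)[OF assms i]]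
      left_mult_one_mat[OF rep_spaceD(2)[OF assms i]] right_mult_one_mat[OF rep_spaceD(2)[OF assms i]]
    by simp
qed

lemma intertwines_trans:
  assumes r: "r \<in> rep_space n" "r' \<in> rep_space n" "r'' \<in> rep_space n"
    and h: "\<And>i. 1 \<le> i \<Longrightarrow> i < n \<Longrightarrow> h i \<in> carrier_mat i i"
    and k: "\<And>i. 1 \<le> i \<Longrightarrow> i < n \<Longrightarrow> k i \<in> carrier_mat i i"
    and eq: "intertwines n h r r'" "intertwines n k r' r''"
  shows "intertwines n (\<lambda>i. k i * h i) r r''"
  unfolding intertwines_def frame_fixing_mult
proof (intro ballI)
  fix i assume "i \<in> {1..<n}"
  then have i: "1 \<le> i" "i < n" by auto
  let ?h = "frame_fixing n h" and ?k = "frame_fixing n k"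
  have c: "?h i \<in> carrier_mat i i" "?h (i+1) \<in> carrier_mat (i+1) (i+1)"
    "?k i \<in> carrier_mat i i" "?k (i+1) \<in> carrier_mat (i+1) (i+1)"
    using i by (auto intro!: frame_fixing_carrier h k)
  have "amap r'' i * (?k i * ?h i) = (amap r'' i * ?k i) * ?h i"
    by (rule assoc_mult_mat[symmetric]) (rule rep_spaceD[OF r(3) i] c)+
  also have "\<dots> = ?k (i+1) * amap r' i * ?h i" by (simp only: intertwinesD[OF eq(2) i])
  also have "\<dots> = ?k (i+1) * (amap r' i * ?h i)"
    by (rule assoc_mult_mat) (rule rep_spaceD[OF r(2) i] c)+
  also have "\<dots> = ?k (i+1) * (?h (i+1) * amap r i)" by (simp only: intertwinesD[OF eq(1) i])
  also have "\<dots> = ?k (i+1) * ?h (i+1) * amap r i"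
    by (rule assoc_mult_mat[symmetric]) (rule rep_spaceD[OF r(1) i] c)+
  finally have A: "amap r'' i * (?k i * ?h i) = ?k (i+1) * ?h (i+1) * amap r i" .
  have "bmap r'' i * (?k (i+1) * ?h (i+1)) = (bmap r'' i * ?k (i+1)) * ?h (i+1)"
    by (rule assoc_mult_mat[symmetric]) (rule rep_spaceD[OF r(3) i] c)+
  also have "\<dots> = ?k i * bmap r' i * ?h (i+1)" by (simp only: intertwinesD[OF eq(2) i])
  also have "\<dots> = ?k i * (bmap r' i * ?h (i+1))"
    by (rule assoc_mult_mat) (rule rep_spaceD[OF r(2) i] c)+
  also have "\<dots> = ?k i * (?h i * bmap r i)" by (simp only: intertwinesD[OF eq(1) i])
  also have "\<dots> = ?k i * ?h i * bmap r i"
    by (rule assoc_mult_mat[symmetric]) (rule rep_spaceD[OF r(1) i] c)+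
  finally show "amap r'' i * (?k i * ?h i) = ?k (i+1) * ?h (i+1) * amap r i \<and>
      bmap r'' i * (?k (i+1) * ?h (i+1)) = ?k i * ?h i * bmap r i"
    using A by simp
qed

lemma inverse_intertwine:
  fixes A :: "complex mat"
  assumes c: "h1 \<in> carrier_mat a a" "k1 \<in> carrier_mat a a" "h2 \<in> carrier_mat b b" "k2 \<in> carrier_mat b b"
    "A \<in> carrier_mat b a" "A' \<in> carrier_mat b a"
    and inv: "h1 * k1 = 1\<^sub>m a" "k2 * h2 = 1\<^sub>m b" and eq: "A' * h1 = h2 * A"
  shows "A * k1 = k2 * A'"
proof -
  have "A * k1 = (k2 * h2) * A * k1" using c inv by simp
  also have "\<dots> = k2 * (h2 * A) * k1" using c by (simp add: assoc_mult_mat[of k2 b b h2 b A a])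
  also have "\<dots> = k2 * (A' * h1) * k1" by (simp only: eq)
  also have "\<dots> = k2 * A' * (h1 * k1)"
    using c by (simp add: assoc_mult_mat[of k2 b b _ a _ a] assoc_mult_mat[of A' b a h1 a k1 a] mult_carrier_mat[of _ b a])
  also have "\<dots> = k2 * A'" using c by (simp add: inv mult_carrier_mat[of _ b b _ a])
  finally show ?thesis .
qed

lemma intertwines_sym:
  assumes r: "r \<in> rep_space n" "r' \<in> rep_space n"
    and h: "\<And>i. 1 \<le> i \<Longrightarrow> i < n \<Longrightarrow> h i \<in> carrier_mat i i"
    and k: "\<And>i. 1 \<le> i \<Longrightarrow> i < n \<Longrightarrow> k i \<in> carrier_mat i i"
    and inv: "\<And>i. 1 \<le> i \<Longrightarrow> i < n \<Longrightarrow> h i * k i = 1\<^sub>m i" "\<And>i. 1 \<le> i \<Longrightarrow> i < n \<Longrightarrow> k i * h i = 1\<^sub>m i"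
    and eq: "intertwines n h r r'"
  shows "intertwines n k r' r"
  unfolding intertwines_def
proof (intro ballI)
  fix i assume "i \<in> {1..<n}"
  then have i: "1 \<le> i" "i < n" by auto
  let ?h = "frame_fixing n h" and ?k = "frame_fixing n k"
  have c: "?h i \<in> carrier_mat i i" "?h (i+1) \<in> carrier_mat (i+1) (i+1)"
    "?k i \<in> carrier_mat i i" "?k (i+1) \<in> carrier_mat (i+1) (i+1)"
    using i by (auto intro!: frame_fixing_carrier h k)
  have "?h j * ?k j = 1\<^sub>m j" "?k j * ?h j = 1\<^sub>m j" if "1 \<le> j" "j \<le> n" for j
    using that inv by (auto simp: frame_fixing_def)
  then have inv': "?h i * ?k i = 1\<^sub>m i" "?k i * ?h i = 1\<^sub>m i"
    "?h (i+1) * ?k (i+1) = 1\<^sub>m (i+1)" "?k (i+1) * ?h (i+1) = 1\<^sub>m (i+1)"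
    using i by auto
  show "amap r i * ?k i = ?k (i+1) * amap r' i \<and> bmap r i * ?k (i+1) = ?k i * bmap r' i"
    using inverse_intertwine[OF c(1,3,2,4) rep_spaceD(1)[OF r(1) i] rep_spaceD(1)[OF r(2) i] inv'(1,4) intertwinesD(1)[OF eq i]]
      inverse_intertwine[OF c(2,4,1,3) rep_spaceD(2)[OF r(1) i] rep_spaceD(2)[OF r(2) i] inv'(3,2) intertwinesD(2)[OF eq i]]
    by simp
qed

section \<open>Composite maps to the framing\<close>

text \<open>The argument is the distance n - i from the framing, which turns a recursion descending
  from vertex n into a primitive one.\<close>

primrec frame_map_aux :: "nat \<Rightarrow> rep \<Rightarrow> nat \<Rightarrow> complex mat" where
  "frame_map_aux n r 0 = 1\<^sub>m n"
| "frame_map_aux n r (Suc k) = frame_map_aux n r k * amap r (n - Suc k)"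

text \<open>In the notation of the quiver variety, the composition $A_{n-1} \cdots A_i$.\<close>

definition frame_map :: "nat \<Rightarrow> rep \<Rightarrow> nat \<Rightarrow> complex mat" where
  "frame_map n r i = frame_map_aux n r (n - i)"

lemma frame_map_top [simp]: "frame_map n r n = 1\<^sub>m n"
  by (simp add: frame_map_def)

lemma frame_map_step: "i < n \<Longrightarrow> frame_map n r i = frame_map n r (i + 1) * amap r i"
proof -
  assume "i < n"
  then have "n - i = Suc (n - (i + 1))" "n - Suc (n - (i + 1)) = i" by auto
  then show ?thesis unfolding frame_map_def by (simp only: frame_map_aux.simps)
qed

lemma frame_map_carrier:
  assumes r: "r \<in> rep_space n" and i: "1 \<le> i" "i \<le> n"
  shows "frame_map n r i \<in> carrier_mat n i"
  using i(2,1)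
proof (induction i rule: inc_induct)
  case (step j)
  then show ?case
    using frame_map_step[of j n r] rep_spaceD(1)[OF r, of j] by (auto intro!: mult_carrier_mat[of _ n "j + 1"])
qed simp

text \<open>The base change at the framing is the identity, so an intertwiner alters the composite
  only on the right. Where the composite is injective, it therefore determines the
  intertwiner.\<close>

lemma frame_map_intertwines:
  assumes r: "r \<in> rep_space n" "r' \<in> rep_space n"
    and h: "\<And>i. 1 \<le> i \<Longrightarrow> i < n \<Longrightarrow> h i \<in> carrier_mat i i"
    and eq: "intertwines n h r r'" and i: "1 \<le> i" "i \<le> n"
  shows "frame_map n r' i * frame_fixing n h i = frame_map n r i"
  using i(2,1)
proof (induction i rule: inc_induct)
  case (step i)
  let ?h = "frame_fixing n h"
  have i: "1 \<le> i" "i < n" using step i by auto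
  have c: "?h i \<in> carrier_mat i i" "?h (i+1) \<in> carrier_mat (i+1) (i+1)"
    "frame_map n r' (i+1) \<in> carrier_mat n (i+1)"
    using i by (auto intro!: frame_fixing_carrier h frame_map_carrier r)
  have "frame_map n r' i * ?h i = frame_map n r' (i+1) * (amap r' i * ?h i)"
    unfolding frame_map_step[OF i(2)] by (rule assoc_mult_mat) (rule c rep_spaceD[OF r(2) i])+
  also have "\<dots> = frame_map n r' (i+1) * (?h (i+1) * amap r i)" by (simp only: intertwinesD[OF eq i])
  also have "\<dots> = frame_map n r' (i+1) * ?h (i+1) * amap r i"
    by (rule assoc_mult_mat[symmetric]) (rule c rep_spaceD[OF r(1) i])+
  also have "\<dots> = frame_map n r i"
    using step i by (simp add: frame_map_step[OF i(2)])
  finally show ?case .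
qed (simp add: frame_fixing_def)

text \<open>Among the A_i only the last is altered by the torus. At i = n the composite is empty,
  hence the restriction to i < n.\<close>

lemma frame_map_torus:
  assumes r: "r \<in> rep_space n" and i: "1 \<le> i" "i < n"
  shows "frame_map n (torus_rep n u h r) i = mat_diag n (\<lambda>k. u (k + 1)) * frame_map n r i"
proof -
  let ?D = "mat_diag n (\<lambda>k. u (k + 1))"
  have "i \<le> n - 1" using i by simp
  then show ?thesis using i(1)
  proof (induction i rule: inc_induct)
    case base
    then have n: "n - 1 < n" "n - 1 + 1 = n" by auto
    have "amap r (n - 1) \<in> carrier_mat n (n - 1)" using rep_spaceD(1)[OF r, of "n-1"] base n by simp
    then have "?D * amap r (n - 1) \<in> carrier_mat n (n - 1)"
      by (rule mult_carrier_mat[OF mat_diag_dim])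
    then show ?case
      using n left_mult_one_mat[of _ n "n - 1"] \<open>amap r (n - 1) \<in> carrier_mat n (n - 1)\<close>
      by (simp add: frame_map_step[OF n(1)] torus_rep_def del: One_nat_def)
  next
    case (step j)
    have j: "j < n" "j + 1 \<noteq> n" "1 \<le> j" using step by auto
    have c: "amap r j \<in> carrier_mat (j+1) j" "frame_map n r (j+1) \<in> carrier_mat n (j+1)"
      using j by (auto intro!: frame_map_carrier r rep_spaceD(1)[OF r, simplified])
    have "frame_map n (torus_rep n u h r) j = (?D * frame_map n r (j+1)) * amap r j"
      using step j by (simp add: frame_map_step[OF j(1)] torus_rep_def)
    also have "\<dots> = ?D * (frame_map n r (j+1) * amap r j)"
      by (rule assoc_mult_mat) (rule c mat_diag_dim)+
    finally show ?case by (simp add: frame_map_step[OF j(1)])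
  qed
qed

text \<open>A_i is the first map applied in the composite, so injectivity of the composite passes to
  A_i.\<close>

lemma semistable_of_left_inverse:
  assumes r: "r \<in> rep_space n"
    and inv: "\<And>i. 1 \<le> i \<Longrightarrow> i < n \<Longrightarrow> \<exists>Z\<in>carrier_mat i n. Z * frame_map n r i = 1\<^sub>m i"
  shows "semistable n r"
  unfolding semistable_def
proof (intro ballI inj_onI)
  fix i v w assume "i \<in> {1..<n}" and v: "v \<in> carrier_vec i" and w: "w \<in> carrier_vec i"
    and eq: "amap r i *\<^sub>v v = amap r i *\<^sub>v w"
  then have i: "1 \<le> i" "i < n" by auto
  obtain Z where Z: "Z \<in> carrier_mat i n" "Z * frame_map n r i = 1\<^sub>m i" using inv i by blast
  have c: "frame_map n r (i+1) \<in> carrier_mat n (i+1)" "frame_map n r i \<in> carrier_mat n i"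
    using i by (auto intro!: frame_map_carrier r)
  have A: "amap r i \<in> carrier_mat (i+1) i" by (rule rep_spaceD[OF r i])
  have *: "x = Z *\<^sub>v (frame_map n r (i+1) *\<^sub>v (amap r i *\<^sub>v x))" if x: "x \<in> carrier_vec i" for x
  proof -
    have "frame_map n r (i+1) *\<^sub>v (amap r i *\<^sub>v x) = frame_map n r i *\<^sub>v x"
      unfolding frame_map_step[OF i(2)] by (rule assoc_mult_mat_vec[symmetric, OF c(1) A x])
    then have "Z *\<^sub>v (frame_map n r (i+1) *\<^sub>v (amap r i *\<^sub>v x)) = (Z * frame_map n r i) *\<^sub>v x"
      by (simp only: assoc_mult_mat_vec[OF Z(1) c(2) x])
    then show ?thesis using x by (simp add: Z(2))
  qed
  show "v = w" using *[OF v] *[OF w] eq by simp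
qed

lemma mu_zero_of_bmap_0:
  assumes r: "r \<in> rep_space n" and b: "\<And>i. 1 \<le> i \<Longrightarrow> i < n \<Longrightarrow> bmap r i = 0\<^sub>m i (i + 1)"
  shows "r \<in> mu_zero n"
  unfolding mu_zero_def
proof (intro CollectI conjI ballI r)
  fix i assume "i \<in> {1..<n}"
  then have i: "1 \<le> i" "i < n" by auto
  have "amap r (i-1) * bmap r (i-1) = 0\<^sub>m i i" if "i \<noteq> 1"
  proof -
    have "amap r (i-1) \<in> carrier_mat i (i-1)" using rep_spaceD(1)[OF r, of "i-1"] i that by simp
    then show ?thesis using b[of "i-1"] i that by simp
  qed
  then show "moment_map r i = 0\<^sub>m i i"
    using b[OF i] rep_spaceD(1)[OF r i] by (auto simp: moment_map_def)
qed

section \<open>Coordinate flags and standard quasimaps\<close>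

text \<open>The inclusion of the i-th member of the flag into the framing. The columns are e_{I_1},
  ..., e_{I_i}, with indices shifted because matrix rows start at 0.\<close>

definition flag_mat :: "nat \<Rightarrow> (nat \<Rightarrow> nat) \<Rightarrow> nat \<Rightarrow> complex mat" where
  "flag_mat n I i = mat n i (\<lambda>(k, l). if k + 1 = I (l + 1) then 1 else 0)"

lemma flag_mat_carrier [simp]: "flag_mat n I i \<in> carrier_mat n i"
  by (simp add: flag_mat_def)

lemma permutes_index:
  fixes I :: "nat \<Rightarrow> nat"
  assumes "I permutes {1..n}" "l < n"
  shows "I (l + 1) - 1 < n" "I (l + 1) - 1 + 1 = I (l + 1)"
proof -
  have "I (l + 1) \<in> {1..n}" using permutes_in_image[OF assms(1), of "l + 1"] assms(2) by simp
  then show "I (l + 1) - 1 < n" "I (l + 1) - 1 + 1 = I (l + 1)" by auto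
qed

lemma permutes_eq:
  fixes I :: "nat \<Rightarrow> nat"
  assumes "I permutes {1..n}"
  shows "I (a + 1) = I (b + 1) \<longleftrightarrow> a = b"
  using permutes_inj[OF assms] by (auto simp: inj_eq)

lemma flag_mat_mult_index:
  assumes I: "I permutes {1..n}" and B: "B \<in> carrier_mat i c" and i: "i \<le> n" and l: "l < i" "j < c"
  shows "(flag_mat n I i * B) $$ (I (l + 1) - 1, j) = B $$ (l, j)"
proof -
  have "(flag_mat n I i * B) $$ (I (l + 1) - 1, j) = (\<Sum>a = 0..<i. (if a = l then 1 else 0) * B $$ (a, j))"
    using permutes_index[OF I, of l] B i l permutes_eq[OF I]
    by (auto simp: flag_mat_def scalar_prod_def intro!: sum.cong)
  also have "\<dots> = (\<Sum>a = 0..<i. if a = l then B $$ (a, j) else 0)" by (intro sum.cong) auto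
  also have "\<dots> = B $$ (l, j)" using l by simp
  finally show ?thesis .
qed

lemma flag_mat_left_inverse:
  assumes I: "I permutes {1..n}" and i: "i \<le> n"
  shows "transpose_mat (flag_mat n I i) * flag_mat n I i = 1\<^sub>m i"
proof (rule eq_matI)
  fix a b assume ab: "a < dim_row (1\<^sub>m i)" "b < dim_col (1\<^sub>m i)"
  have "(transpose_mat (flag_mat n I i) * flag_mat n I i) $$ (a, b) =
      (\<Sum>k = 0..<n. (if k + 1 = I (a + 1) then 1 else 0) * (if k + 1 = I (b + 1) then 1 else 0))"
    using ab by (auto simp: flag_mat_def scalar_prod_def intro!: sum.cong)
  also have "\<dots> = (\<Sum>k = 0..<n. if k = I (a + 1) - 1 then (if a = b then 1 else 0) else 0)"
  proof (rule sum.cong)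
    fix k
    have "k + 1 = I (a + 1) \<longleftrightarrow> k = I (a + 1) - 1" using permutes_index[OF I, of a] ab i by auto
    then show "(if k + 1 = I (a + 1) then 1 else 0) * (if k + 1 = I (b + 1) then 1 else 0) =
      (if k = I (a + 1) - 1 then (if a = b then 1 else 0) else (0 :: complex))"
      using permutes_eq[OF I, of a b] permutes_index[OF I, of a] ab i by auto
  qed simp
  also have "\<dots> = 1\<^sub>m i $$ (a, b)" using ab permutes_index[OF I, of a] i by simp
  finally show "(transpose_mat (flag_mat n I i) * flag_mat n I i) $$ (a, b) = 1\<^sub>m i $$ (a, b)" .
qed (simp_all add: flag_mat_def)

lemma flag_mat_diag:
  assumes I: "I permutes {1..n}" and i: "i \<le> n"
  shows "mat_diag n (\<lambda>k. u (k + 1)) * flag_mat n I i = flag_mat n I i * mat_diag i (\<lambda>j. u (I (j + 1)))"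
  by (subst mat_diag_mult_left[of _ n i], simp, subst mat_diag_mult_right[of _ n], simp)
    (auto simp: flag_mat_def intro!: eq_matI)

lemma flag_rep_rep_space: "flag_rep n I \<in> rep_space n"
  by (auto simp: rep_space_def flag_rep_def)

lemma mult_inclusion:
  fixes M :: "complex mat"
  assumes "M \<in> carrier_mat n (i + 1)"
  shows "M * mat (i + 1) i (\<lambda>(k, l). if k = l then 1 else 0) = mat n i (\<lambda>(k, l). M $$ (k, l))"
proof (rule eq_matI)
  fix k l assume "k < dim_row (mat n i (\<lambda>(k, l). M $$ (k, l)))" "l < dim_col (mat n i (\<lambda>(k, l). M $$ (k, l)))"
  then have kl: "k < n" "l < i" by auto
  have "(M * mat (i + 1) i (\<lambda>(k, l). if k = l then 1 else 0)) $$ (k, l) =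
      (\<Sum>a = 0..<i+1. M $$ (k, a) * (if a = l then 1 else 0))"
    using assms kl by (auto simp: scalar_prod_def intro!: sum.cong)
  also have "\<dots> = (\<Sum>a = 0..<i+1. if a = l then M $$ (k, a) else 0)" by (intro sum.cong) auto
  also have "\<dots> = M $$ (k, l)" using kl by simp
  finally show "(M * mat (i + 1) i (\<lambda>(k, l). if k = l then 1 else 0)) $$ (k, l) =
      mat n i (\<lambda>(k, l). M $$ (k, l)) $$ (k, l)" using kl by simp
qed (use assms in auto)

lemma amap_flag_rep:
  "i + 1 = n \<Longrightarrow> amap (flag_rep n I) i = flag_mat n I i"
  "i + 1 \<noteq> n \<Longrightarrow> amap (flag_rep n I) i = mat (i + 1) i (\<lambda>(k, l). if k = l then 1 else 0)"
  by (auto simp: flag_rep_def flag_mat_def intro!: eq_matI)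

text \<open>
  The bundle at vertex \<open>i\<close> is the sum of the $\mathcal O(-m(i,j))$. The truncated subtraction is
  a true one for the \<open>valid_exponents\<close> below.
\<close>

definition std_rep :: "nat \<Rightarrow> (nat \<Rightarrow> nat) \<Rightarrow> (nat \<Rightarrow> nat \<Rightarrow> nat) \<Rightarrow> complex \<Rightarrow> rep" where
  "std_rep n I m x = \<lparr>
     amap = (\<lambda>i. amap (flag_rep n I) i * mat_diag i (\<lambda>l. x ^ (m i l - m (i + 1) l))),
     bmap = (\<lambda>i. 0\<^sub>m i (i + 1))\<rparr>"

text \<open>All degeneration sits at x = 0; near infinity the quasimap is constant with value the
  flag.\<close>

definition std_qm :: "nat \<Rightarrow> (nat \<Rightarrow> nat) \<Rightarrow> (nat \<Rightarrow> nat \<Rightarrow> nat) \<Rightarrow> quasimap" where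
  "std_qm n I m = \<lparr>
     transition = (\<lambda>i x. if i = n then 1\<^sub>m n else mat_diag i (\<lambda>j. x ^ m i j)),
     sect0 = std_rep n I m,
     sectinf = (\<lambda>_. flag_rep n I)\<rparr>"

text \<open>Vanishing outside the triangle makes the array unique. The zeros at i = n belong to the
  trivial framing bundle, so that the last monotonicity condition compares with 0.\<close>

definition valid_exponents :: "nat \<Rightarrow> (nat \<Rightarrow> nat \<Rightarrow> nat) \<Rightarrow> bool" where
  "valid_exponents n m \<longleftrightarrow> (\<forall>i j. i \<notin> {1..<n} \<or> j \<ge> i \<longrightarrow> m i j = 0) \<and>
     (\<forall>i\<in>{1..<n}. \<forall>j<i. m (i + 1) j \<le> m i j)"

lemma std_rep_rep_space: "std_rep n I m x \<in> rep_space n"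
  using rep_spaceD(1)[OF flag_rep_rep_space, of _ n I]
  by (auto simp: rep_space_def std_rep_def intro: mult_carrier_mat[OF _ mat_diag_dim])

text \<open>The exponents m(i,l) - m(i+1,l) of the successive maps telescope to m(i,l). Monotonicity
  makes the truncated differences genuine.\<close>

lemma frame_map_std:
  assumes m: "valid_exponents n m" and i: "1 \<le> i" "i < n"
  shows "frame_map n (std_rep n I m x) i = flag_mat n I i * mat_diag i (\<lambda>j. x ^ m i j)"
proof -
  have "i \<le> n - 1" using i by simp
  then show ?thesis using i(1)
  proof (induction i rule: inc_induct)
    case base
    then have n: "n - 1 < n" "n - 1 + 1 = n" by auto
    have "m n l = 0" for l using m by (simp add: valid_exponents_def)
    moreover have "flag_mat n I (n - 1) * mat_diag (n - 1) (\<lambda>j. x ^ m (n - 1) j) \<in> carrier_mat n (n - 1)"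
      by (rule mult_carrier_mat[OF flag_mat_carrier mat_diag_dim])
    ultimately show ?case
      using n left_mult_one_mat[of _ n "n - 1"] by (simp add: frame_map_step[OF n(1)] std_rep_def amap_flag_rep del: One_nat_def)
  next
    case (step j)
    have j: "j < n" "j + 1 \<noteq> n" "1 \<le> j" using step by auto
    let ?N = "flag_mat n I (j+1) * mat_diag (j+1) (\<lambda>l. x ^ m (j+1) l)"
    let ?J = "mat (j + 1) j (\<lambda>(k, l). if k = l then 1 else 0) :: complex mat"
    let ?D = "mat_diag j (\<lambda>l. x ^ (m j l - m (j + 1) l))"
    have N: "?N \<in> carrier_mat n (j+1)" by (rule mult_carrier_mat[of _ n "j+1"]) simp_all
    have le: "m (j + 1) l \<le> m j l" if "l < j" for l using m that j by (auto simp: valid_exponents_def)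
    have "frame_map n (std_rep n I m x) j = ?N * (?J * ?D)"
      using step j by (simp add: frame_map_step[OF j(1)] std_rep_def amap_flag_rep)
    also have "\<dots> = (?N * ?J) * ?D"
      by (rule assoc_mult_mat[symmetric, OF N _ mat_diag_dim]) simp
    also have "\<dots> = flag_mat n I j * mat_diag j (\<lambda>l. x ^ m j l)"
      unfolding mult_inclusion[OF N]
      by (subst mat_diag_mult_right[of _ n], simp, subst mat_diag_mult_right[of _ n], simp,
          subst mat_diag_mult_right[of _ n], simp)
        (auto simp: flag_mat_def power_add[symmetric] le[simplified] intro!: eq_matI)
    finally show ?case .
  qed
qed

lemma frame_map_flag:
  assumes i: "1 \<le> i" "i < n"
  shows "frame_map n (flag_rep n I) i = flag_mat n I i"
proof -
  have "flag_rep n I = std_rep n I (\<lambda>_ _. 0) 1"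
    using rep_spaceD(1)[OF flag_rep_rep_space, of _ n I]
    by (simp add: std_rep_def flag_rep_def fun_eq_iff)
  then show ?thesis
    using frame_map_std[of n "\<lambda>_ _. 0" i I 1] i by (simp add: valid_exponents_def flag_mat_def)
qed

section \<open>The torus action\<close>

lemma mat_diag_inverse:
  assumes "\<And>k. k < n \<Longrightarrow> a k * b k = (1 :: complex)"
  shows "mat_diag n a * mat_diag n b = 1\<^sub>m n"
  unfolding mat_diag_diag using assms by (auto simp: mat_diag_def intro!: eq_matI)

lemma torus_rep_sel:
  "amap (torus_rep n u h r) i = (if i + 1 = n then mat_diag n (\<lambda>k. u (k + 1)) * amap r i else amap r i)"
  "bmap (torus_rep n u h r) i = inverse h \<cdot>\<^sub>m
     (if i + 1 = n then bmap r i * mat_diag n (\<lambda>k. inverse (u (k + 1))) else bmap r i)"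
  by (simp_all add: torus_rep_def)

lemma torus_rep_rep_space:
  assumes "r \<in> rep_space n"
  shows "torus_rep n u h r \<in> rep_space n"
  unfolding rep_space_def
proof (intro CollectI ballI)
  fix i assume "i \<in> {1..<n}"
  then have i: "1 \<le> i" "i < n" by auto
  note c = rep_spaceD[OF assms i]
  have "mat_diag n (\<lambda>k. u (k + 1)) * amap r i \<in> carrier_mat n i" if "i + 1 = n"
    by (rule mult_carrier_mat[OF mat_diag_dim]) (use c that in simp)
  moreover have "bmap r i * mat_diag n (\<lambda>k. inverse (u (k + 1))) \<in> carrier_mat i n" if "i + 1 = n"
    by (rule mult_carrier_mat[OF _ mat_diag_dim]) (use c that in simp)
  ultimately show "amap (torus_rep n u h r) i \<in> carrier_mat (i + 1) i \<and>
      bmap (torus_rep n u h r) i \<in> carrier_mat i (i + 1)"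
    using c by (auto simp: torus_rep_sel)
qed

text \<open>The weights act at the framing, where base changes are the identity, and scaling
  commutes with everything.\<close>

lemma torus_intertwines:
  assumes r: "r \<in> rep_space n" "r' \<in> rep_space n"
    and g: "\<And>i. 1 \<le> i \<Longrightarrow> i < n \<Longrightarrow> g i \<in> carrier_mat i i"
    and eq: "intertwines n g r r'"
  shows "intertwines n g (torus_rep n u h r) (torus_rep n u h r')"
  unfolding intertwines_def
proof (intro ballI conjI)
  fix i assume "i \<in> {1..<n}"
  then have i: "1 \<le> i" "i < n" by auto
  note c = rep_spaceD[OF r(1) i] rep_spaceD[OF r(2) i]
  note e = intertwinesD[OF eq i]
  let ?g = "frame_fixing n g" and ?D = "mat_diag n (\<lambda>k. u (k + 1))"
    and ?D' = "mat_diag n (\<lambda>k. inverse (u (k + 1)))"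
  have gi: "?g i = g i" "g i \<in> carrier_mat i i" using i g by (auto simp: frame_fixing_def)
  have g': "?g (i+1) \<in> carrier_mat (i+1) (i+1)" using i g by (intro frame_fixing_carrier) auto
  show "amap (torus_rep n u h r') i * ?g i = ?g (i + 1) * amap (torus_rep n u h r) i"
  proof (cases "i + 1 = n")
    case True
    then have g1: "?g (i+1) = 1\<^sub>m n" by (simp add: frame_fixing_def)
    have A: "amap r i \<in> carrier_mat n i" "amap r' i \<in> carrier_mat n i" using c True by auto
    have "amap (torus_rep n u h r') i * ?g i = ?D * (amap r' i * g i)"
      using True gi A by (simp add: torus_rep_sel assoc_mult_mat[OF mat_diag_dim A(2) gi(2)])
    also have "amap r' i * g i = amap r i" using e(1) gi g1 A by simp
    also have "?D * amap r i = 1\<^sub>m n * (?D * amap r i)"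
      by (rule left_mult_one_mat[symmetric, OF mult_carrier_mat[OF mat_diag_dim A(1)]])
    finally show ?thesis using True g1 by (simp add: torus_rep_sel)
  next
    case False
    then show ?thesis using e(1) by (simp add: torus_rep_sel)
  qed
  show "bmap (torus_rep n u h r') i * ?g (i + 1) = ?g i * bmap (torus_rep n u h r) i"
  proof (cases "i + 1 = n")
    case True
    then have g1: "?g (i+1) = 1\<^sub>m n" by (simp add: frame_fixing_def)
    have B: "bmap r i \<in> carrier_mat i n" "bmap r' i \<in> carrier_mat i n" using c True by auto
    have "bmap r' i = g i * bmap r i" using e(2) gi g1 B by simp
    then have "bmap r' i * ?D' = g i * (bmap r i * ?D')"
      by (simp add: assoc_mult_mat[OF gi(2) B(1) mat_diag_dim])
    then have "inverse h \<cdot>\<^sub>m (bmap r' i * ?D') = g i * (inverse h \<cdot>\<^sub>m (bmap r i * ?D'))"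
      by (simp add: mult_smult_distrib[OF gi(2) mult_carrier_mat[OF B(1) mat_diag_dim]])
    moreover have "inverse h \<cdot>\<^sub>m (bmap r' i * ?D') \<in> carrier_mat i n"
      using mult_carrier_mat[OF B(2) mat_diag_dim] by simp
    ultimately show ?thesis using True g1 gi right_mult_one_mat[of _ i n] by (simp add: torus_rep_sel)
  next
    case False
    have "(inverse h \<cdot>\<^sub>m bmap r' i) * ?g (i + 1) = inverse h \<cdot>\<^sub>m (bmap r' i * ?g (i + 1))"
      by (rule mult_smult_assoc_mat[OF c(4) g'])
    also have "\<dots> = ?g i * (inverse h \<cdot>\<^sub>m bmap r i)"
      unfolding e(2) using gi by (simp add: mult_smult_distrib[OF gi(2) c(2)])
    finally show ?thesis using False by (simp add: torus_rep_sel)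
  qed
qed

lemma minus_mat_eq_0:
  fixes A :: "complex mat"
  assumes "A \<in> carrier_mat r c" "B \<in> carrier_mat r c"
  shows "A - B = 0\<^sub>m r c \<longleftrightarrow> A = B"
proof
  assume eq: "A - B = 0\<^sub>m r c"
  show "A = B"
  proof (rule eq_matI)
    fix k l assume "k < dim_row B" "l < dim_col B"
    then have kl: "k < r" "l < c" "k < dim_row B" "l < dim_col B" using assms by auto
    have "(A - B) $$ (k, l) = 0" unfolding eq using kl by simp
    then show "A $$ (k, l) = B $$ (k, l)" using kl by simp
  qed (use assms in auto)
qed (use assms in auto)

text \<open>Every term of the moment map contains exactly one B, so the moment map scales by 1/h;
  the diagonal matrices at the framing cancel in B_{n-1} A_{n-1}.\<close>

lemma torus_mu_zero:
  assumes r: "r \<in> mu_zero n" and u: "torus_point n u h q"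
  shows "torus_rep n u h r \<in> mu_zero n"
proof -
  let ?r = "torus_rep n u h r" and ?D = "mat_diag n (\<lambda>k. u (k + 1))"
    and ?D' = "mat_diag n (\<lambda>k. inverse (u (k + 1)))"
  have rs: "r \<in> rep_space n" using r by (rule mu_zero_rep_space)
  have BA: "bmap ?r i * amap ?r i = inverse h \<cdot>\<^sub>m (bmap r i * amap r i)" if i: "1 \<le> i" "i < n" for i
  proof (cases "i + 1 = n")
    case True
    have A: "amap r i \<in> carrier_mat n i" and B: "bmap r i \<in> carrier_mat i n"
      using rep_spaceD[OF rs i] True by auto
    have "?D' * ?D = 1\<^sub>m n" using u by (intro mat_diag_inverse) (auto simp: torus_point_def)
    then have "?D' * (?D * amap r i) = amap r i"
      using assoc_mult_mat[OF mat_diag_dim mat_diag_dim A, symmetric] left_mult_one_mat[OF A] by simp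
    then have "bmap r i * ?D' * (?D * amap r i) = bmap r i * amap r i"
      using assoc_mult_mat[OF B mat_diag_dim mult_carrier_mat[OF mat_diag_dim A]] by simp
    then show ?thesis
      using True mult_smult_assoc_mat[OF mult_carrier_mat[OF B mat_diag_dim] mult_carrier_mat[OF mat_diag_dim A]]
      by (simp add: torus_rep_sel)
  next
    case False
    then show ?thesis
      using mult_smult_assoc_mat[OF rep_spaceD(2,1)[OF rs i]] by (simp add: torus_rep_sel)
  qed
  have AB: "amap ?r (i - 1) * bmap ?r (i - 1) = inverse h \<cdot>\<^sub>m (amap r (i - 1) * bmap r (i - 1))"
    if i: "1 < i" "i < n" for i
  proof -
    have i': "1 \<le> i - 1" "i - 1 < n" "i - 1 + 1 \<noteq> n" using i by auto
    then show ?thesis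
      using mult_smult_distrib[OF rep_spaceD(1,2)[OF rs i'(1,2)]] by (simp add: torus_rep_sel)
  qed
  show ?thesis
    unfolding mu_zero_def
  proof (intro CollectI conjI ballI torus_rep_rep_space rs)
    fix i assume "i \<in> {1..<n}"
    then have i: "1 \<le> i" "i < n" by auto
    have BAc: "bmap r i * amap r i \<in> carrier_mat i i"
      by (rule mult_carrier_mat[OF rep_spaceD(2,1)[OF rs i]])
    have mom: "moment_map r i = 0\<^sub>m i i" using r i by (auto simp: mu_zero_def)
    show "moment_map ?r i = 0\<^sub>m i i"
    proof (cases "i = 1")
      case True
      have "0\<^sub>m i i = bmap r i * amap r i"
        using mom True minus_mat_eq_0[OF zero_carrier_mat BAc] by (simp add: moment_map_def)
      then have "bmap ?r i * amap ?r i = 0\<^sub>m i i" using BA[OF i] by (metis smult_zero_mat)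
      then show ?thesis using True by (simp add: moment_map_def)
    next
      case False
      have ABc: "amap r (i - 1) * bmap r (i - 1) \<in> carrier_mat i i"
        using rep_spaceD[OF rs, of "i - 1"] i False by (intro mult_carrier_mat[of _ i "i - 1"]) auto
      have "amap r (i - 1) * bmap r (i - 1) = bmap r i * amap r i"
        using mom False minus_mat_eq_0[OF ABc BAc] by (simp add: moment_map_def)
      then have "amap ?r (i - 1) * bmap ?r (i - 1) = bmap ?r i * amap ?r i"
        using BA[OF i] AB[of i] i False by simp
      moreover have "bmap ?r i * amap ?r i \<in> carrier_mat i i" using BA[OF i] BAc by simp
      ultimately show ?thesis using False minus_mat_eq_0 by (simp add: moment_map_def)
    qed
  qed
qed

lemma torus_semistable:
  assumes r: "r \<in> rep_space n" and u: "torus_point n u h q" and s: "semistable n r"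
  shows "semistable n (torus_rep n u h r)"
  unfolding semistable_def
proof (intro ballI)
  fix i assume "i \<in> {1..<n}"
  then have i: "1 \<le> i" "i < n" by auto
  have inj: "inj_on (\<lambda>v. amap r i *\<^sub>v v) (carrier_vec i)"
    using s i by (auto simp: semistable_def)
  show "inj_on (\<lambda>v. amap (torus_rep n u h r) i *\<^sub>v v) (carrier_vec i)"
  proof (cases "i + 1 = n")
    case True
    let ?D = "mat_diag n (\<lambda>k. u (k + 1))" and ?D' = "mat_diag n (\<lambda>k. inverse (u (k + 1)))"
    have A: "amap r i \<in> carrier_mat n i" using rep_spaceD(1)[OF r i] True by simp
    have D: "?D' * ?D = 1\<^sub>m n" using u by (intro mat_diag_inverse) (auto simp: torus_point_def)
    have *: "amap r i *\<^sub>v v = ?D' *\<^sub>v ((?D * amap r i) *\<^sub>v v)" if v: "v \<in> carrier_vec i" for v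
    proof -
      have Av: "amap r i *\<^sub>v v \<in> carrier_vec n" using A v by simp
      have "?D' *\<^sub>v ((?D * amap r i) *\<^sub>v v) = ?D' *\<^sub>v (?D *\<^sub>v (amap r i *\<^sub>v v))"
        by (simp add: assoc_mult_mat_vec[OF mat_diag_dim A v])
      also have "\<dots> = (?D' * ?D) *\<^sub>v (amap r i *\<^sub>v v)"
        by (rule assoc_mult_mat_vec[symmetric, OF mat_diag_dim mat_diag_dim Av])
      finally show ?thesis using Av unfolding D by simp
    qed
    show ?thesis
    proof (rule inj_onI)
      fix v w assume vw: "v \<in> carrier_vec i" "w \<in> carrier_vec i"
        "amap (torus_rep n u h r) i *\<^sub>v v = amap (torus_rep n u h r) i *\<^sub>v w"
      then have "amap r i *\<^sub>v v = amap r i *\<^sub>v w" using *[of v] *[of w] True by (simp add: torus_rep_sel)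
      then show "v = w" using inj vw by (auto dest: inj_onD)
    qed
  next
    case False
    then show ?thesis using inj by (simp add: torus_rep_sel)
  qed
qed

section \<open>The torus action on quasimaps\<close>

lemma quasimapD:
  assumes "is_quasimap n f"
  shows "1 \<le> i \<Longrightarrow> i < n \<Longrightarrow> transition_mat i (transition f i)"
    and "x \<noteq> 0 \<Longrightarrow> transition f n x = 1\<^sub>m n"
    and "regular_section n (sect0 f)" "regular_section n (sectinf f)"
    and "x \<noteq> 0 \<Longrightarrow> intertwines n (\<lambda>i. transition f i x) (sect0 f x) (sectinf f (1 / x))"
    and "sect0 f x \<in> mu_zero n" "sectinf f x \<in> mu_zero n"
    and "sect0 f x \<in> rep_space n" "sectinf f x \<in> rep_space n"
    and "finite {x. \<not> semistable n (sect0 f x)}"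
  using assms mu_zero_rep_space unfolding is_quasimap_def by auto

lemma transition_carrier:
  "is_quasimap n f \<Longrightarrow> 1 \<le> i \<Longrightarrow> i < n \<Longrightarrow> x \<noteq> 0 \<Longrightarrow> transition f i x \<in> carrier_mat i i"
  using quasimapD(1)[of n f i] by (auto simp: transition_mat_def)

lemma transition_mat_rescale:
  assumes g: "transition_mat r g" and q: "q \<noteq> 0"
  shows "transition_mat r (\<lambda>x. g (x / q))"
  unfolding transition_mat_def
proof (intro conjI allI impI)
  fix k l assume "k < r" "l < r"
  then obtain p m where p: "\<And>x. x \<noteq> 0 \<Longrightarrow> g x $$ (k, l) = poly p x / x ^ m"
    using g unfolding transition_mat_def by blast
  have "g (x / q) $$ (k, l) = poly (smult (q ^ m) (pcompose p [:0, 1 / q:])) x / x ^ m" if "x \<noteq> 0" for x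
    using p[of "x / q"] that q by (simp add: poly_pcompose power_divide)
  then show "\<exists>p m. \<forall>x. x \<noteq> 0 \<longrightarrow> g (x / q) $$ (k, l) = poly p x / x ^ m" by blast
qed (use g q in \<open>auto simp: transition_mat_def\<close>)

lemma regular_section_torus:
  assumes \<phi>: "regular_section n \<phi>"
  shows "regular_section n (\<lambda>x. torus_rep n u h (\<phi> (a * x)))"
  unfolding regular_section_def
proof (intro ballI)
  fix i assume i: "i \<in> {1..<n}"
  have A: "regular_mat (i+1) i (\<lambda>x. amap (\<phi> (a * x)) i)" and B: "regular_mat i (i+1) (\<lambda>x. bmap (\<phi> (a * x)) i)"
    using \<phi> i by (auto simp: regular_section_def intro: regular_mat_compose[of _ _ "\<lambda>x. amap (\<phi> x) i"]
        regular_mat_compose[of _ _ "\<lambda>x. bmap (\<phi> x) i"])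
  show "regular_mat (i+1) i (\<lambda>x. amap (torus_rep n u h (\<phi> (a * x))) i) \<and>
      regular_mat i (i+1) (\<lambda>x. bmap (torus_rep n u h (\<phi> (a * x))) i)"
  proof (cases "i + 1 = n")
    case True
    then have "regular_mat n i (\<lambda>x. amap (\<phi> (a * x)) i)" "regular_mat i n (\<lambda>x. bmap (\<phi> (a * x)) i)"
      using A B by simp_all
    then show ?thesis
      using True regular_mat_mult[OF regular_mat_const[OF mat_diag_dim[of n "\<lambda>k. u (k + 1)"]]]
        regular_mat_smult[OF regular_mat_mult[OF _ regular_mat_const[OF mat_diag_dim[of n "\<lambda>k. inverse (u (k + 1))"]]]]
      by (simp add: torus_rep_sel)
  next
    case False
    then show ?thesis using A B by (simp add: torus_rep_sel regular_mat_smult)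
  qed
qed

lemma torus_qm_sel:
  "transition (torus_qm n u h q f) i x = transition f i (x / q)"
  "sect0 (torus_qm n u h q f) x = torus_rep n u h (sect0 f (x / q))"
  "sectinf (torus_qm n u h q f) x = torus_rep n u h (sectinf f (q * x))"
  by (simp_all add: torus_qm_def)

lemma torus_is_quasimap:
  assumes f: "is_quasimap n f" and u: "torus_point n u h q"
  shows "is_quasimap n (torus_qm n u h q f)"
  unfolding is_quasimap_def
proof (intro conjI ballI allI impI)
  let ?f = "torus_qm n u h q f"
  have q: "q \<noteq> 0" using u by (simp add: torus_point_def)
  show "transition_mat i (transition ?f i)" if "i \<in> {1..<n}" for i
    using transition_mat_rescale[OF quasimapD(1)[OF f] q, of i] that by (simp add: torus_qm_def)
  show "transition ?f n x = 1\<^sub>m n" if "x \<noteq> 0" for x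
    using quasimapD(2)[OF f, of "x / q"] that q by (simp add: torus_qm_sel)
  show "regular_section n (sect0 ?f)"
    using regular_section_torus[OF quasimapD(3)[OF f], of u h "1 / q"] by (simp add: torus_qm_def)
  show "regular_section n (sectinf ?f)"
    using regular_section_torus[OF quasimapD(4)[OF f], of u h q] by (simp add: torus_qm_def)
  show "intertwines n (\<lambda>i. transition ?f i x) (sect0 ?f x) (sectinf ?f (1 / x))" if x: "x \<noteq> 0" for x
  proof -
    have x': "x / q \<noteq> 0" using x q by simp
    have "intertwines n (\<lambda>i. transition f i (x / q)) (sect0 f (x / q)) (sectinf f (q * (1 / x)))"
      using quasimapD(5)[OF f x'] by simp
    then show ?thesis
      unfolding torus_qm_sel using transition_carrier[OF f _ _ x'] quasimapD[OF f]
      by (intro torus_intertwines) auto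
  qed
  show "sect0 ?f x \<in> mu_zero n" "sectinf ?f x \<in> mu_zero n" for x
    unfolding torus_qm_sel using quasimapD[OF f] u by (auto intro: torus_mu_zero)
  have "{x. \<not> semistable n (sect0 ?f x)} \<subseteq> (\<lambda>x. q * x) ` {x. \<not> semistable n (sect0 f x)}"
  proof
    fix x assume "x \<in> {x. \<not> semistable n (sect0 ?f x)}"
    then have "\<not> semistable n (sect0 f (x / q))"
      using torus_semistable[OF quasimapD(8)[OF f] u, of "x / q"] by (auto simp: torus_qm_sel)
    moreover have "x = q * (x / q)" using q by simp
    ultimately show "x \<in> (\<lambda>x. q * x) ` {x. \<not> semistable n (sect0 f x)}" by blast
  qed
  then show "finite {x. \<not> semistable n (sect0 ?f x)}"
    using quasimapD(10)[OF f] finite_surj by blast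
qed

text \<open>\<open>std_rep\<close> is homogeneous: an entry x^e acquires q^{-e} from the
  substitution x/q, and e = m(i,j) - m(i+1,j) is a difference of exponents at two neighbouring
  vertices. Base changes by q^{-m(i,j)} u_{I_j} therefore undo the action.\<close>

lemma std_rep_torus:
  assumes I: "I permutes {1..n}" and m: "valid_exponents n m" and u: "torus_point n u h q"
  shows "intertwines n (\<lambda>i. mat_diag i (\<lambda>j. u (I (j + 1)) * q powi (- int (m i j))))
    (torus_rep n u h (std_rep n I m (x / q))) (std_rep n I m x)"
  unfolding intertwines_def
proof (intro ballI conjI)
  have q: "q \<noteq> 0" using u by (simp add: torus_point_def)
  fix i assume "i \<in> {1..<n}"
  then have i: "1 \<le> i" "i < n" by auto
  let ?h = "\<lambda>i. mat_diag i (\<lambda>j. u (I (j + 1)) * q powi (- int (m i j)))"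
  let ?F = "amap (flag_rep n I) i" and ?e = "\<lambda>l. m i l - m (i + 1) l"
  let ?d = "\<lambda>x. mat_diag i (\<lambda>l. x ^ ?e l) :: complex mat"
  have F: "?F \<in> carrier_mat (i+1) i" by (rule rep_spaceD(1)[OF flag_rep_rep_space i])
  have pow: "x ^ ?e l * q powi (- int (m i l)) = q powi (- int (m (i+1) l)) * (x / q) ^ ?e l" if "l < i" for l
  proof -
    have "m i l = m (i+1) l + ?e l" using m i that by (auto simp: valid_exponents_def)
    then have "q powi (- int (m i l)) = q powi (- int (m (i+1) l)) / q ^ ?e l"
      using q by (metis diff_conv_add_uminus minus_add_distrib of_nat_add power_int_diff power_int_of_nat)
    then show ?thesis by (simp add: power_divide)
  qed
  have Fd: "?F * ?d x = mat (i+1) i (\<lambda>(k, l). ?F $$ (k, l) * x ^ ?e l)" for x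
    by (rule mat_diag_mult_right[OF F])
  have "?F * ?d x * ?h i = mat (i+1) i (\<lambda>(k, l). ?F $$ (k, l) * x ^ ?e l * (u (I (l + 1)) * q powi (- int (m i l))))"
    unfolding Fd by (subst mat_diag_mult_right[of _ "i+1"]) (auto intro!: eq_matI)
  also have "\<dots> = frame_fixing n ?h (i + 1) * amap (torus_rep n u h (std_rep n I m (x / q))) i"
  proof (cases "i + 1 = n")
    \<comment> \<open>At the last step the framing itself carries u. The nonzero entries sit where
      \<open>k + 1 = I (l + 1)\<close>, so both sides have the same weight.\<close>
    case True
    have "m n l = 0" for l using m by (simp add: valid_exponents_def)
    then have mi: "m (i+1) l = 0" for l using True by simp
    have rhs: "frame_fixing n ?h (i + 1) * amap (torus_rep n u h (std_rep n I m (x / q))) i =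
        mat (i+1) i (\<lambda>(k, l). u (k + 1) * (?F $$ (k, l) * (x / q) ^ ?e l))"
    proof -
      have "mat_diag n (\<lambda>k. u (k + 1)) * (?F * ?d (x / q)) =
          mat (i+1) i (\<lambda>(k, l). u (k + 1) * (?F $$ (k, l) * (x / q) ^ ?e l))"
        unfolding Fd using True by (subst mat_diag_mult_left[of _ n i]) (auto intro!: eq_matI)
      then show ?thesis
        using True left_mult_one_mat[of _ n i] by (simp add: frame_fixing_def torus_rep_sel std_rep_def)
    qed
    show ?thesis
      unfolding rhs
    proof (rule cong_mat, simp_all del: One_nat_def, goal_cases)
      case (1 k l)
      have "x ^ m i l * q powi (- int (m i l)) = (x / q) ^ m i l" using pow[of l] 1 mi by simp
      moreover have "?F $$ (k, l) = (if k + 1 = I (l + 1) then 1 else 0)"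
        using 1 True by (simp add: flag_rep_def)
      ultimately show ?case using mi 1 by (auto simp: algebra_simps)
    qed
  next
    case False
    have rhs: "frame_fixing n ?h (i + 1) * amap (torus_rep n u h (std_rep n I m (x / q))) i =
        mat (i+1) i (\<lambda>(k, l). u (I (k + 1)) * q powi (- int (m (i+1) k)) * (?F $$ (k, l) * (x / q) ^ ?e l))"
    proof -
      have "mat_diag (i+1) (\<lambda>j. u (I (j + 1)) * q powi (- int (m (i+1) j))) * (?F * ?d (x / q)) =
         mat (i+1) i (\<lambda>(k, l). u (I (k + 1)) * q powi (- int (m (i+1) k)) * (?F $$ (k, l) * (x / q) ^ ?e l))"
        unfolding Fd by (subst mat_diag_mult_left[of _ "i+1" i]) (auto intro!: eq_matI)
      then show ?thesis
        using False by (simp add: frame_fixing_def torus_rep_sel std_rep_def)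
    qed
    show ?thesis
      unfolding rhs
    proof (rule cong_mat, simp_all del: One_nat_def, goal_cases)
      case (1 k l)
      have "?F $$ (k, l) = (if k = l then 1 else 0)"
        using 1 False by (simp add: flag_rep_def)
      then show ?case using pow[of l] 1 by (auto simp: algebra_simps)
    qed
  qed
  finally show "amap (std_rep n I m x) i * frame_fixing n ?h i =
      frame_fixing n ?h (i + 1) * amap (torus_rep n u h (std_rep n I m (x / q))) i"
    using i by (simp add: std_rep_def frame_fixing_def)
  have h: "frame_fixing n ?h i \<in> carrier_mat i i" "frame_fixing n ?h (i+1) \<in> carrier_mat (i+1) (i+1)"
    using i by (auto intro!: frame_fixing_carrier)
  have "bmap (torus_rep n u h (std_rep n I m (x / q))) i = 0\<^sub>m i (i+1)"
    by (simp add: torus_rep_sel std_rep_def left_mult_zero_mat[OF mat_diag_dim])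
  then show "bmap (std_rep n I m x) i * frame_fixing n ?h (i + 1) =
      frame_fixing n ?h i * bmap (torus_rep n u h (std_rep n I m (x / q))) i"
    using left_mult_zero_mat[OF h(2)] right_mult_zero_mat[OF h(1)] by (simp add: std_rep_def)
qed

lemma flag_rep_std: "flag_rep n I = std_rep n I (\<lambda>_ _. 0) 1"
  using rep_spaceD(1)[OF flag_rep_rep_space, of _ n I]
  by (simp add: std_rep_def flag_rep_def fun_eq_iff)

lemma flag_rep_torus:
  assumes I: "I permutes {1..n}" and u: "torus_point n u h q"
  shows "intertwines n (\<lambda>i. mat_diag i (\<lambda>j. u (I (j + 1)))) (torus_rep n u h (flag_rep n I)) (flag_rep n I)"
proof -
  have "std_rep n I (\<lambda>_ _. 0) (1 / q) = flag_rep n I"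
    unfolding flag_rep_std by (simp add: std_rep_def)
  then show ?thesis
    using std_rep_torus[OF I, of "\<lambda>_ _. 0" u h q 1] u by (simp add: valid_exponents_def flag_rep_std)
qed

section \<open>Isomorphisms of quasimaps\<close>

lemma det_mat_diag: "det (mat_diag n f) = (\<Prod>i<n. f i :: complex)"
proof -
  have "det (mat_diag n f) = prod_list (diag_mat (mat_diag n f))"
    by (rule det_upper_triangular) (auto simp: mat_diag_def)
  also have "diag_mat (mat_diag n f) = map f [0..<n]"
    by (auto simp: diag_mat_def mat_diag_def)
  also have "prod_list (map f [0..<n]) = (\<Prod>i<n. f i)"
    by (induction n) auto
  finally show ?thesis .
qed

definition qm_rel :: "nat \<Rightarrow> rep set \<Rightarrow> (quasimap \<times> quasimap) set" where
  "qm_rel n p = {(f, f'). f \<in> quasimaps_at n p \<and> f' \<in> quasimaps_at n p \<and>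
     (\<exists>h0 hinf. qm_iso_via n h0 hinf f f')}"

lemma QM_qm_rel: "QM n p = quasimaps_at n p // qm_rel n p"
  by (simp add: QM_def qm_rel_def)

lemma qm_isoD:
  assumes "qm_iso_via n h0 hinf f f'"
  shows "1 \<le> i \<Longrightarrow> i < n \<Longrightarrow> regular_mat i i (h0 i)"
    "1 \<le> i \<Longrightarrow> i < n \<Longrightarrow> regular_mat i i (hinf i)"
    "1 \<le> i \<Longrightarrow> i < n \<Longrightarrow> h0 i x \<in> carrier_mat i i"
    "1 \<le> i \<Longrightarrow> i < n \<Longrightarrow> hinf i x \<in> carrier_mat i i"
    "1 \<le> i \<Longrightarrow> i < n \<Longrightarrow> det (h0 i x) \<noteq> 0"
    "1 \<le> i \<Longrightarrow> i < n \<Longrightarrow> det (hinf i x) \<noteq> 0"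
    "1 \<le> i \<Longrightarrow> i < n \<Longrightarrow> x \<noteq> 0 \<Longrightarrow> hinf i (1 / x) * transition f i x = transition f' i x * h0 i x"
    "intertwines n (\<lambda>i. h0 i x) (sect0 f x) (sect0 f' x)"
    "intertwines n (\<lambda>i. hinf i x) (sectinf f x) (sectinf f' x)"
  using assms regular_mat_carrier unfolding qm_iso_via_def by auto

lemma qm_isoI:
  assumes "\<And>i. 1 \<le> i \<Longrightarrow> i < n \<Longrightarrow> regular_mat i i (h0 i)"
    "\<And>i. 1 \<le> i \<Longrightarrow> i < n \<Longrightarrow> regular_mat i i (hinf i)"
    "\<And>i x. 1 \<le> i \<Longrightarrow> i < n \<Longrightarrow> det (h0 i x) \<noteq> 0"
    "\<And>i x. 1 \<le> i \<Longrightarrow> i < n \<Longrightarrow> det (hinf i x) \<noteq> 0"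
    "\<And>i x. 1 \<le> i \<Longrightarrow> i < n \<Longrightarrow> x \<noteq> 0 \<Longrightarrow> hinf i (1 / x) * transition f i x = transition f' i x * h0 i x"
    "\<And>x. intertwines n (\<lambda>i. h0 i x) (sect0 f x) (sect0 f' x)"
    "\<And>x. intertwines n (\<lambda>i. hinf i x) (sectinf f x) (sectinf f' x)"
  shows "qm_iso_via n h0 hinf f f'"
  using assms unfolding qm_iso_via_def by auto

lemma qm_iso_refl:
  assumes "is_quasimap n f"
  shows "qm_iso_via n (\<lambda>i _. 1\<^sub>m i) (\<lambda>i _. 1\<^sub>m i) f f"
proof (rule qm_isoI)
  show "1\<^sub>m i * transition f i x = transition f i x * 1\<^sub>m i" if "1 \<le> i" "i < n" "x \<noteq> 0" for i x
    using left_mult_one_mat[OF transition_carrier[OF assms that]] right_mult_one_mat[OF transition_carrier[OF assms that]]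
    by simp
qed (use quasimapD[OF assms] in \<open>auto intro: regular_mat_const intertwines_refl\<close>)

lemma qm_iso_trans:
  assumes f: "is_quasimap n f" "is_quasimap n f'" "is_quasimap n f''"
    and h: "qm_iso_via n h0 hinf f f'" and k: "qm_iso_via n k0 kinf f' f''"
  shows "qm_iso_via n (\<lambda>i x. k0 i x * h0 i x) (\<lambda>i x. kinf i x * hinf i x) f f''"
proof (rule qm_isoI)
  note H = qm_isoD[OF h] and K = qm_isoD[OF k]
  fix i assume i: "1 \<le> i" "i < n"
  show "regular_mat i i (\<lambda>x. k0 i x * h0 i x)" "regular_mat i i (\<lambda>x. kinf i x * hinf i x)"
    using H(1,2)[OF i] K(1,2)[OF i] by (auto intro: regular_mat_mult)
  show "det (k0 i x * h0 i x) \<noteq> 0" "det (kinf i x * hinf i x) \<noteq> 0" for x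
    using det_mult[OF K(3)[OF i] H(3)[OF i], of x x] det_mult[OF K(4)[OF i] H(4)[OF i], of x x]
      H(5,6)[OF i, of x] K(5,6)[OF i, of x] by simp_all
  fix x :: complex assume x: "x \<noteq> 0"
  note T = transition_carrier[OF f(1) i x] transition_carrier[OF f(2) i x] transition_carrier[OF f(3) i x]
  have "kinf i (1 / x) * hinf i (1 / x) * transition f i x = kinf i (1 / x) * (hinf i (1 / x) * transition f i x)"
    by (rule assoc_mult_mat[OF K(4)[OF i] H(4)[OF i] T(1)])
  also have "\<dots> = kinf i (1 / x) * (transition f' i x * h0 i x)" by (simp only: H(7)[OF i x])
  also have "\<dots> = kinf i (1 / x) * transition f' i x * h0 i x"
    by (rule assoc_mult_mat[symmetric, OF K(4)[OF i] T(2) H(3)[OF i]])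
  also have "\<dots> = transition f'' i x * k0 i x * h0 i x" by (simp only: K(7)[OF i x])
  also have "\<dots> = transition f'' i x * (k0 i x * h0 i x)"
    by (rule assoc_mult_mat[OF T(3) K(3)[OF i] H(3)[OF i]])
  finally show "kinf i (1 / x) * hinf i (1 / x) * transition f i x = transition f'' i x * (k0 i x * h0 i x)" .
next
  note H = qm_isoD[OF h] and K = qm_isoD[OF k]
  show "intertwines n (\<lambda>i. k0 i x * h0 i x) (sect0 f x) (sect0 f'' x)" for x
    by (rule intertwines_trans[of _ n "sect0 f' x"]) (use H K quasimapD(8) f in auto)
  show "intertwines n (\<lambda>i. kinf i x * hinf i x) (sectinf f x) (sectinf f'' x)" for x
    by (rule intertwines_trans[of _ n "sectinf f' x"]) (use H K quasimapD(9) f in auto)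
qed

lemma qm_iso_sym:
  assumes f: "is_quasimap n f" "is_quasimap n f'" and h: "qm_iso_via n h0 hinf f f'"
  shows "\<exists>k0 kinf. qm_iso_via n k0 kinf f' f"
proof -
  note H = qm_isoD[OF h]
  have "\<forall>i. \<exists>N. 1 \<le> i \<and> i < n \<longrightarrow>
      regular_mat i i N \<and> (\<forall>x. h0 i x * N x = 1\<^sub>m i \<and> N x * h0 i x = 1\<^sub>m i \<and> det (N x) \<noteq> 0)"
  proof
    fix i
    show "\<exists>N. 1 \<le> i \<and> i < n \<longrightarrow>
        regular_mat i i N \<and> (\<forall>x. h0 i x * N x = 1\<^sub>m i \<and> N x * h0 i x = 1\<^sub>m i \<and> det (N x) \<noteq> 0)"
    proof (cases "1 \<le> i \<and> i < n")
      case True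
      then have i: "1 \<le> i" "i < n" by auto
      then show ?thesis using regular_inverse[OF H(1)[OF i] H(5)[OF i]] by simp
    qed blast
  qed
  from choice[OF this] obtain k0 where k0': "\<forall>i. 1 \<le> i \<and> i < n \<longrightarrow>
      regular_mat i i (k0 i) \<and> (\<forall>x. h0 i x * k0 i x = 1\<^sub>m i \<and> k0 i x * h0 i x = 1\<^sub>m i \<and> det (k0 i x) \<noteq> 0)" ..
  have k0: "\<And>i. 1 \<le> i \<Longrightarrow> i < n \<Longrightarrow> regular_mat i i (k0 i)"
    "\<And>i x. 1 \<le> i \<Longrightarrow> i < n \<Longrightarrow> h0 i x * k0 i x = 1\<^sub>m i"
    "\<And>i x. 1 \<le> i \<Longrightarrow> i < n \<Longrightarrow> k0 i x * h0 i x = 1\<^sub>m i"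
    "\<And>i x. 1 \<le> i \<Longrightarrow> i < n \<Longrightarrow> det (k0 i x) \<noteq> 0"
    using k0' by blast+
  have "\<forall>i. \<exists>N. 1 \<le> i \<and> i < n \<longrightarrow>
      regular_mat i i N \<and> (\<forall>x. hinf i x * N x = 1\<^sub>m i \<and> N x * hinf i x = 1\<^sub>m i \<and> det (N x) \<noteq> 0)"
  proof
    fix i
    show "\<exists>N. 1 \<le> i \<and> i < n \<longrightarrow>
        regular_mat i i N \<and> (\<forall>x. hinf i x * N x = 1\<^sub>m i \<and> N x * hinf i x = 1\<^sub>m i \<and> det (N x) \<noteq> 0)"
    proof (cases "1 \<le> i \<and> i < n")
      case True
      then have i: "1 \<le> i" "i < n" by auto
      then show ?thesis using regular_inverse[OF H(2)[OF i] H(6)[OF i]] by simp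
    qed blast
  qed
  from choice[OF this] obtain kinf where kinf': "\<forall>i. 1 \<le> i \<and> i < n \<longrightarrow>
      regular_mat i i (kinf i) \<and> (\<forall>x. hinf i x * kinf i x = 1\<^sub>m i \<and> kinf i x * hinf i x = 1\<^sub>m i \<and> det (kinf i x) \<noteq> 0)" ..
  have kinf: "\<And>i. 1 \<le> i \<Longrightarrow> i < n \<Longrightarrow> regular_mat i i (kinf i)"
    "\<And>i x. 1 \<le> i \<Longrightarrow> i < n \<Longrightarrow> hinf i x * kinf i x = 1\<^sub>m i"
    "\<And>i x. 1 \<le> i \<Longrightarrow> i < n \<Longrightarrow> kinf i x * hinf i x = 1\<^sub>m i"
    "\<And>i x. 1 \<le> i \<Longrightarrow> i < n \<Longrightarrow> det (kinf i x) \<noteq> 0"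
    using kinf' by blast+
  note kc = regular_mat_carrier[OF k0(1)] regular_mat_carrier[OF kinf(1)]
  have "qm_iso_via n k0 kinf f' f"
  proof (rule qm_isoI)
    fix i x assume i: "1 \<le> i" "i < n" and x: "x \<noteq> (0 :: complex)"
    show "kinf i (1 / x) * transition f' i x = transition f i x * k0 i x"
      by (rule inverse_intertwine[OF H(3)[OF i] kc(1)[OF i] H(4)[OF i] kc(2)[OF i]
            transition_carrier[OF f(1) i x] transition_carrier[OF f(2) i x] k0(2)[OF i] kinf(3)[OF i]
            H(7)[OF i x, symmetric], symmetric])
  next
    show "intertwines n (\<lambda>i. k0 i x) (sect0 f' x) (sect0 f x)" for x
      by (rule intertwines_sym[of _ n _ "\<lambda>i. h0 i x"]) (use H kc k0 quasimapD(8) f in auto)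
    show "intertwines n (\<lambda>i. kinf i x) (sectinf f' x) (sectinf f x)" for x
      by (rule intertwines_sym[of _ n _ "\<lambda>i. hinf i x"]) (use H kc kinf quasimapD(9) f in auto)
  qed (use k0 kinf in auto)
  then show ?thesis by blast
qed

lemma qm_iso_torus:
  assumes f: "is_quasimap n f" "is_quasimap n f'" and h: "qm_iso_via n h0 hinf f f'"
    and u: "torus_point n u h q"
  shows "qm_iso_via n (\<lambda>i x. h0 i (x / q)) (\<lambda>i x. hinf i (q * x)) (torus_qm n u h q f) (torus_qm n u h q f')"
proof (rule qm_isoI)
  have q: "q \<noteq> 0" using u by (simp add: torus_point_def)
  note H = qm_isoD[OF h]
  fix i assume i: "1 \<le> i" "i < n"
  show "regular_mat i i (\<lambda>x. h0 i (x / q))"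
    using regular_mat_compose[OF H(1)[OF i], of "1 / q"] by simp
  show "regular_mat i i (\<lambda>x. hinf i (q * x))"
    using regular_mat_compose[OF H(2)[OF i]] .
  show "det (h0 i (x / q)) \<noteq> 0" "det (hinf i (q * x)) \<noteq> 0" for x using H(5,6)[OF i] by auto
  fix x :: complex assume "x \<noteq> 0"
  then have "x / q \<noteq> 0" using q by simp
  from H(7)[OF i this] show "hinf i (q * (1 / x)) * transition (torus_qm n u h q f) i x =
      transition (torus_qm n u h q f') i x * h0 i (x / q)"
    by (simp add: torus_qm_sel)
next
  note H = qm_isoD[OF h]
  show "intertwines n (\<lambda>i. h0 i (x / q)) (sect0 (torus_qm n u h q f) x) (sect0 (torus_qm n u h q f') x)" for x
    unfolding torus_qm_sel by (rule torus_intertwines) (use H quasimapD(8) f in auto)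
  show "intertwines n (\<lambda>i. hinf i (q * x)) (sectinf (torus_qm n u h q f) x) (sectinf (torus_qm n u h q f') x)" for x
    unfolding torus_qm_sel by (rule torus_intertwines) (use H quasimapD(9) f in auto)
qed

lemma quasimaps_atD: "f \<in> quasimaps_at n p \<Longrightarrow> is_quasimap n f" "f \<in> quasimaps_at n p \<Longrightarrow> sectinf f 0 \<in> p"
  by (simp_all add: quasimaps_at_def)

lemma equiv_qm_rel: "equiv (quasimaps_at n p) (qm_rel n p)"
proof (rule equivI)
  show "refl_on (quasimaps_at n p) (qm_rel n p)"
    by (rule refl_onI) (use qm_iso_refl quasimaps_atD(1) in \<open>unfold qm_rel_def; blast\<close>)
  show "qm_rel n p \<subseteq> quasimaps_at n p \<times> quasimaps_at n p" by (auto simp: qm_rel_def)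
  show "sym (qm_rel n p)"
    by (rule symI) (use qm_iso_sym quasimaps_atD(1) in \<open>unfold qm_rel_def; blast\<close>)
  show "trans (qm_rel n p)"
    by (rule transI) (use qm_iso_trans quasimaps_atD(1) in \<open>unfold qm_rel_def; blast\<close>)
qed

section \<open>Quasimaps through a coordinate flag\<close>

lemma flag_pointD:
  assumes "r \<in> flag_point n I"
  shows "r \<in> mu_zero n" "semistable n r"
    and "\<exists>g. (\<forall>i\<in>{1..<n}. g i \<in> carrier_mat i i \<and> det (g i) \<noteq> 0) \<and> intertwines n g (flag_rep n I) r"
  using assms by (auto simp: flag_point_def gauge_rel_def)

lemma flag_rep_mu_zero: "flag_rep n I \<in> mu_zero n"
  by (rule mu_zero_of_bmap_0[OF flag_rep_rep_space]) (simp add: flag_rep_def)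

lemma flag_rep_semistable:
  assumes I: "I permutes {1..n}"
  shows "semistable n (flag_rep n I)"
proof (rule semistable_of_left_inverse[OF flag_rep_rep_space])
  fix i assume i: "1 \<le> i" "i < n"
  show "\<exists>Z\<in>carrier_mat i n. Z * frame_map n (flag_rep n I) i = 1\<^sub>m i"
    using flag_mat_left_inverse[OF I, of i] i by (auto simp: frame_map_flag intro!: bexI[of _ "transpose_mat (flag_mat n I i)"])
qed

lemma flag_rep_flag_point:
  assumes I: "I permutes {1..n}"
  shows "flag_rep n I \<in> flag_point n I"
proof -
  have "intertwines n (\<lambda>i. 1\<^sub>m i) (flag_rep n I) (flag_rep n I)"
    by (rule intertwines_refl[OF flag_rep_rep_space])
  then show ?thesis
    unfolding flag_point_def gauge_rel_def
    using flag_rep_mu_zero flag_rep_semistable[OF I] by (auto intro!: exI[of _ "\<lambda>i. 1\<^sub>m i"])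
qed

text \<open>The coordinate flag is fixed up to the diagonal base change by the u_{I_j}, and the
  action commutes with base changes, so the whole gauge class is preserved.\<close>

lemma flag_point_torus:
  assumes I: "I permutes {1..n}" and u: "torus_point n u h q" and r: "r \<in> flag_point n I"
  shows "torus_rep n u h r \<in> flag_point n I"
proof -
  note R = flag_pointD[OF r]
  have rs: "r \<in> rep_space n" using R(1) by (rule mu_zero_rep_space)
  obtain g where g': "\<forall>i\<in>{1..<n}. g i \<in> carrier_mat i i \<and> det (g i) \<noteq> 0"
    and "intertwines n g (flag_rep n I) r" using R(3) by blast
  then have g: "\<And>i. 1 \<le> i \<Longrightarrow> i < n \<Longrightarrow> g i \<in> carrier_mat i i"
    "\<And>i. 1 \<le> i \<Longrightarrow> i < n \<Longrightarrow> det (g i) \<noteq> 0" "intertwines n g (flag_rep n I) r" by auto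
  let ?F = "flag_rep n I" and ?d = "\<lambda>i. mat_diag i (\<lambda>j. u (I (j + 1)))" and ?d' = "\<lambda>i. mat_diag i (\<lambda>j. inverse (u (I (j + 1))))"
  have u0: "u (I (j + 1)) \<noteq> 0" if "j < n" for j
    using u permutes_in_image[OF I, of "j + 1"] that by (auto simp: torus_point_def)
  have "intertwines n ?d' ?F (torus_rep n u h ?F)"
    by (rule intertwines_sym[of _ n _ ?d, OF torus_rep_rep_space[OF flag_rep_rep_space] flag_rep_rep_space])
      (use u0 flag_rep_torus[OF I u] in \<open>auto intro!: mat_diag_inverse simp del: mat_diag_diag\<close>)
  moreover have "intertwines n g (torus_rep n u h ?F) (torus_rep n u h r)"
    using g rs by (intro torus_intertwines flag_rep_rep_space)
  ultimately have "intertwines n (\<lambda>i. g i * ?d' i) ?F (torus_rep n u h r)"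
    by (intro intertwines_trans[of _ n "torus_rep n u h ?F"]) (use g rs in \<open>auto intro: torus_rep_rep_space flag_rep_rep_space\<close>)
  moreover have "g i * ?d' i \<in> carrier_mat i i \<and> det (g i * ?d' i) \<noteq> 0" if i: "1 \<le> i" "i < n" for i
  proof
    show "g i * ?d' i \<in> carrier_mat i i" by (rule mult_carrier_mat[OF g(1)[OF i] mat_diag_dim])
    show "det (g i * ?d' i) \<noteq> 0"
      using det_mult[OF g(1)[OF i] mat_diag_dim, of "\<lambda>j. inverse (u (I (j + 1)))"] g(2)[OF i] u0 i
      by (simp add: det_mat_diag)
  qed
  ultimately show ?thesis
    unfolding flag_point_def gauge_rel_def
    using flag_rep_mu_zero flag_rep_semistable[OF I] torus_mu_zero[OF R(1) u] torus_semistable[OF rs u R(2)]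
    by (auto intro!: exI[of _ "\<lambda>i. g i * ?d' i"])
qed

lemma torus_quasimaps_at:
  assumes I: "I permutes {1..n}" and u: "torus_point n u h q" and f: "f \<in> quasimaps_at n (flag_point n I)"
  shows "torus_qm n u h q f \<in> quasimaps_at n (flag_point n I)"
  using torus_is_quasimap[OF quasimaps_atD(1)[OF f] u] flag_point_torus[OF I u quasimaps_atD(2)[OF f]]
  by (simp add: quasimaps_at_def torus_qm_sel)

lemma frame_std_left_inverse:
  assumes I: "I permutes {1..n}" and m: "valid_exponents n m" and x: "x \<noteq> 0" and i: "1 \<le> i" "i \<le> n"
  shows "\<exists>Z\<in>carrier_mat i n. Z * frame_map n (std_rep n I m x) i = 1\<^sub>m i"
proof (cases "i = n")
  case True
  then show ?thesis by (auto intro!: bexI[of _ "1\<^sub>m n"])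
next
  case False
  then have i': "i < n" using i by simp
  let ?d = "mat_diag i (\<lambda>j. inverse (x ^ m i j))" and ?d' = "mat_diag i (\<lambda>j. x ^ m i j)" and ?t = "transpose_mat (flag_mat n I i)"
  have t: "?t \<in> carrier_mat i n" by simp
  have "?d * ?t * (flag_mat n I i * ?d') = ?d * (?t * flag_mat n I i) * ?d'"
    using assoc_mult_mat[OF mult_carrier_mat[OF mat_diag_dim t] flag_mat_carrier mat_diag_dim]
      assoc_mult_mat[OF mat_diag_dim t flag_mat_carrier] by simp
  also have "\<dots> = 1\<^sub>m i"
    using flag_mat_left_inverse[OF I i(2)] x
    by (simp add: mat_diag_inverse right_mult_one_mat[OF mat_diag_dim] del: mat_diag_diag)
  finally show ?thesis
    unfolding frame_map_std[OF m i(1) i'] using mult_carrier_mat[OF mat_diag_dim t] by blast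
qed

lemma std_quasimaps_at:
  assumes I: "I permutes {1..n}" and m: "valid_exponents n m"
  shows "std_qm n I m \<in> quasimaps_at n (flag_point n I)"
proof -
  let ?f = "std_qm n I m"
  have mu: "std_rep n I m x \<in> mu_zero n" for x
    by (rule mu_zero_of_bmap_0[OF std_rep_rep_space]) (simp add: std_rep_def)
  have "is_quasimap n ?f"
    unfolding is_quasimap_def
  proof (intro conjI ballI allI impI)
    show "transition_mat i (transition ?f i)" if "i \<in> {1..<n}" for i
      unfolding transition_mat_def
    proof (intro conjI allI impI)
      fix k l assume kl: "k < i" "l < i"
      have "transition ?f i x $$ (k, l) = poly (if k = l then monom 1 (m i k) else 0) x / x ^ 0" for x
        using kl that by (simp add: std_qm_def mat_diag_def poly_monom)
      then show "\<exists>p d. \<forall>x. x \<noteq> 0 \<longrightarrow> transition ?f i x $$ (k, l) = poly p x / x ^ d" by blast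
    qed (use that in \<open>auto simp: std_qm_def det_mat_diag\<close>)
    show "transition ?f n x = 1\<^sub>m n" for x by (simp add: std_qm_def)
    show "regular_section n (sect0 ?f)"
      unfolding regular_section_def
    proof (intro ballI conjI)
      fix i assume "i \<in> {1..<n}"
      then have i: "1 \<le> i" "i < n" by auto
      have "regular_mat i i (\<lambda>x. mat_diag i (\<lambda>l. x ^ (m i l - m (i + 1) l)))"
        by (rule regular_mat_diag) (metis poly_monom mult_1_left)
      then show "regular_mat (i + 1) i (\<lambda>x. amap (sect0 ?f x) i)"
        using regular_mat_mult[OF regular_mat_const[OF rep_spaceD(1)[OF flag_rep_rep_space i]]]
        by (simp add: std_qm_def std_rep_def)
      show "regular_mat i (i + 1) (\<lambda>x. bmap (sect0 ?f x) i)"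
        by (simp add: std_qm_def std_rep_def regular_mat_const)
    qed
    show "regular_section n (sectinf ?f)"
      using rep_spaceD[OF flag_rep_rep_space] by (auto simp: regular_section_def std_qm_def intro!: regular_mat_const)
    show "intertwines n (\<lambda>i. transition ?f i x) (sect0 ?f x) (sectinf ?f (1 / x))" if x: "x \<noteq> 0" for x
      unfolding intertwines_def
    proof (intro ballI conjI)
      fix i assume "i \<in> {1..<n}"
      then have i: "1 \<le> i" "i < n" by auto
      let ?F = "amap (flag_rep n I) i"
      have F: "?F \<in> carrier_mat (i+1) i" by (rule rep_spaceD(1)[OF flag_rep_rep_space i])
      have t: "frame_fixing n (\<lambda>i. transition ?f i x) j = (if j = n then 1\<^sub>m n else mat_diag j (\<lambda>l. x ^ m j l))" for j
        by (simp add: frame_fixing_def std_qm_def)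
      \<comment> \<open>The transition x^m(i) is split into x^m(i+1), which moves past the flag map
        to vertex i + 1, and a remainder that belongs to the section near 0.\<close>
      have dF: "mat_diag i (\<lambda>l. x ^ m i l) = mat_diag i (\<lambda>l. x ^ m (i+1) l) * mat_diag i (\<lambda>l. x ^ (m i l - m (i+1) l))"
        unfolding mat_diag_diag using m i
        by (auto simp: mat_diag_def power_add[symmetric] valid_exponents_def intro!: eq_matI)
      have "?F * mat_diag i (\<lambda>l. x ^ m (i+1) l) = frame_fixing n (\<lambda>i. transition ?f i x) (i + 1) * ?F"
      proof (cases "i + 1 = n")
        case True
        then have "m (i+1) l = 0" for l using m by (simp add: valid_exponents_def)
        then show ?thesis using F True left_mult_one_mat[OF F] right_mult_one_mat[OF F] by (simp add: t)
      next
        case False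
        have "?F * mat_diag i (\<lambda>l. x ^ m (i+1) l) = mat_diag (i+1) (\<lambda>l. x ^ m (i+1) l) * ?F"
          unfolding mat_diag_mult_right[OF F] mat_diag_mult_left[OF F]
          using False by (auto simp: flag_rep_def intro!: cong_mat)
        then show ?thesis using False by (simp add: t)
      qed
      then have "?F * mat_diag i (\<lambda>l. x ^ m i l) = frame_fixing n (\<lambda>i. transition ?f i x) (i + 1) * ?F *
          mat_diag i (\<lambda>l. x ^ (m i l - m (i+1) l))"
        unfolding dF assoc_mult_mat[OF F mat_diag_dim mat_diag_dim, symmetric] by (simp only:)
      also have "\<dots> = frame_fixing n (\<lambda>i. transition ?f i x) (i + 1) * (?F * mat_diag i (\<lambda>l. x ^ (m i l - m (i+1) l)))"
        by (rule assoc_mult_mat[OF _ F mat_diag_dim]) (use i in \<open>auto simp: t\<close>)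
      finally have "?F * mat_diag i (\<lambda>l. x ^ m i l) = frame_fixing n (\<lambda>i. transition ?f i x) (i + 1) *
          (?F * mat_diag i (\<lambda>l. x ^ (m i l - m (i+1) l)))" .
      moreover have "amap (sectinf ?f (1 / x)) i = ?F"
        "amap (sect0 ?f x) i = ?F * mat_diag i (\<lambda>l. x ^ (m i l - m (i+1) l))"
        "frame_fixing n (\<lambda>i. transition ?f i x) i = mat_diag i (\<lambda>l. x ^ m i l)"
        using i by (simp_all add: t) (simp_all add: std_qm_def std_rep_def)
      ultimately show "amap (sectinf ?f (1 / x)) i * frame_fixing n (\<lambda>i. transition ?f i x) i =
          frame_fixing n (\<lambda>i. transition ?f i x) (i + 1) * amap (sect0 ?f x) i"
        by (simp only:)
      have c: "frame_fixing n (\<lambda>i. transition ?f i x) (i + 1) \<in> carrier_mat (i+1) (i+1)"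
        "frame_fixing n (\<lambda>i. transition ?f i x) i \<in> carrier_mat i i"
        using i by (auto simp: t)
      show "bmap (sectinf ?f (1 / x)) i * frame_fixing n (\<lambda>i. transition ?f i x) (i + 1) =
          frame_fixing n (\<lambda>i. transition ?f i x) i * bmap (sect0 ?f x) i"
        using left_mult_zero_mat[OF c(1)] right_mult_zero_mat[OF c(2)] by (simp add: std_qm_def std_rep_def flag_rep_def)
    qed
    show "sect0 ?f x \<in> mu_zero n" for x using mu by (simp add: std_qm_def)
    show "sectinf ?f x \<in> mu_zero n" for x using flag_rep_mu_zero by (simp add: std_qm_def)
    have "{x. \<not> semistable n (sect0 ?f x)} \<subseteq> {0}"
    proof
      fix x assume "x \<in> {x. \<not> semistable n (sect0 ?f x)}"
      then show "x \<in> {0}"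
        using semistable_of_left_inverse[OF std_rep_rep_space, of n I m x] frame_std_left_inverse[OF I m, of x]
        by (force simp: std_qm_def)
    qed
    then show "finite {x. \<not> semistable n (sect0 ?f x)}" by (rule finite_subset) simp
  qed
  then show ?thesis using flag_rep_flag_point[OF I] by (simp add: quasimaps_at_def std_qm_def)
qed

lemma std_qm_torus:
  assumes I: "I permutes {1..n}" and m: "valid_exponents n m" and u: "torus_point n u h q"
  shows "qm_iso_via n (\<lambda>i _. mat_diag i (\<lambda>j. u (I (j + 1)) * q powi (- int (m i j))))
    (\<lambda>i _. mat_diag i (\<lambda>j. u (I (j + 1)))) (torus_qm n u h q (std_qm n I m)) (std_qm n I m)"
proof (rule qm_isoI)
  have q: "q \<noteq> 0" using u by (simp add: torus_point_def)
  have u0: "u (I (j + 1)) \<noteq> 0" if "j < n" for j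
    using u permutes_in_image[OF I, of "j + 1"] that by (auto simp: torus_point_def)
  fix i assume i: "1 \<le> i" "i < n"
  show "regular_mat i i (\<lambda>_. mat_diag i (\<lambda>j. u (I (j + 1)) * q powi (- int (m i j))))"
    "regular_mat i i (\<lambda>_. mat_diag i (\<lambda>j. u (I (j + 1))))"
    by (rule regular_mat_const[OF mat_diag_dim])+
  show "det (mat_diag i (\<lambda>j. u (I (j + 1)) * q powi (- int (m i j)))) \<noteq> 0"
    "det (mat_diag i (\<lambda>j. u (I (j + 1)))) \<noteq> 0"
    using u0 q i by (auto simp: det_mat_diag)
  fix x :: complex assume x: "x \<noteq> 0"
  show "mat_diag i (\<lambda>j. u (I (j + 1))) * transition (torus_qm n u h q (std_qm n I m)) i x =
      transition (std_qm n I m) i x * mat_diag i (\<lambda>j. u (I (j + 1)) * q powi (- int (m i j)))"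
    using i q by (auto simp: torus_qm_sel std_qm_def power_divide power_int_minus field_simps intro!: arg_cong[of _ _ "mat_diag i"])
next
  show "intertwines n (\<lambda>i. mat_diag i (\<lambda>j. u (I (j + 1)) * q powi (- int (m i j))))
      (sect0 (torus_qm n u h q (std_qm n I m)) x) (sect0 (std_qm n I m) x)" for x
    using std_rep_torus[OF I m u] by (simp add: torus_qm_sel std_qm_def)
  show "intertwines n (\<lambda>i. mat_diag i (\<lambda>j. u (I (j + 1))))
      (sectinf (torus_qm n u h q (std_qm n I m)) x) (sectinf (std_qm n I m) x)" for x
    using flag_rep_torus[OF I u] by (simp add: torus_qm_sel std_qm_def)
qed

section \<open>Frames of quasimaps fixed by the torus\<close>

lemma pow_3_2_eq:
  assumes "(3 :: nat) ^ a * 2 ^ b = 3 ^ c * 2 ^ d"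
  shows "a = c \<and> b = d"
proof -
  have False if le: "b < d" and eq: "(3 :: nat) ^ a * 2 ^ b = 3 ^ c * 2 ^ d" for a b c d :: nat
  proof -
    have "(2::nat) ^ d = 2 ^ (d - b) * 2 ^ b" using le by (simp add: power_add[symmetric])
    then have "(3 :: nat) ^ a = 3 ^ c * 2 ^ (d - b)" using eq by simp
    moreover have "even ((3::nat) ^ c * 2 ^ (d - b))" using le by simp
    moreover have "odd ((3::nat) ^ a)" by simp
    ultimately show False by metis
  qed
  then have "b = d" using assms by (metis linorder_neqE_nat)
  then show ?thesis using assms by simp
qed

lemma pow_3_2_eq_complex:
  assumes "(3 :: complex) ^ a * 2 ^ b = 3 ^ c * 2 ^ d"
  shows "a = c \<and> b = d"
proof -
  have "of_nat ((3 :: nat) ^ a * 2 ^ b) = (of_nat (3 ^ c * 2 ^ d) :: complex)" using assms by simp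
  then show ?thesis using pow_3_2_eq of_nat_eq_iff by blast
qed

lemma pow_3_half_eq_complex:
  assumes "(3 :: complex) ^ a * (1 / 2) ^ b = 3 ^ c * (1 / 2) ^ d"
  shows "a = c \<and> b = d"
proof -
  have "(3 :: complex) ^ a * 2 ^ d = 3 ^ c * 2 ^ b"
    using assms by (simp add: power_divide field_simps)
  then show ?thesis using pow_3_2_eq_complex[of a d c b] by auto
qed

lemma frame_map_regular:
  assumes \<phi>: "regular_section n \<phi>" and i: "1 \<le> i" "i \<le> n"
  shows "regular_mat n i (\<lambda>x. frame_map n (\<phi> x) i)"
  using i(2,1)
proof (induction i rule: inc_induct)
  case base
  then show ?case by (simp add: regular_mat_const)
next
  case (step j)
  have "regular_mat (j + 1) j (\<lambda>x. amap (\<phi> x) j)" using \<phi> step by (auto simp: regular_section_def)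
  then show ?case using step by (simp add: frame_map_step regular_mat_mult)
qed

lemma left_inverse_of_det:
  fixes A :: "complex mat"
  assumes A: "A \<in> carrier_mat r r" and "det A \<noteq> 0"
  shows "\<exists>Z\<in>carrier_mat r r. Z * A = 1\<^sub>m r"
proof -
  note adj = adj_mat[OF A]
  have "((1 / det A) \<cdot>\<^sub>m adj_mat A) * A = (1 / det A) \<cdot>\<^sub>m (adj_mat A * A)"
    by (rule mult_smult_assoc_mat[OF adj(1) A])
  also have "\<dots> = 1\<^sub>m r" unfolding adj(3) using assms(2) by (intro eq_matI) auto
  finally show ?thesis using adj(1) by (intro bexI[of _ "(1 / det A) \<cdot>\<^sub>m adj_mat A"]) auto
qed

lemma flag_mat_cancel:
  assumes I: "I permutes {1..n}" and i: "i \<le> n"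
    and AB: "A \<in> carrier_mat i c" "B \<in> carrier_mat i c" "flag_mat n I i * A = flag_mat n I i * B"
  shows "A = B"
  by (rule left_cancel_mat[OF flag_mat_left_inverse[OF I i] _ flag_mat_carrier AB]) simp

lemma frame_left_inverse:
  assumes I: "I permutes {1..n}" and i: "i \<le> n" and A: "A \<in> carrier_mat i i" "det A \<noteq> 0"
  shows "\<exists>Z\<in>carrier_mat i n. Z * (flag_mat n I i * A) = 1\<^sub>m i"
proof -
  obtain Z where Z: "Z \<in> carrier_mat i i" "Z * A = 1\<^sub>m i" using left_inverse_of_det[OF A] by blast
  let ?t = "transpose_mat (flag_mat n I i)"
  have t: "?t \<in> carrier_mat i n" by simp
  have "Z * ?t * (flag_mat n I i * A) = Z * (?t * (flag_mat n I i * A))"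
    by (rule assoc_mult_mat[OF Z(1) t mult_carrier_mat[OF flag_mat_carrier A(1)]])
  also have "?t * (flag_mat n I i * A) = (?t * flag_mat n I i) * A"
    by (rule assoc_mult_mat[symmetric, OF t flag_mat_carrier A(1)])
  also have "\<dots> = A" unfolding flag_mat_left_inverse[OF I i] by (rule left_mult_one_mat[OF A(1)])
  finally show ?thesis using Z mult_carrier_mat[OF Z(1) t] by auto
qed

text \<open>
  The eigenvalues $3^{k+1} 2^m$, resp.\ $3^{k+1} 2^{-m}$, of this torus element on the monomials near
  \<open>\<infinity>\<close>, resp.\ near $0$, are pairwise distinct.
\<close>

definition generic_torus_fixed :: "nat \<Rightarrow> quasimap \<Rightarrow> bool" where
  "generic_torus_fixed n f \<longleftrightarrow> (\<exists>h0 hinf. qm_iso_via n h0 hinf (torus_qm n (\<lambda>k. 3 ^ k) 1 2 f) f)"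

text \<open>At y = 0 the columns span the coordinate flag, and eigencomponents of elements of the
  column module lie in the module. So it contains the constant vectors e_{I_j} themselves, that is,
  N = P V for the flag matrix N. Multiplying by the transpose of N shows that V is invertible, which
  leaves P = N X.\<close>

lemma frame_at_infinity:
  assumes I: "I permutes {1..n}" and f: "f \<in> quasimaps_at n (flag_point n I)"
    and fixed: "generic_torus_fixed n f" and i: "1 \<le> i" "i < n"
  shows "\<exists>X. regular_mat i i X \<and> (\<forall>y. det (X y) \<noteq> 0 \<and> frame_map n (sectinf f y) i = flag_mat n I i * X y)"
proof -
  have qm: "is_quasimap n f" using f by (rule quasimaps_atD)
  let ?N = "flag_mat n I i" and ?t = "transpose_mat (flag_mat n I i)"
  let ?u = "\<lambda>k. 3 ^ (k + 1) :: complex"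
  have t: "?t \<in> carrier_mat i n" by simp
  obtain h0 hinf where iso: "qm_iso_via n h0 hinf (torus_qm n (\<lambda>k. 3 ^ k) 1 2 f) f"
    using fixed by (auto simp: generic_torus_fixed_def)
  note H = qm_isoD[OF iso]
  have i': "i \<le> n" using i by simp
  obtain P where P: "P \<in> carrier_mat n i" "(\<lambda>y. frame_map n (sectinf f y) i) = eval_mat P"
    using frame_map_regular[OF quasimapD(4)[OF qm] i(1) i'] by (rule regular_matE)
  have P_eq: "frame_map n (sectinf f y) i = eval_mat P y" for y using fun_cong[OF P(2)] by simp
  obtain K where K: "K \<in> carrier_mat i i" "hinf i = eval_mat K" using H(2)[OF i] by (rule regular_matE)
  have "eval_mat (twist ?u 2 P) y = eval_mat (P * K) y" for y
  proof -
    have "frame_map n (sectinf f y) i * frame_fixing n (\<lambda>i. hinf i y) i =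
        frame_map n (sectinf (torus_qm n (\<lambda>k. 3 ^ k) 1 2 f) y) i"
      by (rule frame_map_intertwines[OF _ _ _ H(9) i(1) i'])
        (use H(4) quasimapD(9)[OF qm] in \<open>auto simp: torus_qm_sel intro: torus_rep_rep_space\<close>)
    then have "frame_map n (sectinf f y) i * hinf i y = mat_diag n ?u * frame_map n (sectinf f (2 * y)) i"
      using i frame_map_torus[OF quasimapD(9)[OF qm] i] by (simp add: frame_fixing_def torus_qm_sel)
    then show ?thesis
      unfolding eval_twist[OF P(1)] eval_mat_mult[OF P(1) K(1)] P_eq K(2) by simp
  qed
  then have tw: "twist ?u 2 P = P * K"
    by (intro eval_mat_eqI[OF twist_carrier[OF P(1)] mult_carrier_mat[OF P(1) K(1)]]) (simp add: infinite_UNIV_char_0)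
  have dist: "k = k' \<and> m = m'" if "?u k * 2 ^ m = ?u k' * 2 ^ m'" for k m k' m'
    using pow_3_2_eq_complex[OF that] by simp
  obtain g where g: "\<forall>i\<in>{1..<n}. g i \<in> carrier_mat i i \<and> det (g i) \<noteq> 0"
    "intertwines n g (flag_rep n I) (sectinf f 0)"
    using flag_pointD(3)[OF quasimaps_atD(2)[OF f]] by blast
  have gi: "g i \<in> carrier_mat i i" using g(1) i by auto
  have "frame_map n (sectinf f 0) i * frame_fixing n g i = frame_map n (flag_rep n I) i"
    by (rule frame_map_intertwines[OF flag_rep_rep_space quasimapD(9)[OF qm] _ g(2) i(1) i']) (use g(1) in auto)
  then have P0: "eval_mat P 0 * g i = ?N"
    using i by (simp add: frame_fixing_def frame_map_flag P_eq)
  let ?C = "map_mat (\<lambda>c. [:c:]) ?N"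
  have C: "?C \<in> carrier_mat n i" by simp
  have cols: "col ?C j \<in> poly_span P" if j: "j < i" for j
  proof -
    let ?k = "I (j + 1) - 1"
    have k: "?k < n" "?k + 1 = I (j + 1)" using permutes_index[OF I, of j] j i by auto
    \<comment> \<open>For this constant vector, P v at y = 0 is the j-th column of N. Its entry in
      row I_j thus has constant coefficient 1, which puts e_{I_j} into the module.\<close>
    let ?v = "map_vec (\<lambda>c. [:c:]) (col (g i) j)"
    have v: "?v \<in> carrier_vec i" by (rule carrier_vecI) (use gi in simp)
    have mem: "P *\<^sub>v ?v \<in> poly_span P" using P(1) v by (auto simp: poly_span_def)
    have "poly ((P *\<^sub>v ?v) $ ?k) 0 = (eval_mat P 0 * g i) $$ (?k, j)"
      using P(1) gi k j by (auto simp: scalar_prod_def poly_sum intro!: sum.cong)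
    also have "\<dots> = 1" unfolding P0 using k j by (simp add: flag_mat_def)
    finally have "coeff ((P *\<^sub>v ?v) $ ?k) 0 \<noteq> 0" by (simp add: poly_0_coeff_0)
    then have "monom 1 0 \<cdot>\<^sub>v unit_vec n ?k \<in> poly_span P"
      by (intro poly_span_monomials[OF P(1) K(1) tw _ mem k(1)]) (rule dist)
    moreover have "monom 1 0 \<cdot>\<^sub>v unit_vec n ?k = col ?C j"
      using k j by (intro eq_vecI) (auto simp: flag_mat_def)
    ultimately show ?thesis by simp
  qed
  obtain V where V: "V \<in> carrier_mat i i" "P * V = ?C" using poly_span_mat[OF P(1) C cols] by blast
  let ?X = "\<lambda>y. ?t * eval_mat P y"
  have X: "?X y \<in> carrier_mat i i" for y using mult_carrier_mat[OF t] P(1) by simp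
  have PV: "eval_mat P y * eval_mat V y = ?N" for y
    unfolding eval_mat_mult[OF P(1) V(1), symmetric] V(2) by (intro eq_matI) auto
  have XV: "?X y * eval_mat V y = 1\<^sub>m i" for y
  proof -
    have "?X y * eval_mat V y = ?t * (eval_mat P y * eval_mat V y)"
      by (rule assoc_mult_mat[OF t]) (use P V in auto)
    then show ?thesis unfolding PV using flag_mat_left_inverse[OF I i'] by simp
  qed
  have VX: "eval_mat V y * ?X y = 1\<^sub>m i" for y
    by (rule mat_mult_left_right_inverse[OF X _ XV]) (use V in auto)
  have "det (?X y) \<noteq> 0" for y
  proof
    assume "det (?X y) = 0"
    then have "det (?X y * eval_mat V y) = 0" using det_mult[OF X, of "eval_mat V y" y] V by simp
    then show False unfolding XV by simp
  qed
  moreover have "frame_map n (sectinf f y) i = ?N * ?X y" for y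
  proof -
    have "eval_mat P y = eval_mat P y * (eval_mat V y * ?X y)"
      unfolding VX using P(1) by (intro right_mult_one_mat[symmetric, of _ n]) simp
    also have "\<dots> = eval_mat P y * eval_mat V y * ?X y"
      by (rule assoc_mult_mat[symmetric, of _ n i _ i _ i]) (use P(1) V(1) X in auto)
    finally show ?thesis unfolding P_eq PV .
  qed
  moreover have "regular_mat i i ?X"
    by (rule regular_mat_mult[OF regular_mat_const[OF t] regular_mat_eval[OF P(1)]])
  ultimately show ?thesis by blast
qed

text \<open>For x \<noteq> 0 the composite is carried over from the chart at infinity, where its
  columns lie in the span of the flag matrix N. So near 0 it is N R with a square polynomial matrix
  R of nonzero determinant, and \<open>twist_stable_diagonal\<close> applies to R.\<close>

lemma frame_at_zero:
  assumes I: "I permutes {1..n}" and f: "f \<in> quasimaps_at n (flag_point n I)"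
    and fixed: "generic_torus_fixed n f" and i: "1 \<le> i" "i < n"
  shows "\<exists>m Q. regular_mat i i Q \<and> (\<forall>x. det (Q x) \<noteq> 0 \<and>
    frame_map n (sect0 f x) i = flag_mat n I i * (mat_diag i (\<lambda>j. x ^ m j) * Q x))"
proof -
  have qm: "is_quasimap n f" using f by (rule quasimaps_atD)
  let ?N = "flag_mat n I i" and ?t = "transpose_mat (flag_mat n I i)"
  let ?F = "\<lambda>x. frame_map n (sect0 f x) i"
  \<comment> \<open>Once N is factored out, the weights appear in the order of the flag.\<close>
  let ?u = "\<lambda>j. 3 ^ I (j + 1) :: complex"
  have t: "?t \<in> carrier_mat i n" by simp
  obtain h0 hinf where iso: "qm_iso_via n h0 hinf (torus_qm n (\<lambda>k. 3 ^ k) 1 2 f) f"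
    using fixed by (auto simp: generic_torus_fixed_def)
  note H = qm_isoD[OF iso]
  have i': "i \<le> n" using i by simp
  obtain X where X: "regular_mat i i X" "\<And>y. det (X y) \<noteq> 0" "\<And>y. frame_map n (sectinf f y) i = ?N * X y"
    using frame_at_infinity[OF I f fixed i] by blast
  note Xc = regular_mat_carrier[OF X(1)]
  have Freg: "regular_mat n i ?F" by (rule frame_map_regular[OF quasimapD(3)[OF qm] i(1) i'])
  note Fc = regular_mat_carrier[OF Freg]
  let ?R = "\<lambda>x. ?t * ?F x"
  have Rreg: "regular_mat i i ?R" by (rule regular_mat_mult[OF regular_mat_const[OF t] Freg])
  note Rc = regular_mat_carrier[OF Rreg]
  have F_trans: "?F x = ?N * (X (1 / x) * transition f i x)" if x: "x \<noteq> 0" for x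
  proof -
    have "frame_map n (sectinf f (1 / x)) i * frame_fixing n (\<lambda>i. transition f i x) i = ?F x"
      by (rule frame_map_intertwines[OF quasimapD(8)[OF qm] quasimapD(9)[OF qm] _ quasimapD(5)[OF qm x] i(1) i'])
        (rule transition_carrier[OF qm _ _ x])
    then show ?thesis
      using i assoc_mult_mat[OF flag_mat_carrier Xc transition_carrier[OF qm i x]] by (simp add: frame_fixing_def X(3))
  qed
  have XTc: "X (1 / x) * transition f i x \<in> carrier_mat i i" if "x \<noteq> 0" for x
    by (rule mult_carrier_mat[OF Xc transition_carrier[OF qm i that]])
  have R_trans: "?R x = X (1 / x) * transition f i x" if x: "x \<noteq> 0" for x
  proof -
    have "?R x = ?t * ?N * (X (1 / x) * transition f i x)"
      unfolding F_trans[OF x] by (rule assoc_mult_mat[symmetric, OF t flag_mat_carrier XTc[OF x]])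
    then show ?thesis
      unfolding flag_mat_left_inverse[OF I i'] using left_mult_one_mat[OF XTc[OF x]] by simp
  qed
  \<comment> \<open>Known for x \<noteq> 0, and extended to x = 0 since both sides are
    polynomial.\<close>
  have FNR: "?F x = ?N * ?R x" for x
  proof -
    have "?F = (\<lambda>x. ?N * ?R x)"
    proof (rule regular_mat_eqI[OF Freg regular_mat_mult[OF regular_mat_const[OF flag_mat_carrier] Rreg]])
      have "{x. x \<noteq> 0} \<subseteq> {x. ?F x = ?N * ?R x}" using F_trans R_trans by auto
      then show "infinite {x. ?F x = ?N * ?R x}" using infinite_nonzero_complex infinite_super by blast
    qed
    then show ?thesis by (rule fun_cong)
  qed
  obtain P where P: "P \<in> carrier_mat i i" "?R = eval_mat P" using Rreg by (rule regular_matE)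
  have P_eq: "?R x = eval_mat P x" for x using fun_cong[OF P(2)] by simp
  have detP: "det P \<noteq> 0"
  proof
    assume "det P = 0"
    then have "det (?R 1) = 0" unfolding P_eq det_eval_mat by simp
    moreover have "det (?R 1) = det (X (1 / 1)) * det (transition f i 1)"
      unfolding R_trans[OF one_neq_zero] using det_mult[OF Xc transition_carrier[OF qm i one_neq_zero]] .
    moreover have "det (transition f i 1) \<noteq> 0" using quasimapD(1)[OF qm i] by (simp add: transition_mat_def)
    ultimately show False using X(2) by simp
  qed
  obtain K where K: "K \<in> carrier_mat i i" "h0 i = eval_mat K" using H(1)[OF i] by (rule regular_matE)
  have "eval_mat (twist ?u (1 / 2) P) x = eval_mat (P * K) x" for x
  proof -
    have "?F x * frame_fixing n (\<lambda>i. h0 i x) i = frame_map n (sect0 (torus_qm n (\<lambda>k. 3 ^ k) 1 2 f) x) i"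
      by (rule frame_map_intertwines[OF _ _ _ H(8) i(1) i'])
        (use H(3) quasimapD(8)[OF qm] in \<open>auto simp: torus_qm_sel intro: torus_rep_rep_space\<close>)
    then have "?F x * h0 i x = mat_diag n (\<lambda>k. 3 ^ (k + 1)) * ?F (x / 2)"
      using i frame_map_torus[OF quasimapD(8)[OF qm] i] by (simp add: frame_fixing_def torus_qm_sel)
    then have "?N * ?R x * h0 i x = mat_diag n (\<lambda>k. 3 ^ (k + 1)) * (?N * ?R (x / 2))"
      unfolding FNR[symmetric] .
    also have "\<dots> = (mat_diag n (\<lambda>k. 3 ^ (k + 1)) * ?N) * ?R (x / 2)"
      by (rule assoc_mult_mat[symmetric, OF mat_diag_dim flag_mat_carrier Rc])
    also have "mat_diag n (\<lambda>k. 3 ^ (k + 1)) * ?N = ?N * mat_diag i ?u"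
      using flag_mat_diag[OF I i', of "\<lambda>k. 3 ^ k"] by simp
    also have "?N * mat_diag i ?u * ?R (x / 2) = ?N * (mat_diag i ?u * ?R (x / 2))"
      by (rule assoc_mult_mat[OF flag_mat_carrier mat_diag_dim Rc])
    finally have "?N * (?R x * h0 i x) = ?N * (mat_diag i ?u * ?R (x / 2))"
      unfolding assoc_mult_mat[OF flag_mat_carrier Rc H(3)[OF i]] .
    then have "?R x * h0 i x = mat_diag i ?u * ?R (x / 2)"
      by (rule flag_mat_cancel[OF I i' mult_carrier_mat[OF Rc H(3)[OF i]] mult_carrier_mat[OF mat_diag_dim Rc]])
    then show ?thesis
      unfolding eval_twist[OF P(1)] eval_mat_mult[OF P(1) K(1)] P_eq K(2) by simp
  qed
  \<comment> \<open>The factor 1/2 is due to q = 2: near 0 the translated section is evaluated at x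
    / q.\<close>
  then have tw: "twist ?u (1 / 2) P = P * K"
    by (intro eval_mat_eqI[OF twist_carrier[OF P(1)] mult_carrier_mat[OF P(1) K(1)]]) (simp add: infinite_UNIV_char_0)
  have dist: "k = k' \<and> m = m'" if "?u k * (1 / 2) ^ m = ?u k' * (1 / 2) ^ m'" for k m k' m'
    using pow_3_half_eq_complex[OF that] permutes_eq[OF I] by auto
  have "\<exists>m Q. Q \<in> carrier_mat i i \<and> P = mat_diag i (\<lambda>j. monom 1 (m j)) * Q \<and> (\<forall>x. det (eval_mat Q x) \<noteq> 0)"
    by (rule twist_stable_diagonal[OF P(1) detP K(1) tw]) (rule dist)
  then obtain m Q where Q: "Q \<in> carrier_mat i i" "P = mat_diag i (\<lambda>j. monom 1 (m j)) * Q" "\<And>x. det (eval_mat Q x) \<noteq> 0"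
    by blast
  have "?F x = ?N * (mat_diag i (\<lambda>j. x ^ m j) * eval_mat Q x)" for x
  proof -
    have "eval_mat P x = eval_mat (mat_diag i (\<lambda>j. monom 1 (m j))) x * eval_mat Q x"
      unfolding Q(2) by (rule eval_mat_mult[OF mat_diag_dim Q(1)])
    also have "eval_mat (mat_diag i (\<lambda>j. monom 1 (m j))) x = mat_diag i (\<lambda>j. x ^ m j)"
      by (intro eq_matI) (auto simp: mat_diag_def poly_monom)
    finally show ?thesis using FNR[of x, unfolded P_eq] by simp
  qed
  then show ?thesis using Q regular_mat_eval[OF Q(1)] by blast
qed

section \<open>From composites back to quasimaps\<close>

text \<open>Both sides agree after composition with the injective map from vertex i + 1 to the
  framing, which can be cancelled.\<close>

lemma intertwines_of_frames:
  assumes r: "r \<in> rep_space n" "r' \<in> rep_space n"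
    and h: "\<And>i. 1 \<le> i \<Longrightarrow> i < n \<Longrightarrow> h i \<in> carrier_mat i i"
    and frames: "\<And>i. 1 \<le> i \<Longrightarrow> i \<le> n \<Longrightarrow> frame_map n r i = frame_map n r' i * frame_fixing n h i"
    and inv: "\<And>i. 1 \<le> i \<Longrightarrow> i \<le> n \<Longrightarrow> \<exists>Z\<in>carrier_mat i n. Z * frame_map n r' i = 1\<^sub>m i"
    and i: "1 \<le> i" "i < n"
  shows "amap r' i * frame_fixing n h i = frame_fixing n h (i + 1) * amap r i"
proof -
  let ?h = "frame_fixing n h"
  have c: "?h i \<in> carrier_mat i i" "?h (i+1) \<in> carrier_mat (i+1) (i+1)"
    "frame_map n r' (i+1) \<in> carrier_mat n (i+1)"
    using i by (auto intro!: frame_fixing_carrier h frame_map_carrier r)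
  note A = rep_spaceD(1)[OF r(1) i] rep_spaceD(1)[OF r(2) i]
  obtain Z where Z: "Z \<in> carrier_mat (i+1) n" "Z * frame_map n r' (i+1) = 1\<^sub>m (i+1)"
    using inv[of "i+1"] i by auto
  have "frame_map n r' (i+1) * (amap r' i * ?h i) = frame_map n r' i * ?h i"
    unfolding frame_map_step[OF i(2)] by (rule assoc_mult_mat[symmetric, OF c(3) A(2) c(1)])
  also have "\<dots> = frame_map n r i" using frames[of i] i by simp
  also have "\<dots> = frame_map n r' (i+1) * ?h (i+1) * amap r i"
    unfolding frame_map_step[OF i(2)] using frames[of "i+1"] i by simp
  also have "\<dots> = frame_map n r' (i+1) * (?h (i+1) * amap r i)"
    by (rule assoc_mult_mat[OF c(3,2) A(1)])
  finally show ?thesis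
    by (rule left_cancel_mat[OF Z(2,1) c(3) mult_carrier_mat[OF A(2) c(1)] mult_carrier_mat[OF c(2) A(1)]])
qed

text \<open>The torus element with u = 1 and h = 2 leaves the A_i and hence the composites
  unchanged. By injectivity the intertwiner is the identity, so B_i = B_i / 2.\<close>

lemma bmap_0_of_scaling_fixed:
  assumes r: "r \<in> rep_space n" and h: "\<And>i. 1 \<le> i \<Longrightarrow> i < n \<Longrightarrow> h i \<in> carrier_mat i i"
    and eq: "intertwines n h (torus_rep n (\<lambda>_. 1) 2 r) r"
    and inv: "\<And>i. 1 \<le> i \<Longrightarrow> i < n \<Longrightarrow> \<exists>Z\<in>carrier_mat i n. Z * frame_map n r i = 1\<^sub>m i"
    and i: "1 \<le> i" "i < n"
  shows "bmap r i = 0\<^sub>m i (i + 1)"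
proof -
  have one: "h j = 1\<^sub>m j" if j: "1 \<le> j" "j < n" for j
  proof -
    have jn: "j \<le> n" using j by simp
    note F = frame_map_carrier[OF r j(1) jn]
    have "frame_map n r j * frame_fixing n h j = frame_map n (torus_rep n (\<lambda>_. 1) 2 r) j"
      by (rule frame_map_intertwines[OF torus_rep_rep_space[OF r] r h eq j(1) jn])
    also have "\<dots> = frame_map n r j"
      using frame_map_torus[OF r j] left_mult_one_mat[OF F] by simp
    finally have "frame_map n r j * h j = frame_map n r j * 1\<^sub>m j"
      using j right_mult_one_mat[OF F] by (simp add: frame_fixing_def)
    moreover obtain Z where "Z \<in> carrier_mat j n" "Z * frame_map n r j = 1\<^sub>m j" using inv[OF j] by blast
    ultimately show ?thesis using left_cancel_mat[of Z _ j n "h j" j "1\<^sub>m j"] F h[OF j] by simp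
  qed
  have ff: "frame_fixing n h j = 1\<^sub>m j" if "1 \<le> j" "j \<le> n" for j
    using that one[of j] by (auto simp: frame_fixing_def)
  note B = rep_spaceD(2)[OF r i]
  have "bmap (torus_rep n (\<lambda>_. 1) 2 r) i = (1 / 2) \<cdot>\<^sub>m bmap r i"
    using B right_mult_one_mat[OF B] by (auto simp: torus_rep_sel)
  moreover have "bmap (torus_rep n (\<lambda>_. 1) 2 r) i \<in> carrier_mat i (i + 1)"
    by (rule rep_spaceD(2)[OF torus_rep_rep_space[OF r] i])
  moreover have "bmap r i * 1\<^sub>m (i + 1) = 1\<^sub>m i * bmap (torus_rep n (\<lambda>_. 1) 2 r) i"
    using intertwinesD(2)[OF eq i] ff[of i] ff[of "i + 1"] i by simp
  ultimately have eq: "bmap r i = (1 / 2) \<cdot>\<^sub>m bmap r i"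
    using left_mult_one_mat[of "bmap (torus_rep n (\<lambda>_. 1) 2 r) i" i "i + 1"] right_mult_one_mat[OF B] by simp
  show ?thesis
  proof (rule eq_matI)
    fix k l assume "k < dim_row (0\<^sub>m i (i + 1))" "l < dim_col (0\<^sub>m i (i + 1))"
    then have kl: "k < i" "l < i + 1" by auto
    have "bmap r i $$ (k, l) = ((1 / 2) \<cdot>\<^sub>m bmap r i) $$ (k, l)" using eq by simp
    also have "\<dots> = 1 / 2 * bmap r i $$ (k, l)" using kl B by simp
    finally show "bmap r i $$ (k, l) = 0\<^sub>m i (i + 1) $$ (k, l)" using kl by simp
  qed (use B in auto)
qed

lemma power_le_of_poly:
  assumes "\<And>x :: complex. x ^ a = x ^ b * poly p x"
  shows "b \<le> a"
proof -
  have "poly (monom 1 a) x = poly (monom 1 b * p) x" for x :: complex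
    using assms[of x] by (simp add: poly_monom)
  then have eq: "monom 1 a = monom 1 b * p" by (metis poly_eq_poly_eq_iff ext)
  then have "p \<noteq> 0" by (metis monom_eq_0_iff mult_zero_right one_neq_zero)
  then have "degree (monom 1 b * p) = b + degree p"
    by (subst degree_mult_eq) (auto simp: degree_monom_eq)
  then show ?thesis using eq degree_monom_eq[of "1 :: complex" a] by simp
qed

section \<open>Classification of the fixed points\<close>

lemma mat_diag_cong: "(\<And>j. j < i \<Longrightarrow> f j = g j) \<Longrightarrow> mat_diag i f = mat_diag i g"
  by (auto simp: mat_diag_def intro!: eq_matI)

lemma mult_mat_diag_index:
  fixes B :: "complex mat"
  assumes "B \<in> carrier_mat r c" "k < r" "l < c"
  shows "(mat_diag r f * B) $$ (k, l) = f k * B $$ (k, l)" "(B * mat_diag c f) $$ (k, l) = B $$ (k, l) * f l"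
  using assms by (simp_all add: mat_diag_mult_left[OF assms(1)] mat_diag_mult_right[OF assms(1)])

text \<open>The isomorphism is read off from the frames: Q near 0 and X near infinity. The
  composites then agree by construction, and cancelling injective composites yields the conditions
  on the transition matrices and the A_i for x \<noteq> 0; near 0 the relations between the A_i
  extend to x = 0 as polynomial identities.\<close>

lemma torus_fixed_std:
  assumes I: "I permutes {1..n}" and f: "f \<in> quasimaps_at n (flag_point n I)"
    and fixed: "generic_torus_fixed n f"
    and scaling: "\<exists>h0 hinf. qm_iso_via n h0 hinf (torus_qm n (\<lambda>_. 1) 2 1 f) f"
  shows "\<exists>m. valid_exponents n m \<and> (\<exists>h0 hinf. qm_iso_via n h0 hinf f (std_qm n I m))"
proof -
  have qm: "is_quasimap n f" using f by (rule quasimaps_atD)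
  note r0 = quasimapD(8)[OF qm] and rinf = quasimapD(9)[OF qm]
  let ?in = "\<lambda>i. 1 \<le> i \<and> i < n"
  have "\<forall>i. \<exists>X. ?in i \<longrightarrow> regular_mat i i X \<and> (\<forall>y. det (X y) \<noteq> 0 \<and> frame_map n (sectinf f y) i = flag_mat n I i * X y)"
    using frame_at_infinity[OF I f fixed] by blast
  from choice[OF this] obtain X where X': "\<forall>i. ?in i \<longrightarrow> regular_mat i i (X i) \<and>
      (\<forall>y. det (X i y) \<noteq> 0 \<and> frame_map n (sectinf f y) i = flag_mat n I i * X i y)" ..
  have X: "\<And>i. 1 \<le> i \<Longrightarrow> i < n \<Longrightarrow> regular_mat i i (X i)"
    "\<And>i y. 1 \<le> i \<Longrightarrow> i < n \<Longrightarrow> det (X i y) \<noteq> 0"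
    "\<And>i y. 1 \<le> i \<Longrightarrow> i < n \<Longrightarrow> frame_map n (sectinf f y) i = flag_mat n I i * X i y"
    using X' by blast+
  have "\<forall>i. \<exists>mQ. ?in i \<longrightarrow> regular_mat i i (snd mQ) \<and> (\<forall>x. det (snd mQ x) \<noteq> 0 \<and>
      frame_map n (sect0 f x) i = flag_mat n I i * (mat_diag i (\<lambda>j. x ^ fst mQ j) * snd mQ x))"
    using frame_at_zero[OF I f fixed] by (metis fst_conv snd_conv)
  from choice[OF this] obtain mQ where mQ: "\<forall>i. ?in i \<longrightarrow> regular_mat i i (snd (mQ i)) \<and> (\<forall>x. det (snd (mQ i) x) \<noteq> 0 \<and>
      frame_map n (sect0 f x) i = flag_mat n I i * (mat_diag i (\<lambda>j. x ^ fst (mQ i) j) * snd (mQ i) x))" ..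
  define Q where "Q i = snd (mQ i)" for i
  \<comment> \<open>Set to zero outside the triangle, as \<open>valid_exponents\<close> requires;
    the diagonal matrix of size i only sees j < i.\<close>
  define m where "m i j = (if ?in i \<and> j < i then fst (mQ i) j else 0)" for i j
  have Q: "\<And>i. 1 \<le> i \<Longrightarrow> i < n \<Longrightarrow> regular_mat i i (Q i)"
    "\<And>i x. 1 \<le> i \<Longrightarrow> i < n \<Longrightarrow> det (Q i x) \<noteq> 0"
    using mQ unfolding Q_def by blast+
  let ?E = "\<lambda>i x. mat_diag i (\<lambda>j. x ^ m i j) :: complex mat"
  have F0: "frame_map n (sect0 f x) i = flag_mat n I i * (?E i x * Q i x)" if i: "1 \<le> i" "i < n" for i x
  proof -
    have "mat_diag i (\<lambda>j. x ^ fst (mQ i) j) = ?E i x" using i by (intro mat_diag_cong) (simp add: m_def)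
    then show ?thesis using mQ i unfolding Q_def by simp
  qed
  note Qc = regular_mat_carrier[OF Q(1)] and Xc = regular_mat_carrier[OF X(1)]
  have EQc: "?E i x * Q i x \<in> carrier_mat i i" if "1 \<le> i" "i < n" for i x
    by (rule mult_carrier_mat[OF mat_diag_dim Qc[OF that]])
  have inv0: "\<exists>Z\<in>carrier_mat i n. Z * frame_map n (sect0 f x) i = 1\<^sub>m i" if i: "1 \<le> i" "i < n" and x: "x \<noteq> 0" for i x
  proof -
    have "det (?E i x * Q i x) \<noteq> 0"
      using det_mult[OF mat_diag_dim Qc[OF i]] Q(2)[OF i] x by (simp add: det_mat_diag)
    then show ?thesis unfolding F0[OF i] using i by (intro frame_left_inverse[OF I _ EQc]) auto
  qed
  have invinf: "\<exists>Z\<in>carrier_mat i n. Z * frame_map n (sectinf f y) i = 1\<^sub>m i" if i: "1 \<le> i" "i < n" for i y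
    unfolding X(3)[OF i] using i by (intro frame_left_inverse[OF I _ Xc X(2)]) auto
  \<comment> \<open>The composite at i factors through the one at i + 1. After inverting Q at vertex
    i, the entry (j, j) reads x^m(i,j) = x^m(i+1,j) p(x) with a polynomial p.\<close>
  have mono: "m (i + 1) j \<le> m i j" if i: "1 \<le> i" "i < n" and j: "j < i" for i j
  proof (cases "i + 1 < n")
    case False
    then show ?thesis by (simp add: m_def)
  next
    case True
    then have i1: "1 \<le> i + 1" "i + 1 < n" by auto
    obtain K where K: "regular_mat i i K" "\<And>x. Q i x * K x = 1\<^sub>m i"
      using regular_inverse[OF Q(1)[OF i] Q(2)[OF i]] by blast
    note Kc = regular_mat_carrier[OF K(1)]
    let ?A = "\<lambda>x. amap (sect0 f x) i"
    have A: "regular_mat (i+1) i ?A" using quasimapD(3)[OF qm] i by (simp add: regular_section_def)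
    note Ac = regular_mat_carrier[OF A]
    have B: "regular_mat (i+1) i (\<lambda>x. Q (i+1) x * (?A x * K x))"
      by (intro regular_mat_mult[OF Q(1)[OF i1]] regular_mat_mult[OF A K(1)])
    note Bc = regular_mat_carrier[OF B]
    have eq: "flag_mat n I i * ?E i x = flag_mat n I (i+1) * (?E (i+1) x * (Q (i+1) x * (?A x * K x)))" for x
    proof -
      have AKc: "?A x * K x \<in> carrier_mat (i+1) i" by (rule mult_carrier_mat[OF Ac Kc])
      have "flag_mat n I i * ?E i x = flag_mat n I i * (?E i x * (Q i x * K x))"
        unfolding K(2) using right_mult_one_mat[OF mat_diag_dim[of i "\<lambda>j. x ^ m i j"]] by simp
      also have "\<dots> = flag_mat n I i * (?E i x * Q i x) * K x"
        by (simp only: assoc_mult_mat[OF flag_mat_carrier EQc[OF i] Kc] assoc_mult_mat[OF mat_diag_dim Qc[OF i] Kc])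
      also have "\<dots> = frame_map n (sect0 f x) (i+1) * ?A x * K x"
        unfolding F0[OF i, symmetric] frame_map_step[OF i(2)] ..
      also have "\<dots> = frame_map n (sect0 f x) (i+1) * (?A x * K x)"
        by (rule assoc_mult_mat[OF frame_map_carrier[OF r0] Ac Kc]) (use i in auto)
      also have "\<dots> = flag_mat n I (i+1) * (?E (i+1) x * Q (i+1) x * (?A x * K x))"
        unfolding F0[OF i1] by (rule assoc_mult_mat[OF flag_mat_carrier EQc[OF i1] AKc])
      also have "?E (i+1) x * Q (i+1) x * (?A x * K x) = ?E (i+1) x * (Q (i+1) x * (?A x * K x))"
        by (rule assoc_mult_mat[OF mat_diag_dim Qc[OF i1] AKc])
      finally show ?thesis .
    qed
    obtain P where P: "P \<in> carrier_mat (i+1) i" "(\<lambda>x. Q (i+1) x * (?A x * K x)) = eval_mat P"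
      using B by (rule regular_matE)
    have "x ^ m i j = x ^ m (i+1) j * poly (P $$ (j, j)) x" for x
    proof -
      have "(flag_mat n I i * ?E i x) $$ (I (j + 1) - 1, j) = ?E i x $$ (j, j)"
        using i j by (intro flag_mat_mult_index[OF I mat_diag_dim]) auto
      moreover have "(flag_mat n I (i+1) * (?E (i+1) x * (Q (i+1) x * (?A x * K x)))) $$ (I (j + 1) - 1, j) =
          (?E (i+1) x * (Q (i+1) x * (?A x * K x))) $$ (j, j)"
        using i j by (intro flag_mat_mult_index[OF I mult_carrier_mat[OF mat_diag_dim Bc]]) auto
      moreover have "(?E (i+1) x * (Q (i+1) x * (?A x * K x))) $$ (j, j) = x ^ m (i+1) j * (Q (i+1) x * (?A x * K x)) $$ (j, j)"
        using j by (intro mult_mat_diag_index(1)[OF Bc]) auto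
      moreover have "(Q (i+1) x * (?A x * K x)) $$ (j, j) = poly (P $$ (j, j)) x"
        using fun_cong[OF P(2), of x] P(1) j by simp
      ultimately show ?thesis using eq[of x] j by (simp add: mat_diag_def)
    qed
    then show ?thesis by (rule power_le_of_poly)
  qed
  have valid: "valid_exponents n m"
    unfolding valid_exponents_def using mono by (auto simp: m_def)
  obtain g0 ginf where g: "qm_iso_via n g0 ginf (torus_qm n (\<lambda>_. 1) 2 1 f) f" using scaling by blast
  \<comment> \<open>Near 0 the composite is known to be injective for x \<noteq> 0, so the vanishing
    at x = 0 comes from B_i being polynomial in x. Near infinity there is no exceptional
    point.\<close>
  have b0: "bmap (sect0 f x) i = 0\<^sub>m i (i + 1)" if i: "1 \<le> i" "i < n" for i x
  proof -
    have reg: "regular_mat i (i+1) (\<lambda>x. bmap (sect0 f x) i)" using quasimapD(3)[OF qm] i by (simp add: regular_section_def)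
    have "bmap (sect0 f x) i = 0\<^sub>m i (i + 1)" if x: "x \<noteq> 0" for x
      by (rule bmap_0_of_scaling_fixed[OF r0 _ _ _ i, where h = "\<lambda>i. g0 i x"])
        (use qm_isoD(3,8)[OF g] inv0 x in \<open>auto simp: torus_qm_sel\<close>)
    then have "{x. x \<noteq> 0} \<subseteq> {x. bmap (sect0 f x) i = 0\<^sub>m i (i + 1)}" by auto
    then have "infinite {x. bmap (sect0 f x) i = 0\<^sub>m i (i + 1)}" using infinite_nonzero_complex infinite_super by blast
    from regular_mat_eqI[OF reg regular_mat_const[OF zero_carrier_mat] this] show ?thesis by (rule fun_cong)
  qed
  have binf: "bmap (sectinf f y) i = 0\<^sub>m i (i + 1)" if i: "1 \<le> i" "i < n" for i y
    by (rule bmap_0_of_scaling_fixed[OF rinf _ _ _ i, where h = "\<lambda>i. ginf i y"])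
      (use qm_isoD(4,9)[OF g] invinf in \<open>auto simp: torus_qm_sel\<close>)
  have "qm_iso_via n Q X f (std_qm n I m)"
  proof (rule qm_isoI)
    fix i x assume i: "1 \<le> i" "i < n" and x: "x \<noteq> (0 :: complex)"
    have T: "transition f i x \<in> carrier_mat i i" by (rule transition_carrier[OF qm i x])
    have "frame_map n (sectinf f (1 / x)) i * frame_fixing n (\<lambda>i. transition f i x) i = frame_map n (sect0 f x) i"
      by (rule frame_map_intertwines[OF r0 rinf _ quasimapD(5)[OF qm x] i(1)])
        (use transition_carrier[OF qm _ _ x] i in auto)
    then have "flag_mat n I i * (X i (1 / x) * transition f i x) = flag_mat n I i * (?E i x * Q i x)"
      using i assoc_mult_mat[OF flag_mat_carrier Xc[OF i] T] by (simp add: frame_fixing_def X(3) F0)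
    then have "X i (1 / x) * transition f i x = ?E i x * Q i x"
      using i by (intro flag_mat_cancel[OF I _ mult_carrier_mat[OF Xc[OF i] T] EQc[OF i]]) auto
    then show "X i (1 / x) * transition f i x = transition (std_qm n I m) i x * Q i x"
      using i by (simp add: std_qm_def)
  next
    fix x :: complex
    have ffc: "frame_fixing n (\<lambda>i. Q i x) i \<in> carrier_mat i i" "frame_fixing n (\<lambda>i. X i x) i \<in> carrier_mat i i"
      if "1 \<le> i" "i \<le> n" for i
      using that Qc Xc by (auto intro!: frame_fixing_carrier)
    have A: "amap (std_rep n I m x) i * frame_fixing n (\<lambda>i. Q i x) i = frame_fixing n (\<lambda>i. Q i x) (i + 1) * amap (sect0 f x) i"
      if i: "1 \<le> i" "i < n" and x: "x \<noteq> 0" for i x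
    proof (rule intertwines_of_frames[OF r0 std_rep_rep_space _ _ frame_std_left_inverse[OF I valid x] i])
      show "frame_map n (sect0 f x) j = frame_map n (std_rep n I m x) j * frame_fixing n (\<lambda>i. Q i x) j" if j: "1 \<le> j" "j \<le> n" for j
      proof (cases "j = n")
        case True
        then show ?thesis by (simp add: frame_fixing_def)
      next
        case False
        then have j': "j < n" using j by simp
        show ?thesis
          unfolding F0[OF j(1) j'] frame_map_std[OF valid j(1) j'] using False
            assoc_mult_mat[OF flag_mat_carrier mat_diag_dim Qc[OF j(1) j']] by (simp add: frame_fixing_def)
      qed
    qed (use Qc in auto)
    have A': "amap (std_rep n I m x) i * frame_fixing n (\<lambda>i. Q i x) i = frame_fixing n (\<lambda>i. Q i x) (i + 1) * amap (sect0 f x) i"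
      if i: "1 \<le> i" "i < n" for i x
    proof -
      have stdreg: "regular_section n (sect0 (std_qm n I m))"
        by (rule quasimapD(3)[OF quasimaps_atD(1)[OF std_quasimaps_at[OF I valid]]])
      have ffreg: "regular_mat j j (\<lambda>x. frame_fixing n (\<lambda>i. Q i x) j)" if "1 \<le> j" "j \<le> n" for j
        using that Q(1)[of j] regular_mat_const[of "1\<^sub>m n :: complex mat" n n]
        by (cases "j = n") (auto simp: frame_fixing_def)
      have reg1: "regular_mat (i+1) i (\<lambda>x. amap (std_rep n I m x) i * frame_fixing n (\<lambda>i. Q i x) i)"
        by (rule regular_mat_mult[of _ i]) (use stdreg ffreg i in \<open>auto simp: regular_section_def std_qm_def\<close>)
      have reg2: "regular_mat (i+1) i (\<lambda>x. frame_fixing n (\<lambda>i. Q i x) (i + 1) * amap (sect0 f x) i)"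
        by (rule regular_mat_mult[of _ "i+1"]) (use quasimapD(3)[OF qm] ffreg i in \<open>auto simp: regular_section_def\<close>)
      have "{x. x \<noteq> 0} \<subseteq> {x. amap (std_rep n I m x) i * frame_fixing n (\<lambda>i. Q i x) i = frame_fixing n (\<lambda>i. Q i x) (i + 1) * amap (sect0 f x) i}"
        using A[OF i] by auto
      then have "infinite {x. amap (std_rep n I m x) i * frame_fixing n (\<lambda>i. Q i x) i = frame_fixing n (\<lambda>i. Q i x) (i + 1) * amap (sect0 f x) i}"
        using infinite_nonzero_complex infinite_super by blast
      from regular_mat_eqI[OF reg1 reg2 this] show ?thesis by (rule fun_cong)
    qed
    show "intertwines n (\<lambda>i. Q i x) (sect0 f x) (sect0 (std_qm n I m) x)"
      unfolding intertwines_def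
    proof (intro ballI)
      fix i assume "i \<in> {1..<n}"
      then have i: "1 \<le> i" "i < n" and i1: "1 \<le> i + 1" "i + 1 \<le> n" "i \<le> n" by auto
      show "amap (sect0 (std_qm n I m) x) i * frame_fixing n (\<lambda>i. Q i x) i = frame_fixing n (\<lambda>i. Q i x) (i + 1) * amap (sect0 f x) i \<and>
        bmap (sect0 (std_qm n I m) x) i * frame_fixing n (\<lambda>i. Q i x) (i + 1) = frame_fixing n (\<lambda>i. Q i x) i * bmap (sect0 f x) i"
        using A'[OF i, of x] left_mult_zero_mat[OF ffc(1)[OF i1(1,2)]] right_mult_zero_mat[OF ffc(1)[OF i(1) i1(3)]]
        by (simp add: b0[OF i] std_qm_def std_rep_def)
    qed
    have Ainf: "amap (flag_rep n I) i * frame_fixing n (\<lambda>i. X i x) i = frame_fixing n (\<lambda>i. X i x) (i + 1) * amap (sectinf f x) i"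
      if i: "1 \<le> i" "i < n" for i
    proof (rule intertwines_of_frames[OF rinf flag_rep_rep_space _ _ _ i])
      show "\<exists>Z\<in>carrier_mat j n. Z * frame_map n (flag_rep n I) j = 1\<^sub>m j" if j: "1 \<le> j" "j \<le> n" for j
        unfolding flag_rep_std by (rule frame_std_left_inverse[OF I _ _ j]) (auto simp: valid_exponents_def)
      show "frame_map n (sectinf f x) j = frame_map n (flag_rep n I) j * frame_fixing n (\<lambda>i. X i x) j" if j: "1 \<le> j" "j \<le> n" for j
        using j X(3)[of j] by (cases "j = n") (auto simp: frame_fixing_def frame_map_flag)
    qed (use Xc in auto)
    show "intertwines n (\<lambda>i. X i x) (sectinf f x) (sectinf (std_qm n I m) x)"
      unfolding intertwines_def
    proof (intro ballI)
      fix i assume "i \<in> {1..<n}"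
      then have i: "1 \<le> i" "i < n" and i1: "1 \<le> i + 1" "i + 1 \<le> n" "i \<le> n" by auto
      show "amap (sectinf (std_qm n I m) x) i * frame_fixing n (\<lambda>i. X i x) i = frame_fixing n (\<lambda>i. X i x) (i + 1) * amap (sectinf f x) i \<and>
        bmap (sectinf (std_qm n I m) x) i * frame_fixing n (\<lambda>i. X i x) (i + 1) = frame_fixing n (\<lambda>i. X i x) i * bmap (sectinf f x) i"
        using Ainf[OF i] left_mult_zero_mat[OF ffc(2)[OF i1(1,2)]] right_mult_zero_mat[OF ffc(2)[OF i(1) i1(3)]]
        by (simp add: binf[OF i] std_qm_def) (simp add: flag_rep_def)
    qed
  qed (use Q X in auto)
  then show ?thesis using valid by blast
qed

section \<open>Distinctness and degrees of the standard quasimaps\<close>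

lemma frame_map_qm_iso:
  assumes qm: "is_quasimap n f" "is_quasimap n f'" and h: "qm_iso_via n h0 hinf f f'" and i: "1 \<le> i" "i < n"
  shows "frame_map n (sect0 f' x) i * h0 i x = frame_map n (sect0 f x) i"
    "frame_map n (sectinf f' x) i * hinf i x = frame_map n (sectinf f x) i"
proof -
  note H = qm_isoD[OF h]
  have i': "i \<le> n" using i by simp
  have "frame_map n (sect0 f' x) i * frame_fixing n (\<lambda>i. h0 i x) i = frame_map n (sect0 f x) i"
    by (rule frame_map_intertwines[OF quasimapD(8)[OF qm(1)] quasimapD(8)[OF qm(2)] H(3) H(8) i(1) i'])
  then show "frame_map n (sect0 f' x) i * h0 i x = frame_map n (sect0 f x) i" using i by (simp add: frame_fixing_def)
  have "frame_map n (sectinf f' x) i * frame_fixing n (\<lambda>i. hinf i x) i = frame_map n (sectinf f x) i"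
    by (rule frame_map_intertwines[OF quasimapD(9)[OF qm(1)] quasimapD(9)[OF qm(2)] H(4) H(9) i(1) i'])
  then show "frame_map n (sectinf f' x) i * hinf i x = frame_map n (sectinf f x) i" using i by (simp add: frame_fixing_def)
qed

text \<open>The base change near 0 has polynomial entries, so x^m(i,j) is a polynomial multiple of
  x^m'(i,j). With the inverse isomorphism this makes the exponents invariants.\<close>

lemma std_qm_le:
  assumes I: "I permutes {1..n}" and m: "valid_exponents n m" "valid_exponents n m'"
    and h: "qm_iso_via n h0 hinf (std_qm n I m) (std_qm n I m')"
  shows "m' i j \<le> m i j"
proof (cases "1 \<le> i \<and> i < n \<and> j < i")
  case False
  then have "i \<notin> {1..<n} \<or> j \<ge> i" by auto
  then show ?thesis using m(2) unfolding valid_exponents_def by simp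
next
  case True
  then have i: "1 \<le> i" "i < n" and j: "j < i" and i': "i \<le> n" by auto
  note H = qm_isoD[OF h]
  note qm = quasimaps_atD(1)[OF std_quasimaps_at[OF I m(1)]] quasimaps_atD(1)[OF std_quasimaps_at[OF I m(2)]]
  obtain P where P: "P \<in> carrier_mat i i" "h0 i = eval_mat P" using H(1)[OF i] by (rule regular_matE)
  have "x ^ m i j = x ^ m' i j * poly (P $$ (j, j)) x" for x
  proof -
    have "flag_mat n I i * (mat_diag i (\<lambda>j. x ^ m' i j) * h0 i x) = flag_mat n I i * mat_diag i (\<lambda>j. x ^ m i j)"
      using frame_map_qm_iso(1)[OF qm h i, of x] assoc_mult_mat[OF flag_mat_carrier mat_diag_dim H(3)[OF i]]
      by (simp add: std_qm_def frame_map_std[OF m(1) i] frame_map_std[OF m(2) i])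
    then have "mat_diag i (\<lambda>j. x ^ m' i j) * h0 i x = mat_diag i (\<lambda>j. x ^ m i j)"
      by (rule flag_mat_cancel[OF I i' mult_carrier_mat[OF mat_diag_dim H(3)[OF i]] mat_diag_dim])
    then have "(mat_diag i (\<lambda>j. x ^ m' i j) * h0 i x) $$ (j, j) = mat_diag i (\<lambda>j. x ^ m i j) $$ (j, j)" by simp
    then show ?thesis
      using mult_mat_diag_index(1)[OF H(3)[OF i] j j] P j by (simp add: mat_diag_def)
  qed
  then show ?thesis by (rule power_le_of_poly)
qed

lemma std_qm_inj:
  assumes I: "I permutes {1..n}" and m: "valid_exponents n m" "valid_exponents n m'"
    and h: "qm_iso_via n h0 hinf (std_qm n I m) (std_qm n I m')"
  shows "m = m'"
proof (intro ext)
  fix i j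
  obtain k0 kinf where "qm_iso_via n k0 kinf (std_qm n I m') (std_qm n I m)"
    using qm_iso_sym[OF quasimaps_atD(1)[OF std_quasimaps_at[OF I m(1)]] quasimaps_atD(1)[OF std_quasimaps_at[OF I m(2)]] h]
    by blast
  then show "m i j = m' i j"
    using std_qm_le[OF I m h, of i j] std_qm_le[OF I m(2,1), of k0 kinf i j] by simp
qed

lemma power_int_2_inject:
  assumes "(2 :: complex) powi a = 2 powi b"
  shows "a = b"
proof -
  have *: "a \<ge> b" if "(2 :: complex) powi a = 2 powi b" for a b
  proof (rule ccontr)
    assume "\<not> a \<ge> b"
    then obtain k where k: "b = a + int k" "k > 0" by (metis not_le zless_iff_Suc_zadd zero_less_Suc)
    then have "(2 :: complex) powi b = 2 powi a * 2 ^ k" by (simp add: power_int_add)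
    then have "(2 :: complex) ^ k = 1" using that by simp
    then have "of_nat (2 ^ k) = (of_nat 1 :: complex)" by simp
    then have "(2 :: nat) ^ k = 1" by (simp only: of_nat_eq_iff)
    then show False using k by simp
  qed
  show ?thesis using *[OF assms] *[OF assms[symmetric]] by simp
qed

text \<open>Evaluation at 1 gives the constant and evaluation at 2 the exponent, so the definite
  description is unique.\<close>

lemma bundle_degree_eq:
  assumes "c \<noteq> 0" "\<And>x. x \<noteq> 0 \<Longrightarrow> det (g x) = c * x powi (- d)"
  shows "bundle_degree g = d"
  unfolding bundle_degree_def
proof (rule the_equality)
  show "\<exists>c. c \<noteq> 0 \<and> (\<forall>x. x \<noteq> 0 \<longrightarrow> det (g x) = c * x powi (- d))" using assms by blast
  fix d' assume "\<exists>c. c \<noteq> 0 \<and> (\<forall>x. x \<noteq> 0 \<longrightarrow> det (g x) = c * x powi (- d'))"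
  then obtain c' where c': "c' \<noteq> 0" "\<And>x. x \<noteq> 0 \<Longrightarrow> det (g x) = c' * x powi (- d')" by blast
  have "c = c'" using assms(2)[of 1] c'(2)[of 1] by simp
  then have "2 powi (- d) = (2 :: complex) powi (- d')" using assms(2)[of 2] c'(2)[of 2] assms(1) by simp
  then have "- d = - d'" by (rule power_int_2_inject)
  then show "d' = d" by simp
qed

text \<open>Regular base changes have constant determinants and so do not affect the exponent of x
  in the determinant of the transition matrix.\<close>

lemma std_degree:
  assumes I: "I permutes {1..n}" and m: "valid_exponents n m" and f: "is_quasimap n f"
    and h: "qm_iso_via n h0 hinf f (std_qm n I m)" and i: "1 \<le> i" "i < n"
  shows "bundle_degree (transition f i) = - (\<Sum>j<i. int (m i j))"
proof -
  note H = qm_isoD[OF h]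
  obtain c0 where c0: "c0 \<noteq> 0" "\<And>x. det (h0 i x) = c0" using regular_det_const[OF H(1)[OF i] H(5)[OF i]] by blast
  obtain c1 where c1: "c1 \<noteq> 0" "\<And>x. det (hinf i x) = c1" using regular_det_const[OF H(2)[OF i] H(6)[OF i]] by blast
  show ?thesis
  proof (rule bundle_degree_eq[of "c0 / c1"])
    show "c0 / c1 \<noteq> 0" using c0 c1 by simp
    fix x :: complex assume x: "x \<noteq> 0"
    have "det (hinf i (1 / x)) * det (transition f i x) = det (mat_diag i (\<lambda>j. x ^ m i j)) * det (h0 i x)"
      using H(7)[OF i x] i
        det_mult[OF H(4)[OF i] transition_carrier[OF f i x], of "1 / x"] det_mult[OF mat_diag_dim H(3)[OF i], of "\<lambda>j. x ^ m i j" x]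
      by (simp add: std_qm_def)
    then have "c1 * det (transition f i x) = (\<Prod>j<i. x ^ m i j) * c0"
      unfolding c0(2) c1(2) det_mat_diag .
    also have "(\<Prod>j<i. x ^ m i j) = x powi (- (- (\<Sum>j<i. int (m i j))))"
      by (simp add: power_sum[symmetric] flip: of_nat_sum)
    finally show "det (transition f i x) = c0 / c1 * x powi (- (- (\<Sum>j<i. int (m i j))))"
      using c1(1) by (simp add: field_simps)
  qed
qed

section \<open>Uniqueness of equivariant splittings\<close>

text \<open>The Leibniz formula has a nonzero summand. Its permutation will match the summands of an
  arbitrary equivariant splitting with those of the standard one.\<close>

lemma det_nonzero_permutation:
  fixes A :: "complex mat"
  assumes A: "A \<in> carrier_mat r r" and "det A \<noteq> 0"
  shows "\<exists>p. p permutes {0..<r} \<and> (\<forall>a<r. A $$ (a, p a) \<noteq> 0)"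
proof (rule ccontr)
  assume none: "\<not> ?thesis"
  have "signof p * (\<Prod>i = 0..<r. A $$ (i, p i)) = 0" if p: "p permutes {0..<r}" for p
  proof -
    obtain a where "a < r" "A $$ (a, p a) = 0" using none p by blast
    then have "(\<Prod>i = 0..<r. A $$ (i, p i)) = 0" by (intro prod_zero) auto
    then show ?thesis by simp
  qed
  then have "det A = 0" unfolding det_def'[OF A] by (intro sum.neutral) auto
  then show False using assms(2) by simp
qed

lemma eval_weight_single: "k \<in> {1..n} \<Longrightarrow> eval_weight n (u_weight k) u = u k"
proof -
  assume k: "k \<in> {1..n}"
  have "eval_weight n (u_weight k) u = (\<Prod>l=1..n. if l = k then u l else 1)"
    unfolding eval_weight_def u_weight_def by (intro prod.cong) (auto simp: lookup_single when_def)
  then show ?thesis using k by simp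
qed

text \<open>The points with one coordinate 2 and all others 1 read off the exponents one at a
  time.\<close>

lemma eval_weight_unique:
  assumes w: "Poly_Mapping.keys w \<subseteq> {1..n}" and k: "k \<in> {1..n}"
    and eq: "\<And>u. (\<And>l. u l \<noteq> 0) \<Longrightarrow> eval_weight n w u = u k"
  shows "w = u_weight k"
proof (rule poly_mapping_eqI)
  fix l
  show "Poly_Mapping.lookup w l = Poly_Mapping.lookup (u_weight k) l"
  proof (cases "l \<in> {1..n}")
    case True
    let ?u = "\<lambda>j. if j = l then 2 else 1 :: complex"
    have "eval_weight n w ?u = (\<Prod>j=1..n. if j = l then 2 powi Poly_Mapping.lookup w j else 1)"
      unfolding eval_weight_def by (intro prod.cong) auto
    also have "\<dots> = 2 powi Poly_Mapping.lookup w l" using True by simp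
    finally have "2 powi Poly_Mapping.lookup w l = ?u k" using eq[of ?u] by simp
    also have "\<dots> = 2 powi (if k = l then 1 else 0)" by simp
    finally have "Poly_Mapping.lookup w l = (if k = l then 1 else 0)" by (rule power_int_2_inject)
    then show ?thesis by (simp add: u_weight_def lookup_single when_def)
  next
    case False
    then have "Poly_Mapping.lookup w l = 0" using w by (auto simp: in_keys_iff)
    then show ?thesis using False k by (auto simp: u_weight_def lookup_single when_def)
  qed
qed

text \<open>If e < k, a positive power of x would divide the nonzero constant c.\<close>

lemma power_int_le_of_poly:
  assumes c: "c \<noteq> (0 :: complex)" and eq: "\<And>x. x \<noteq> 0 \<Longrightarrow> c * x powi e = x ^ k * poly p x"
  shows "int k \<le> e"
proof (rule ccontr)
  assume "\<not> int k \<le> e"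
  then obtain t where t: "int k = e + int t" "t > 0" by (metis not_le zless_iff_Suc_zadd zero_less_Suc)
  have "poly [:c:] x = poly (monom 1 t * p) x" if x: "x \<noteq> 0" for x
  proof -
    have "x ^ k = x powi e * x ^ t"
      using x t(1) by (metis power_int_add power_int_of_nat)
    then have "x powi e * c = x powi e * (x ^ t * poly p x)" using eq[OF x] by simp
    then have "c = x ^ t * poly p x" using x by simp
    then show ?thesis by (simp add: poly_monom)
  qed
  then have "{x. x \<noteq> 0} \<subseteq> {x. poly [:c:] x = poly (monom 1 t * p) x}" by auto
  then have "[:c:] = monom 1 t * p"
    using infinite_nonzero_complex infinite_super poly_eq_of_infinite by blast
  then have "poly [:c:] 0 = poly (monom 1 t * p) 0" by simp
  then show False using c t(2) by (simp add: poly_monom)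
qed

text \<open>This makes the definite description in \<open>virtual_half_tangent\<close> unique:
  weights and degrees of every splitting agree with the standard ones up to a permutation of the
  summands. For i = n the permutation comes from I itself, because a splitting lists the framing
  weights in the order u_1, ..., u_n.\<close>

lemma splitting_determined:
  assumes I: "I permutes {1..n}" and m: "valid_exponents n m" and f: "is_quasimap n f"
    and iso: "qm_iso_via n h0 hinf f (std_qm n I m)" and split: "equivariant_splitting n f w d"
    and i: "1 \<le> i" "i \<le> n"
  shows "\<exists>p. bij_betw p {..<i} {..<i} \<and> (\<forall>a<i. w i (p a) = u_weight (I (a + 1)) \<and> d i (p a) = - int (m i a))"
proof (cases "i = n")
  case True
  let ?p = "\<lambda>a. I (a + 1) - 1"
  have "bij_betw ?p {..<n} {..<n}"
  proof (rule bij_betw_imageI)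
    show "inj_on ?p {..<n}"
      using permutes_index(2)[OF I] permutes_eq[OF I] by (metis (no_types, lifting) inj_onI lessThan_iff)
    then show "?p ` {..<n} = {..<n}"
      using permutes_index(1)[OF I] by (intro endo_inj_surj) auto
  qed
  moreover have "w n (?p a) = u_weight (I (a + 1)) \<and> d n (?p a) = - int (m n a)" if "a < n" for a
    using split permutes_index[OF I that] m by (auto simp: equivariant_splitting_def valid_exponents_def)
  ultimately show ?thesis using True by blast
next
  case False
  then have i': "1 \<le> i" "i < n" "i \<le> n" using i by auto
  note H = qm_isoD[OF iso]
  have std: "is_quasimap n (std_qm n I m)" by (rule quasimaps_atD(1)[OF std_quasimaps_at[OF I m]])
  \<comment> \<open>\<open>hinf\<close> intertwines two diagonal actions, by the weights of the
    splitting on the right and those of the flag on the left. A nonzero entry at y = 0 thus forces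
    equal weights.\<close>
  have entry: "hinf i y $$ (a, j) * eval_weight n (w i j) u = u (I (a + 1)) * hinf i (q * y) $$ (a, j)"
    if u: "\<And>l. u l \<noteq> 0" and q: "q \<noteq> 0" and aj: "a < i" "j < i" for y u q a j
  proof -
    have tp: "torus_point n u 1 q" using u q by (simp add: torus_point_def)
    let ?W = "\<lambda>j. eval_weight n (w i j) u" and ?D = "mat_diag n (\<lambda>k. u (k + 1))" and ?N = "flag_mat n I i"
    let ?D' = "mat_diag i (\<lambda>j. u (I (j + 1)))"
    have S: "qm_iso_via n (\<lambda>i _. mat_diag i (\<lambda>j. eval_weight n (w i j) u * q powi d i j))
        (\<lambda>i _. mat_diag i (\<lambda>j. eval_weight n (w i j) u)) (torus_qm n u 1 q f) f"
      using split tp by (simp add: equivariant_splitting_def)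
    have F: "frame_map n (sectinf f y) i = ?N * hinf i y" for y
      using frame_map_qm_iso(2)[OF f std iso i'(1,2), of y] frame_map_flag[OF i'(1,2)] by (simp add: std_qm_def)
    have "?N * hinf i y * mat_diag i ?W = ?D * (?N * hinf i (q * y))"
      using frame_map_qm_iso(2)[OF torus_is_quasimap[OF f tp] f S i'(1,2), of y]
        frame_map_torus[OF quasimapD(9)[OF f] i'(1,2)] by (simp add: torus_qm_sel F)
    also have "\<dots> = ?D * ?N * hinf i (q * y)"
      by (rule assoc_mult_mat[symmetric, OF mat_diag_dim flag_mat_carrier H(4)[OF i'(1,2)]])
    also have "\<dots> = ?N * (?D' * hinf i (q * y))"
      unfolding flag_mat_diag[OF I i'(3)] by (rule assoc_mult_mat[OF flag_mat_carrier mat_diag_dim H(4)[OF i'(1,2)]])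
    finally have "?N * (hinf i y * mat_diag i ?W) = ?N * (?D' * hinf i (q * y))"
      unfolding assoc_mult_mat[OF flag_mat_carrier H(4)[OF i'(1,2)] mat_diag_dim] .
    then have "hinf i y * mat_diag i ?W = ?D' * hinf i (q * y)"
      by (rule flag_mat_cancel[OF I i'(3) mult_carrier_mat[OF H(4)[OF i'(1,2)] mat_diag_dim]
            mult_carrier_mat[OF mat_diag_dim H(4)[OF i'(1,2)]]])
    then have "(hinf i y * mat_diag i ?W) $$ (a, j) = (?D' * hinf i (q * y)) $$ (a, j)" by simp
    then show ?thesis
      using mult_mat_diag_index[OF H(4)[OF i'(1,2)] aj] by simp
  qed
  obtain p where p: "p permutes {0..<i}" "\<And>a. a < i \<Longrightarrow> hinf i 0 $$ (a, p a) \<noteq> 0"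
    using det_nonzero_permutation[OF H(4)[OF i'(1,2)] H(6)[OF i'(1,2)], of 0] by blast
  have pa: "p a < i" if "a < i" for a using permutes_in_image[OF p(1), of a] that by simp
  have weight: "w i (p a) = u_weight (I (a + 1))" if a: "a < i" for a
  proof (rule eval_weight_unique)
    show "Poly_Mapping.keys (w i (p a)) \<subseteq> {1..n}"
      using split i' pa[OF a] by (auto simp: equivariant_splitting_def)
    show "I (a + 1) \<in> {1..n}" using permutes_in_image[OF I, of "a + 1"] a i' by simp
    show "eval_weight n (w i (p a)) u = u (I (a + 1))" if "\<And>l. u l \<noteq> 0" for u
      using entry[OF that one_neq_zero a pa[OF a], of 0] p(2)[OF a] by (simp add: mult.commute)
  qed
  \<comment> \<open>With u = 1 the entry (a, p a) of \<open>hinf\<close> is invariant under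
    rescaling y, hence a nonzero constant. Only an inequality results at first, as this entry of
    \<open>h0\<close> might vanish at x = 0.\<close>
  have le: "int (m i a) \<le> - d i (p a)" if a: "a < i" for a
  proof -
    obtain P where P: "P \<in> carrier_mat i i" "hinf i = eval_mat P" using H(2)[OF i'(1,2)] by (rule regular_matE)
    obtain R where R: "R \<in> carrier_mat i i" "h0 i = eval_mat R" using H(1)[OF i'(1,2)] by (rule regular_matE)
    let ?P = "P $$ (a, p a)"
    have P': "hinf i y $$ (a, p a) = poly ?P y" for y using P a pa[OF a] by simp
    have "eval_weight n (w i (p a)) (\<lambda>_. 1) = 1" by (simp add: eval_weight_def)
    then have "poly ?P q = poly [:poly ?P 1:] q" if "q \<noteq> 0" for q
      using entry[of "\<lambda>_. 1" q a "p a" 1] that a pa[OF a] P' by simp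
    then have "{x. x \<noteq> 0} \<subseteq> {x. poly ?P x = poly [:poly ?P 1:] x}" by blast
    then have Pc: "?P = [:poly ?P 1:]"
      using infinite_nonzero_complex infinite_super poly_eq_of_infinite by blast
    have c: "poly ?P 1 \<noteq> 0"
      using p(2)[OF a] unfolding P' by (subst (asm) Pc) simp
    show ?thesis
    proof (rule power_int_le_of_poly[OF c])
      fix x :: complex assume x: "x \<noteq> 0"
      have T: "transition f i x = mat_diag i (\<lambda>j. x powi (- d i j))"
        using split i' x by (auto simp: equivariant_splitting_def)
      have "hinf i (1 / x) * mat_diag i (\<lambda>j. x powi (- d i j)) = mat_diag i (\<lambda>j. x ^ m i j) * h0 i x"
        using H(7)[OF i'(1,2) x] i' by (simp add: T std_qm_def)
      then have "(hinf i (1 / x) * mat_diag i (\<lambda>j. x powi (- d i j))) $$ (a, p a) = (mat_diag i (\<lambda>j. x ^ m i j) * h0 i x) $$ (a, p a)"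
        by simp
      then have "hinf i (1 / x) $$ (a, p a) * x powi (- d i (p a)) = x ^ m i a * h0 i x $$ (a, p a)"
        unfolding mult_mat_diag_index(2)[OF H(4)[OF i'(1,2)] a pa[OF a]] mult_mat_diag_index(1)[OF H(3)[OF i'(1,2)] a pa[OF a]] .
      moreover have "hinf i (1 / x) $$ (a, p a) = poly ?P 1" unfolding P' by (subst Pc) simp
      moreover have "h0 i x $$ (a, p a) = poly (R $$ (a, p a)) x" using R a pa[OF a] by simp
      ultimately show "poly ?P 1 * x powi (- d i (p a)) = x ^ m i a * poly (R $$ (a, p a)) x" by simp
    qed
  qed
  have bij: "bij_betw p {..<i} {..<i}" using permutes_imp_bij[OF p(1)] by (simp add: lessThan_atLeast0)
  \<comment> \<open>Both families of degrees add up to the degree of the bundle, which turns the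
    inequalities into equalities.\<close>
  have "bundle_degree (transition f i) = (\<Sum>j<i. d i j)"
  proof (rule bundle_degree_eq[of 1])
    fix x :: complex assume x: "x \<noteq> 0"
    have "transition f i x = mat_diag i (\<lambda>j. x powi (- d i j))"
      using split i' x by (auto simp: equivariant_splitting_def)
    moreover have "(\<Prod>j<k. x powi (- d i j)) = x powi (- (\<Sum>j<k. d i j))" for k
    proof (induction k)
      case (Suc k)
      have "x powi (- (\<Sum>j<k. d i j) + - d i k) = x powi (- (\<Sum>j<k. d i j)) * x powi (- d i k)"
        by (rule power_int_add) (use x in simp)
      then show ?case using Suc by simp
    qed simp
    ultimately show "det (transition f i x) = 1 * x powi (- (\<Sum>j<i. d i j))" by (simp add: det_mat_diag)
  qed simp
  then have "(\<Sum>j<i. d i j) = - (\<Sum>j<i. int (m i j))" using std_degree[OF I m f iso i'(1,2)] by simp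
  moreover have "(\<Sum>a<i. d i (p a)) = (\<Sum>j<i. d i j)" by (rule sum.reindex_bij_betw[OF bij])
  ultimately have sums: "(\<Sum>a<i. int (m i a)) = (\<Sum>a<i. - d i (p a))" by (simp add: sum_negf)
  have "int (m i a) = - d i (p a)" if "a < i" for a
    by (rule sum_mono_inv[OF sums]) (use le that in auto)
  then have "d i (p a) = - int (m i a)" if "a < i" for a using that by force
  then show ?thesis using bij weight by blast
qed

lemma polarization_cohomology_reindex:
  assumes "\<And>i. 1 \<le> i \<Longrightarrow> i \<le> n \<Longrightarrow> \<exists>p. bij_betw p {..<i} {..<i} \<and> (\<forall>a<i. w i (p a) = w' i a \<and> d i (p a) = d' i a)"
  shows "polarization_cohomology n w d = polarization_cohomology n w' d'"
proof -
  have reindex: "(\<Sum>j<a. \<Sum>k<b. line_cohomology (w b k - w a j) (d b k - d a j)) =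
      (\<Sum>j<a. \<Sum>k<b. line_cohomology (w' b k - w' a j) (d' b k - d' a j))"
    if ab: "1 \<le> a" "a \<le> n" "1 \<le> b" "b \<le> n" for a b
  proof -
    obtain p where p: "bij_betw p {..<a} {..<a}" "\<forall>j<a. w a (p j) = w' a j \<and> d a (p j) = d' a j"
      using assms ab by blast
    obtain r where r: "bij_betw r {..<b} {..<b}" "\<forall>k<b. w b (r k) = w' b k \<and> d b (r k) = d' b k"
      using assms ab by blast
    have "(\<Sum>j<a. \<Sum>k<b. line_cohomology (w b k - w a j) (d b k - d a j)) =
        (\<Sum>j<a. \<Sum>k<b. line_cohomology (w b k - w a (p j)) (d b k - d a (p j)))"
      by (rule sum.reindex_bij_betw[OF p(1), symmetric])
    also have "\<dots> = (\<Sum>j<a. \<Sum>k<b. line_cohomology (w b (r k) - w a (p j)) (d b (r k) - d a (p j)))"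
      by (rule sum.cong[OF refl], rule sum.reindex_bij_betw[OF r(1), symmetric])
    also have "\<dots> = (\<Sum>j<a. \<Sum>k<b. line_cohomology (w' b k - w' a j) (d' b k - d' a j))"
      using p r by (intro sum.cong) auto
    finally show ?thesis .
  qed
  show ?thesis
    unfolding polarization_cohomology_def by (intro arg_cong2[where f = "(-)"] sum.cong reindex) auto
qed

lemma intertwines_cong:
  assumes "\<And>i. 1 \<le> i \<Longrightarrow> i < n \<Longrightarrow> h i = h' i"
  shows "intertwines n h r r' \<longleftrightarrow> intertwines n h' r r'"
proof -
  have "frame_fixing n h i = frame_fixing n h' i" if "1 \<le> i" "i \<le> n" for i
    using that assms by (auto simp: frame_fixing_def)
  then show ?thesis unfolding intertwines_def by auto
qed

text \<open>The framing keeps its basis e_1, ..., e_n, whereas the bundles below it are split in the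
  order of the flag; hence the case distinction in the weights.\<close>

lemma std_equivariant_splitting:
  assumes I: "I permutes {1..n}" and m: "valid_exponents n m"
  shows "equivariant_splitting n (std_qm n I m)
    (\<lambda>i j. if i = n then u_weight (j + 1) else u_weight (I (j + 1))) (\<lambda>i j. - int (m i j))"
  unfolding equivariant_splitting_def
proof (intro conjI allI ballI impI)
  let ?w = "\<lambda>i j. if i = n then u_weight (j + 1) else u_weight (I (j + 1))"
  have In: "I (j + 1) \<in> {1..n}" if "j < n" for j using permutes_in_image[OF I, of "j + 1"] that by simp
  show "Poly_Mapping.keys (?w i j) \<subseteq> {1..n}" if "i \<in> {1..<n}" "j < i" for i j
    using that In[of j] by (auto simp: u_weight_def)
  fix u h q assume u: "torus_point n u h q"
  let ?h0 = "\<lambda>i (_ :: complex). mat_diag i (\<lambda>j. eval_weight n (?w i j) u * q powi (- int (m i j)))"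
    and ?hinf = "\<lambda>i (_ :: complex). mat_diag i (\<lambda>j. eval_weight n (?w i j) u)"
  have h0: "mat_diag i (\<lambda>j. u (I (j + 1)) * q powi (- int (m i j))) = ?h0 i 0" if "1 \<le> i" "i < n" for i
    using that In by (intro mat_diag_cong) (auto simp: eval_weight_single)
  have hinf: "mat_diag i (\<lambda>j. u (I (j + 1))) = ?hinf i 0" if "1 \<le> i" "i < n" for i
    using that In by (intro mat_diag_cong) (auto simp: eval_weight_single)
  have h0_cong: "intertwines n (\<lambda>i. mat_diag i (\<lambda>j. u (I (j + 1)) * q powi (- int (m i j)))) r r' =
      intertwines n (\<lambda>i. ?h0 i 0) r r'" for r r'
    by (rule intertwines_cong) (rule h0)
  have hinf_cong: "intertwines n (\<lambda>i. mat_diag i (\<lambda>j. u (I (j + 1)))) r r' =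
      intertwines n (\<lambda>i. ?hinf i 0) r r'" for r r'
    by (rule intertwines_cong) (rule hinf)
  note S = qm_isoD[OF std_qm_torus[OF I m u]]
  show "qm_iso_via n ?h0 ?hinf (torus_qm n u h q (std_qm n I m)) (std_qm n I m)"
  proof (rule qm_isoI)
    fix i assume i: "1 \<le> i" "i < n"
    show "regular_mat i i (?h0 i)" using S(1)[OF i] unfolding h0[OF i] .
    show "regular_mat i i (?hinf i)" using S(2)[OF i] unfolding hinf[OF i] .
    show "det (?h0 i x) \<noteq> 0" for x using S(5)[OF i] unfolding h0[OF i] .
    show "det (?hinf i x) \<noteq> 0" for x using S(6)[OF i] unfolding hinf[OF i] .
    show "?hinf i (1 / x) * transition (torus_qm n u h q (std_qm n I m)) i x = transition (std_qm n I m) i x * ?h0 i x"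
      if "x \<noteq> 0" for x
      using S(7)[OF i that] unfolding h0[OF i] hinf[OF i] .
  next
    show "intertwines n (\<lambda>i. ?h0 i x) (sect0 (torus_qm n u h q (std_qm n I m)) x) (sect0 (std_qm n I m) x)" for x
      using S(8)[of x] by (simp only: h0_cong)
    show "intertwines n (\<lambda>i. ?hinf i x) (sectinf (torus_qm n u h q (std_qm n I m)) x) (sectinf (std_qm n I m) x)" for x
      using S(9)[of x] by (simp only: hinf_cong)
  qed
qed (use m in \<open>auto simp: valid_exponents_def std_qm_def power_int_of_nat\<close>)

section \<open>Isomorphism classes of the standard quasimaps\<close>

definition std_class :: "nat \<Rightarrow> (nat \<Rightarrow> nat) \<Rightarrow> (nat \<Rightarrow> nat \<Rightarrow> nat) \<Rightarrow> quasimap set" where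
  "std_class n I m = qm_rel n (flag_point n I) `` {std_qm n I m}"

lemma std_classD:
  assumes I: "I permutes {1..n}" and m: "valid_exponents n m" and f: "f \<in> std_class n I m"
  shows "f \<in> quasimaps_at n (flag_point n I)" "\<exists>h0 hinf. qm_iso_via n h0 hinf f (std_qm n I m)"
proof -
  have rel: "(std_qm n I m, f) \<in> qm_rel n (flag_point n I)" using f by (simp add: std_class_def)
  then show "f \<in> quasimaps_at n (flag_point n I)" by (simp add: qm_rel_def)
  have "(f, std_qm n I m) \<in> qm_rel n (flag_point n I)"
    using equiv_qm_rel[of n "flag_point n I"] rel by (meson equivE symE)
  then show "\<exists>h0 hinf. qm_iso_via n h0 hinf f (std_qm n I m)" by (auto simp: qm_rel_def)
qed

lemma std_in_class:
  assumes I: "I permutes {1..n}" and m: "valid_exponents n m"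
  shows "std_qm n I m \<in> std_class n I m"
  unfolding std_class_def using equiv_class_self[OF equiv_qm_rel std_quasimaps_at[OF I m]] .

text \<open>By \<open>splitting_determined\<close> every splitting of every representative yields
  the same character. Listing the framing weights in the order of I as well is legitimate, since the
  sum runs over all of them.\<close>

lemma virtual_half_tangent_std:
  assumes I: "I permutes {1..n}" and m: "valid_exponents n m"
  shows "virtual_half_tangent n I (std_class n I m) =
    polarization_cohomology n (\<lambda>i j. u_weight (I (j + 1))) (\<lambda>i j. - int (m i j)) - polarization_at n I"
proof -
  have unique: "polarization_cohomology n w d = polarization_cohomology n (\<lambda>i j. u_weight (I (j + 1))) (\<lambda>i j. - int (m i j))"
    if f: "f \<in> std_class n I m" and split: "equivariant_splitting n f w d" for f w d
  proof (rule polarization_cohomology_reindex)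
    obtain h0 hinf where "qm_iso_via n h0 hinf f (std_qm n I m)" using std_classD(2)[OF I m f] by blast
    from splitting_determined[OF I m quasimaps_atD(1)[OF std_classD(1)[OF I m f]] this split]
    show "\<exists>p. bij_betw p {..<i} {..<i} \<and> (\<forall>a<i. w i (p a) = u_weight (I (a + 1)) \<and> d i (p a) = - int (m i a))"
      if "1 \<le> i" "i \<le> n" for i using that by blast
  qed
  show ?thesis
    unfolding virtual_half_tangent_def
  proof (rule the_equality)
    show "\<exists>f\<in>std_class n I m. \<exists>w d. equivariant_splitting n f w d \<and>
        polarization_cohomology n (\<lambda>i j. u_weight (I (j + 1))) (\<lambda>i j. - int (m i j)) - polarization_at n I =
        polarization_cohomology n w d - polarization_at n I"
      by (rule bexI[OF _ std_in_class[OF I m]], intro exI conjI, rule std_equivariant_splitting[OF I m])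
        (simp only: unique[OF std_in_class[OF I m] std_equivariant_splitting[OF I m]])
  qed (use unique in auto)
qed

lemma std_class_inj:
  assumes I: "I permutes {1..n}" and m: "valid_exponents n m" "valid_exponents n m'"
    and eq: "std_class n I m = std_class n I m'"
  shows "m = m'"
proof -
  have "std_qm n I m \<in> std_class n I m'" using std_in_class[OF I m(1)] eq by simp
  then obtain h0 hinf where "qm_iso_via n h0 hinf (std_qm n I m) (std_qm n I m')"
    using std_classD(2)[OF I m(2)] by blast
  then show ?thesis by (rule std_qm_inj[OF I m])
qed

lemma std_class_QM:
  assumes I: "I permutes {1..n}" and m: "valid_exponents n m"
  shows "std_class n I m \<in> QM n (flag_point n I)"
  unfolding QM_qm_rel std_class_def by (rule quotientI[OF std_quasimaps_at[OF I m]])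

lemma std_class_fixed:
  assumes I: "I permutes {1..n}" and m: "valid_exponents n m"
  shows "torus_fixed n (std_class n I m)"
  unfolding torus_fixed_def
proof (intro allI impI ballI)
  fix u h q f assume u: "torus_point n u h q" and f: "f \<in> std_class n I m"
  let ?p = "flag_point n I" and ?s = "std_qm n I m" and ?t = "torus_qm n u h q"
  note fq = std_classD(1)[OF I m f]
  note sq = std_quasimaps_at[OF I m]
  have tq: "?t f \<in> quasimaps_at n ?p" "?t ?s \<in> quasimaps_at n ?p"
    using torus_quasimaps_at[OF I u] fq sq by auto
  obtain h0 hinf where "qm_iso_via n h0 hinf f ?s" using std_classD(2)[OF I m f] by blast
  from qm_iso_torus[OF quasimaps_atD(1)[OF fq] quasimaps_atD(1)[OF sq] this u]
  have "(?t f, ?t ?s) \<in> qm_rel n ?p" using tq unfolding qm_rel_def by blast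
  moreover have "(?t ?s, ?s) \<in> qm_rel n ?p"
    using std_qm_torus[OF I m u] tq sq unfolding qm_rel_def by blast
  ultimately have "(?s, ?t f) \<in> qm_rel n ?p"
    using equiv_qm_rel[of n ?p] by (meson equivE symE transE)
  then show "?t f \<in> std_class n I m" by (simp add: std_class_def)
qed

text \<open>Invariance is applied to two torus elements, the generic one and the scaling of the B_i.
  Invertibility of isomorphisms gives them the direction from the translate to the quasimap.\<close>

lemma fixed_is_std_class:
  assumes I: "I permutes {1..n}" and F: "F \<in> QM n (flag_point n I)" and fixed: "torus_fixed n F"
  shows "\<exists>m. valid_exponents n m \<and> F = std_class n I m"
proof -
  let ?p = "flag_point n I"
  obtain f where f: "f \<in> quasimaps_at n ?p" "F = qm_rel n ?p `` {f}"
    using F unfolding QM_qm_rel by (rule quotientE)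
  have "f \<in> F" unfolding f(2) using equiv_class_self[OF equiv_qm_rel f(1)] .
  have inverse_iso: "\<exists>h0 hinf. qm_iso_via n h0 hinf (torus_qm n u h q f) f" if "torus_point n u h q" for u h q
  proof -
    have "torus_qm n u h q f \<in> F" using fixed that \<open>f \<in> F\<close> by (simp add: torus_fixed_def)
    then have "(f, torus_qm n u h q f) \<in> qm_rel n ?p" by (simp add: f(2))
    then have "(torus_qm n u h q f, f) \<in> qm_rel n ?p"
      using equiv_qm_rel[of n ?p] by (meson equivE symE)
    then show ?thesis by (auto simp: qm_rel_def)
  qed
  have "generic_torus_fixed n f"
    unfolding generic_torus_fixed_def by (rule inverse_iso) (simp add: torus_point_def)
  moreover have "\<exists>h0 hinf. qm_iso_via n h0 hinf (torus_qm n (\<lambda>_. 1) 2 1 f) f"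
    by (rule inverse_iso) (simp add: torus_point_def)
  ultimately obtain m where m: "valid_exponents n m" "\<exists>h0 hinf. qm_iso_via n h0 hinf f (std_qm n I m)"
    using torus_fixed_std[OF I f(1)] by blast
  then have "(f, std_qm n I m) \<in> qm_rel n ?p"
    using f(1) std_quasimaps_at[OF I m(1)] by (auto simp: qm_rel_def)
  then have "F = std_class n I m"
    unfolding f(2) std_class_def by (rule equiv_class_eq[OF equiv_qm_rel])
  then show ?thesis using m(1) by blast
qed

lemma std_class_degree:
  assumes I: "I permutes {1..n}" and m: "valid_exponents n m"
  shows "std_class n I m \<in> QM_degree n (flag_point n I) d \<longleftrightarrow> (\<forall>i\<in>{1..<n}. - (\<Sum>j<i. int (m i j)) = d i)"
proof -
  have deg: "bundle_degree (transition f i) = - (\<Sum>j<i. int (m i j))"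
    if f: "f \<in> std_class n I m" and i: "i \<in> {1..<n}" for f i
  proof -
    obtain h0 hinf where "qm_iso_via n h0 hinf f (std_qm n I m)" using std_classD(2)[OF I m f] by blast
    then show ?thesis
      using i by (intro std_degree[OF I m quasimaps_atD(1)[OF std_classD(1)[OF I m f]]]) auto
  qed
  then show ?thesis
    unfolding QM_degree_def using std_in_class[OF I m] std_class_QM[OF I m] by auto
qed

section \<open>The index\<close>

text \<open>The exponent of q after a_i = q^{s_i}: if the exponents of w sum to zero, its partial
  sums are the exponents of the a_i.\<close>

definition weight_slope :: "nat \<Rightarrow> (nat \<Rightarrow> real) \<Rightarrow> weight \<Rightarrow> real" where
  "weight_slope n s w = (\<Sum>i=1..n-1. s i * of_int (\<Sum>k=1..i. Poly_Mapping.lookup w k))"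

lemma decays_iff: "decays n s (w, m) \<longleftrightarrow> weight_slope n s w + of_int m < 0"
proof -
  let ?e = "\<lambda>i. (\<Sum>k=1..i. Poly_Mapping.lookup w k)" and ?a = "weight_slope n s w + of_int m"
  have eq: "(\<Prod>i=1..n-1. (q powr s i) powi ?e i) * q powi m = q powr ?a" if q: "q > 0" for q :: real
  proof -
    have powi: "(q powr a) powi e = exp (of_int e * (a * ln q))" for a e
      using q by (simp add: powr_def exp_power_int)
    have "(\<Prod>i=1..n-1. (q powr s i) powi ?e i) = exp (\<Sum>i=1..n-1. of_int (?e i) * (s i * ln q))"
      unfolding powi by (simp add: exp_sum)
    also have "(\<Sum>i=1..n-1. of_int (?e i) * (s i * ln q)) = weight_slope n s w * ln q"
      unfolding weight_slope_def sum_distrib_right by (intro sum.cong) auto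
    finally have "(\<Prod>i=1..n-1. (q powr s i) powi ?e i) = exp (weight_slope n s w * ln q)" .
    moreover have "q powi m = exp (of_int m * ln q)"
      using powi[of 1 m] q by simp
    ultimately show ?thesis using q by (simp add: powr_def exp_add[symmetric] distrib_right)
  qed
  have "decays n s (w, m) \<longleftrightarrow> ((\<lambda>q::real. q powr ?a) \<longlongrightarrow> 0) at_top"
    unfolding decays_def prod.case
    by (rule filterlim_cong[OF refl refl], rule eventually_mono[OF eventually_gt_at_top[of 0]]) (rule eq)
  also have "\<dots> \<longleftrightarrow> ?a < 0"
  proof
    assume "?a < 0"
    then show "((\<lambda>q::real. q powr ?a) \<longlongrightarrow> 0) at_top"
      by (rule tendsto_neg_powr) (rule filterlim_ident)
  next
    assume lim: "((\<lambda>q::real. q powr ?a) \<longlongrightarrow> 0) at_top"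
    show "?a < 0"
    proof (rule ccontr)
      assume "\<not> ?a < 0"
      then have "\<forall>\<^sub>F q in at_top. 1 \<le> (q::real) powr ?a"
        by (intro eventually_mono[OF eventually_ge_at_top[of 1]] ge_one_powr_ge_zero) auto
      then have "1 \<le> (0 :: real)"
        by (intro tendsto_lowerbound[OF lim]) auto
      then show False by simp
    qed
  qed
  finally show ?thesis .
qed

text \<open>Separating the count from \<open>virtual_half_tangent\<close> lets additivity reduce the
  index to single line bundles.\<close>

definition char_index :: "nat \<Rightarrow> (nat \<Rightarrow> real) \<Rightarrow> virtual_char \<Rightarrow> int" where
  "char_index n s \<chi> = (\<Sum>\<kappa>\<in>{\<kappa> \<in> Poly_Mapping.keys \<chi>. decays n s \<kappa>}. Poly_Mapping.lookup \<chi> \<kappa>)"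

lemma s_index_char_index: "s_index n s I F = char_index n s (virtual_half_tangent n I F)"
  by (simp add: s_index_def char_index_def)

lemma char_index_superset:
  assumes "finite A" "Poly_Mapping.keys \<chi> \<subseteq> A"
  shows "char_index n s \<chi> = (\<Sum>\<kappa>\<in>A. if decays n s \<kappa> then Poly_Mapping.lookup \<chi> \<kappa> else 0)"
proof -
  have "char_index n s \<chi> = (\<Sum>\<kappa>\<in>Poly_Mapping.keys \<chi>. if decays n s \<kappa> then Poly_Mapping.lookup \<chi> \<kappa> else 0)"
    unfolding char_index_def by (rule sum.inter_filter) simp
  also have "\<dots> = (\<Sum>\<kappa>\<in>A. if decays n s \<kappa> then Poly_Mapping.lookup \<chi> \<kappa> else 0)"
    using assms by (intro sum.mono_neutral_left) (auto simp: in_keys_iff)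
  finally show ?thesis .
qed

lemma char_index_add: "char_index n s (\<chi> + \<psi>) = char_index n s \<chi> + char_index n s \<psi>"
proof -
  let ?A = "Poly_Mapping.keys \<chi> \<union> Poly_Mapping.keys \<psi>"
  have "char_index n s (\<chi> + \<psi>) = (\<Sum>\<kappa>\<in>?A. if decays n s \<kappa> then Poly_Mapping.lookup (\<chi> + \<psi>) \<kappa> else 0)"
    using keys_add[of \<chi> \<psi>] by (intro char_index_superset) auto
  also have "\<dots> = char_index n s \<chi> + char_index n s \<psi>"
    by (subst (1 2) char_index_superset[of ?A]) (auto simp: lookup_add sum.distrib[symmetric] intro!: sum.cong)
  finally show ?thesis .
qed

lemma char_index_0: "char_index n s 0 = 0"
  by (simp add: char_index_def)

lemma char_index_diff: "char_index n s (\<chi> - \<psi>) = char_index n s \<chi> - char_index n s \<psi>"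
  using char_index_add[of n s "\<chi> - \<psi>" \<psi>] by simp

lemma char_index_sum: "char_index n s (\<Sum>a\<in>A. \<chi> a) = (\<Sum>a\<in>A. char_index n s (\<chi> a))"
  by (induction A rule: infinite_finite_induct) (simp_all add: char_index_0 char_index_add)

lemma char_index_monomial: "char_index n s (monomial w m) = (if decays n s (w, m) then 1 else 0)"
  by (subst char_index_superset[of "{(w, m)}"]) (auto simp: monomial_def)

text \<open>The cohomology is the signed interval from 0 to d + 1 of powers of q, reversed for
  negative d. A power q^m decays exactly if it lies below c, the ceiling of minus the slope. What is
  counted is therefore the signed length of the interval after both ends are cut off at c, and this
  covers both signs of d.\<close>

lemma char_index_line_cohomology:
  "char_index n s (line_cohomology w d) =
     min (d + 1) \<lceil>- weight_slope n s w\<rceil> - min 0 \<lceil>- weight_slope n s w\<rceil>"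
proof -
  let ?c = "\<lceil>- weight_slope n s w\<rceil>"
  have decays: "decays n s (w, m) \<longleftrightarrow> m < ?c" for m
    unfolding decays_iff less_ceiling_iff by linarith
  have card: "(\<Sum>m\<in>A. char_index n s (monomial w m)) = int (card {m\<in>A. m < ?c})" if "finite A" for A :: "int set"
    using that by (simp add: char_index_monomial decays sum.inter_filter[symmetric])
  have "{m\<in>{0..d}. m < ?c} = {0..<min (d + 1) ?c}" "{m\<in>{d+1..-1}. m < ?c} = {d+1..<min 0 ?c}" by auto
  then have "char_index n s (line_cohomology w d) = int (nat (min (d + 1) ?c)) - int (nat (min 0 ?c - (d + 1)))"
    by (simp add: line_cohomology_def char_index_diff char_index_sum card)
  then show ?thesis by linarith
qed

text \<open>
  The index at the array \<open>M\<close>, the degrees of the line bundles being $-M(i,j)$. The entries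
  $M(n,j)$, which belong to the framing, are zero.
\<close>

definition array_index :: "nat \<Rightarrow> (nat \<Rightarrow> real) \<Rightarrow> (nat \<Rightarrow> nat) \<Rightarrow> (nat \<times> nat \<Rightarrow> int) \<Rightarrow> int" where
  "array_index n s I M =
     (let c = \<lambda>k j. \<lceil>- weight_slope n s (u_weight (I (k + 1)) - u_weight (I (j + 1)))\<rceil> in
      (\<Sum>i=1..n-1. \<Sum>j<i. \<Sum>k<i+1. min (M (i, j) - M (i + 1, k) + 1) (c k j) - min 0 (c k j)) -
      (\<Sum>i=1..n-1. \<Sum>j<i. \<Sum>k<i. min (M (i, j) - M (i, k) + 1) (c k j) - min 0 (c k j)) -
      char_index n s (polarization_at n I))"

lemma array_index_eventually_linear: "eventually_linear X (array_index n s I)"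
  unfolding array_index_def Let_def
  by (intro eventually_linear_diff eventually_linear_sum eventually_linear_min eventually_linear_const)

lemma s_index_std_class:
  assumes "I permutes {1..n}" "valid_exponents n m"
  shows "s_index n s I (std_class n I m) = array_index n s I (\<lambda>(i, j). int (m i j))"
  unfolding s_index_char_index virtual_half_tangent_std[OF assms] polarization_cohomology_def array_index_def Let_def
    char_index_diff char_index_sum char_index_line_cohomology
  by (simp add: algebra_simps)

section \<open>The index vertex as a generating function\<close>

definition array_entries :: "nat \<Rightarrow> (nat \<times> nat) set" where
  "array_entries n = (SIGMA i:{1..<n}. {..<i})"

text \<open>Steps from vertex n - 1 to the framing are left out: there the inequality is
  nonnegativity, which is imposed on all entries separately.\<close>

definition array_steps :: "nat \<Rightarrow> ((nat \<times> nat) \<times> (nat \<times> nat)) set" where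
  "array_steps n = {((i, j), (i + 1, j)) | i j. 1 \<le> i \<and> i + 1 < n \<and> j < i}"

lemma row_sum:
  "(\<Sum>\<alpha>\<in>{\<alpha>\<in>array_entries n. fst \<alpha> = i}. M \<alpha>) = (if i \<in> {1..<n} then \<Sum>j<i. M (i, j) else (0 :: int))"
proof (cases "i \<in> {1..<n}")
  case True
  then have "{\<alpha>\<in>array_entries n. fst \<alpha> = i} = Pair i ` {..<i}" by (auto simp: array_entries_def)
  then show ?thesis using True by (simp add: sum.reindex inj_on_def)
next
  case False
  then have "{\<alpha>\<in>array_entries n. fst \<alpha> = i} = {}" by (auto simp: array_entries_def)
  then show ?thesis using False by (simp only: sum.empty if_False)
qed

text \<open>By the classification, fixed points of degree -\<gamma> correspond to the monotone
  nonnegative arrays with row sums \<gamma>. Integer entries are used because the shifts by sets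
  subtract; \<open>nat\<close> translates back to exponents.\<close>

lemma index_vertex_gen_series:
  assumes I: "I permutes {1..n}"
  shows "index_vertex n s I = gen_series (array_entries n) fst (\<lambda>M.
    if (\<forall>\<alpha>. M \<alpha> \<ge> 0) \<and> (\<forall>(\<alpha>, \<beta>)\<in>array_steps n. M \<beta> \<le> M \<alpha>)
    then (hbar / q_param) powi array_index n s I M else 0)"
proof
  fix \<gamma>
  let ?X = "array_entries n" and ?y = "hbar / q_param"
  let ?ok = "\<lambda>M. (\<forall>\<alpha>. M \<alpha> \<ge> (0 :: int)) \<and> (\<forall>(\<alpha>, \<beta>)\<in>array_steps n. M \<beta> \<le> M \<alpha>)"
  let ?W = "\<lambda>M. if ?ok M then ?y powi array_index n s I M else 0"
  have X: "finite ?X" by (simp add: array_entries_def)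
  show "index_vertex n s I \<gamma> = gen_series ?X fst ?W \<gamma>"
  proof (cases "Poly_Mapping.keys \<gamma> \<subseteq> {1..n-1}")
    case False
    then obtain i where i: "i \<in> Poly_Mapping.keys \<gamma>" and "i \<notin> {1..n-1}" by blast
    then have i': "i \<notin> {1..<n}" by auto
    \<comment> \<open>Row i is empty, so its sum cannot be a positive exponent; this matches the
      value 0 of \<open>index_vertex\<close>.\<close>
    have "arrays ?X fst \<gamma> = {}"
    proof (rule equals0I)
      fix M assume "M \<in> arrays ?X fst \<gamma>"
      then have "int (Poly_Mapping.lookup \<gamma> i) = (\<Sum>\<alpha>\<in>{\<alpha>\<in>?X. fst \<alpha> = i}. M \<alpha>)" unfolding arrays_def by blast
      then have "Poly_Mapping.lookup \<gamma> i = 0" unfolding row_sum if_not_P[OF i'] by simp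
      then show False using i by (simp add: in_keys_iff)
    qed
    then show ?thesis using False by (simp add: index_vertex_def gen_series_def)
  next
    case True
    let ?A = "{M\<in>arrays ?X fst \<gamma>. ?ok M}"
    let ?B = "{F \<in> QM_degree n (flag_point n I) (\<lambda>i. - int (Poly_Mapping.lookup \<gamma> i)). torus_fixed n F}"
    let ?m = "\<lambda>M i j. nat (M (i, j))"
    have entry: "(i, j) \<in> ?X \<longleftrightarrow> i \<in> {1..<n} \<and> j < i" for i j by (auto simp: array_entries_def)
    have A: "valid_exponents n (?m M)" "(\<lambda>(i, j). int (?m M i j)) = M" if M: "M \<in> ?A" for M
    proof -
      have nn: "M \<alpha> \<ge> 0" for \<alpha> using M by blast
      have zero: "M \<alpha> = 0" if "\<alpha> \<notin> ?X" for \<alpha> using M that unfolding arrays_def supported_def by blast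
      have "M (i + 1, j) \<le> M (i, j)" if i: "i \<in> {1..<n}" "j < i" for i j
      proof (cases "i + 1 < n")
        case True
        then have "((i, j), (i + 1, j)) \<in> array_steps n" using i by (auto simp: array_steps_def)
        then show ?thesis using M by blast
      next
        case False
        then show ?thesis using zero[of "(i + 1, j)"] nn[of "(i, j)"] entry by auto
      qed
      then show "valid_exponents n (?m M)"
        unfolding valid_exponents_def using zero entry by (auto simp: nat_mono)
      show "(\<lambda>(i, j). int (?m M i j)) = M" using nn by auto
    qed
    have bij: "bij_betw (\<lambda>M. std_class n I (?m M)) ?A ?B"
    proof (rule bij_betw_imageI)
      show "inj_on (\<lambda>M. std_class n I (?m M)) ?A"
      proof (rule inj_onI)
        fix M M' assume M: "M \<in> ?A" "M' \<in> ?A" and eq: "std_class n I (?m M) = std_class n I (?m M')"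
        have "?m M = ?m M'" by (rule std_class_inj[OF I A(1)[OF M(1)] A(1)[OF M(2)] eq])
        then have "nat (M (i, j)) = nat (M' (i, j))" for i j by (rule fun_cong[THEN fun_cong])
        then have "(\<lambda>(i, j). int (?m M i j)) = (\<lambda>(i, j). int (?m M' i j))" by (simp only:)
        then show "M = M'" unfolding A(2)[OF M(1)] A(2)[OF M(2)] .
      qed
      show "(\<lambda>M. std_class n I (?m M)) ` ?A = ?B"
      proof (intro Set.set_eqI iffI)
        fix F assume "F \<in> (\<lambda>M. std_class n I (?m M)) ` ?A"
        then obtain M where M: "M \<in> ?A" "F = std_class n I (?m M)" by blast
        have "- (\<Sum>j<i. int (?m M i j)) = - int (Poly_Mapping.lookup \<gamma> i)" if i: "i \<in> {1..<n}" for i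
        proof -
          have "int (Poly_Mapping.lookup \<gamma> i) = (\<Sum>\<alpha>\<in>{\<alpha>\<in>?X. fst \<alpha> = i}. M \<alpha>)"
            using M(1) unfolding arrays_def by blast
          also have "\<dots> = (\<Sum>j<i. M (i, j))" using i unfolding row_sum by simp
          also have "\<dots> = (\<Sum>j<i. int (?m M i j))" using M(1) by (intro sum.cong) auto
          finally show ?thesis by simp
        qed
        then show "F \<in> ?B"
          unfolding M(2) using std_class_degree[OF I A(1)[OF M(1)]] std_class_fixed[OF I A(1)[OF M(1)]] by simp
      next
        fix F assume F: "F \<in> ?B"
        then have "F \<in> QM n (flag_point n I)" "torus_fixed n F" by (auto simp: QM_degree_def)
        then obtain m where m: "valid_exponents n m" "F = std_class n I m"
          using fixed_is_std_class[OF I] by blast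
        let ?M = "\<lambda>(i, j). int (m i j)"
        have deg: "(\<Sum>j<i. int (m i j)) = int (Poly_Mapping.lookup \<gamma> i)" if "i \<in> {1..<n}" for i
          using F std_class_degree[OF I m(1)] that unfolding m(2) by fastforce
        have "int (Poly_Mapping.lookup \<gamma> i) = (\<Sum>\<alpha>\<in>{\<alpha>\<in>?X. fst \<alpha> = i}. ?M \<alpha>)" for i
        proof (cases "i \<in> {1..<n}")
          case False
          then have "i \<notin> {1..n-1}" by auto
          then have "i \<notin> Poly_Mapping.keys \<gamma>" using True by blast
          then show ?thesis unfolding row_sum if_not_P[OF False] by (simp add: in_keys_iff)
        qed (simp add: row_sum deg)
        moreover have "supported ?X ?M"
          using m(1) by (auto simp: supported_def valid_exponents_def array_entries_def)
        moreover have "\<forall>(\<alpha>, \<beta>)\<in>array_steps n. ?M \<beta> \<le> ?M \<alpha>"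
          using m(1) by (auto simp: array_steps_def valid_exponents_def)
        ultimately have "?M \<in> ?A" by (simp add: arrays_def split_def)
        moreover have "F = std_class n I (?m ?M)" unfolding m(2) by simp
        ultimately show "F \<in> (\<lambda>M. std_class n I (?m M)) ` ?A" by blast
      qed
    qed
    have "index_vertex n s I \<gamma> = (\<Sum>F\<in>?B. ?y powi s_index n s I F)"
      using True by (simp add: index_vertex_def)
    also have "\<dots> = (\<Sum>M\<in>?A. ?y powi s_index n s I (std_class n I (?m M)))"
      by (rule sum.reindex_bij_betw[OF bij, symmetric])
    also have "\<dots> = (\<Sum>M\<in>?A. ?y powi array_index n s I M)"
    proof (rule sum.cong[OF refl])
      fix M assume M: "M \<in> ?A"
      show "?y powi s_index n s I (std_class n I (?m M)) = ?y powi array_index n s I M"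
        unfolding s_index_std_class[OF I A(1)[OF M]] A(2)[OF M] ..
    qed
    also have "\<dots> = gen_series ?X fst ?W \<gamma>"
      unfolding gen_series_def by (rule sum.inter_filter[OF finite_arrays[OF X]])
    finally show ?thesis .
  qed
qed

theorem corollary1:
  fixes n :: nat and s :: "nat \<Rightarrow> real" and I :: "nat \<Rightarrow> nat"
  assumes "n \<ge> 2"
    and "big_enough n s"
    and "generic_slope n s"
    and "I permutes {1..n}"
  shows "is_rational_expansion n (index_vertex n s I)"
  unfolding index_vertex_gen_series[OF assms(4)]
  by (intro hbar_rational_is_rational monotone_arrays_rational array_index_eventually_linear)
    (auto simp: array_entries_def array_steps_def)

end
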